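(* Let $m\ge 0$ be an integer, suppose that $y\in\mathbb{C}$ is not a pole of the rational Painlevé-II function $p_m(y)$, and let $z=\left(\tfrac{2}{3}\right)^{1/3}y$. Then the unique solution $\mathbf{M}^m(\lambda,y)$ of the Riemann--Hilbert problem arising from Flaschka--Newell theory (Problem FN of the context) is related to the unique solution $\mathbf{Y}^m(\xi,z)$ of the Riemann--Hilbert problem arising from the Bertola--Bothner approach (Problem BB of the context) by an explicit elementary transformation with an explicit elementary inverse (namely the chain $\mathbf{M}^m\leftrightarrow\mathbf{P}^m\leftrightarrow\mathbf{Q}^m=\mathbf{C}^{m,1}\leftrightarrow\mathbf{C}^{m,0}=\mathbf{Y}^m$ whose formulas are given in the context).
   Context: Notation. $\sigma_1=\begin{bmatrix}0&1\\1&0\end{bmatrix}$, $\sigma_3=\begin{bmatrix}1&0\\0&-1\end{bmatrix}$, $\mathbb{I}$ is the $2\times2$ identity, $a^{n\sigma_3}=\mathrm{diag}(a^n,a^{-n})$. For $m\in\mathbb{Z}$, $p_m(y)$ is the unique rational solution of $p''=2p^3+\tfrac23yp-\tfrac23m$. Define $$\theta(\lambda,y):=2\lambda^3+y\lambda,\quad \mathbf{G}_m:=\begin{bmatrix}\alpha&(-1)^m\alpha\\(-1)^{m+1}(2\alpha)^{-1}&(2\alpha)^{-1}\end{bmatrix},\quad \nu'(\xi;z):=\frac{\mathrm{e}^{-\frac13\xi^{-3}+z\xi^{-1}}}{2\pi\mathrm{i}\,\xi},$$ where $\alpha\neq0$ is a constant (which may be taken to be $1$ without loss of generality). In all problems below,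 the unknown is a $2\times2$ matrix function analytic off the unit circle and taking continuous boundary values on it, with subscript $+$ (resp. $-$) for the boundary value from the interior (resp. exterior). Problem FN. Given $m\in\mathbb{Z}$, $y\in\mathbb{C}$, find $\mathbf{M}^m(\lambda,y)$ with $\mathbf{M}^m_+=\mathbf{M}^m_-\lambda^{m\sigma_3}\mathrm{e}^{-\mathrm{i}\theta(\lambda,y)\sigma_3}\mathbf{G}_m^{-1}\mathrm{e}^{\mathrm{i}\theta(\lambda,y)\sigma_3}\lambda^{-m\sigma_3}$ on $|\lambda|=1$ and $\mathbf{M}^m(\lambda,y)\lambda^{m\sigma_3}\to\mathbb{I}$ as $\lambda\to\infty$. It is solvable precisely when $y$ is not a pole of $p_m$. Problem BB. Given an integer $m\ge0$ and $z\in\mathbb{C}$, find $\mathbf{Y}^m(\xi,z)$ with $\mathbf{Y}^m_+=\mathbf{Y}^m_-\begin{bmatrix}1&\nu'(\xi;z)\\0&1\end{bmatrix}$ on $|\xi|=1$ and $\mathbf{Y}^m(\xi,z)\xi^{-m\sigma_3}\to\mathbb{I}$ as $\xi\to\infty$. Intermediate problem. Given $m,j\in\mathbb{Z}$ and $z\in\mathbb{C}$, find $\mathbf{C}^{m,j}(\xi,z)$ with $\mathbf{C}^{m,j}_+=\mathbf{C}^{m,j}_-\begin{bmatrix}1&\xi^j\nu'(\xi;z)\\0&1\end{bmatrix}$ on $|\xi|=1$ and $\mathbf{C}^{m,j}(\xi,z)\xi^{-m\sigma_3}\to\mathbb{I}$ as $\xi\to\infty$. Write $\mathbf{C}^{m,j}(\xi,z)=(\mathbb{I}+\mathbf{R}^{m,j}(z)\xi^{-1}+\mathcal{O}(\xi^{-2}))\xi^{m\sigma_3}$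 as $\xi\to\infty$. The formulas of the transformation. (a) $\mathbf{P}^m(\lambda,y):=\mathbf{M}^m(\lambda,y)$ for $|\lambda|>1$, and $\mathbf{P}^m(\lambda,y):=\mathbf{M}^m(\lambda,y)\begin{bmatrix}(2\alpha)^{-1}&(-1)^{m+1}\alpha\lambda^{2m}\mathrm{e}^{-2\mathrm{i}\theta(\lambda,y)}\\0&2\alpha\end{bmatrix}^{-1}$ for $|\lambda|<1$. (b) $\mathbf{Q}^m(\xi,z):=k^{\sigma_3}\sigma_1\mathbf{P}^m(0,y)^{-1}\mathbf{P}^m(c\xi^{-1},y)\xi^{-m\sigma_3}\sigma_1k^{-\sigma_3}$, where $y=(\tfrac32)^{1/3}z$, $c:=-\mathrm{i}\cdot12^{-1/3}$ and $k:=\mathrm{i}^{m+1}c^m/(\mathrm{e}^{\mathrm{i}\pi/4}\sqrt{2\pi})$. (c) $\mathbf{Q}^m(\xi,z)=\mathbf{C}^{m,1}(\xi,z)$ and $\mathbf{Y}^m(\xi,z)=\mathbf{C}^{m,0}(\xi,z)$. In the first identity it is understood that the jump circle of $\mathbf{Q}^m$, which is $|\xi|=|c|$, is moved to $|\xi|=1$; this is possible because the jump matrix is analytic for $\xi\ne0$, and it only multiplies $\mathbf{Q}^m$ on the right by that jump matrix between the two circles. (d) Decreasing $j$ (used with $j=0$): $$\mathbf{C}^{m,j}(\xi,z)=\begin{bmatrix}1&-C_{12}^{m,j+1}(0,z)C_{22}^{m,j+1}(0,z)^{-1}\\-R_{21}^{m,j+1}(z)&\xi+R_{21}^{m,j+1}(z)C_{12}^{m,j+1}(0,z)C_{22}^{m,j+1}(0,z)^{-1}\end{bmatrix}\mathbf{C}^{m,j+1}(\xi,z)\begin{bmatrix}1&0\\0&\xi^{-1}\end{bmatrix}.$$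 (e) Increasing $j$ (used with $j=0$): $$\mathbf{C}^{m,j+1}(\xi,z)=\begin{bmatrix}\xi+R_{12}^{m,j}(z)C_{21}^{m,j}(0,z)C_{11}^{m,j}(0,z)^{-1}&-R_{12}^{m,j}(z)\\-C_{21}^{m,j}(0,z)C_{11}^{m,j}(0,z)^{-1}&1\end{bmatrix}\mathbf{C}^{m,j}(\xi,z)\begin{bmatrix}\xi^{-1}&0\\0&1\end{bmatrix}.$$ Accompanying remark of the authors: for given $z$ it can happen that one of Problems FN and BB is solvable and the other is not; this occurs precisely when one of the denominators $C_{22}^{m,1}(0,z)$ in (d) or $C_{11}^{m,0}(0,z)$ in (e) vanishes. *)

theory Defs
  imports "HOL-Complex_Analysis.Complex_Analysis" "HOL-Library.Landau_Symbols"
begin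

type_synonym cmat2 = "complex ^ 2 ^ 2"

definition mat2 :: "complex \<Rightarrow> complex \<Rightarrow> complex \<Rightarrow> complex \<Rightarrow> cmat2" where
  "mat2 a b c d = vector [vector [a, b], vector [c, d]]"

definition sigma1 :: cmat2 where
  "sigma1 = mat2 0 1 1 0"

text \<open>The matrix \<open>a\<close> to the power \<open>n \<sigma>\<^sub>3\<close>; in particular
  \<open>exp (f \<sigma>\<^sub>3)\<close> is \<open>sigma3_pow (exp f) 1\<close>.\<close>

definition sigma3_pow :: "complex \<Rightarrow> int \<Rightarrow> cmat2" where
  "sigma3_pow a n = mat2 (a powi n) 0 0 (a powi (- n))"

subsection \<open>Rational solutions of the second Painleve equation\<close>

text \<open>The values of \<open>p\<close> at the finitely many zeros of the denominator are left free; poles are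
  meant in the sense of \<^const>\<open>is_pole\<close>, which does not depend on them.\<close>

definition rational_PII_solution :: "int \<Rightarrow> (complex \<Rightarrow> complex) \<Rightarrow> bool" where
  "rational_PII_solution m p \<longleftrightarrow>
     (\<exists>N D :: complex poly. D \<noteq> 0 \<and>
        (\<forall>y. poly D y \<noteq> 0 \<longrightarrow>
           p y = poly N y / poly D y \<and>
           deriv (deriv p) y = 2 * p y ^ 3 + 2/3 * y * p y - 2/3 * of_int m))"

subsection \<open>Riemann--Hilbert problems on the unit circle\<close>

text \<open>The unknown \<open>X\<close> is a total function whose values on the unit circle carry no
  information; \<open>Xp\<close> and \<open>Xm\<close> are its boundary values from the interior and the exterior,
  \<open>J\<close> is the jump matrix, and \<open>X w ** N w\<close> is normalized to the identity at infinity.\<close>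

definition RH_solution :: "(complex \<Rightarrow> cmat2) \<Rightarrow> (complex \<Rightarrow> cmat2) \<Rightarrow> (complex \<Rightarrow> cmat2) \<Rightarrow> bool" where
  "RH_solution J N X \<longleftrightarrow>
     (\<forall>i j. (\<lambda>w. X w $ i $ j) holomorphic_on (- sphere 0 1)) \<and>
     (\<exists>Xp Xm. continuous_on (sphere 0 1) Xp \<and> continuous_on (sphere 0 1) Xm \<and>
        (\<forall>s \<in> sphere 0 1.
           (X \<longlongrightarrow> Xp s) (at s within ball 0 1) \<and>
           (X \<longlongrightarrow> Xm s) (at s within - cball 0 1) \<and>
           Xp s = Xm s ** J s)) \<and>
     ((\<lambda>w. X w ** N w) \<longlongrightarrow> mat 1) at_infinity"

definition agree_off_circle :: "real \<Rightarrow> (complex \<Rightarrow> cmat2) \<Rightarrow> (complex \<Rightarrow> cmat2) \<Rightarrow> bool" where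
  "agree_off_circle r X X' \<longleftrightarrow> (\<forall>w. norm w \<noteq> r \<longrightarrow> X w = X' w)"

definition theta :: "complex \<Rightarrow> complex \<Rightarrow> complex" where
  "theta l y = 2 * l ^ 3 + y * l"

definition Gmat :: "complex \<Rightarrow> int \<Rightarrow> cmat2" where
  "Gmat \<alpha> m = mat2 \<alpha> ((-1) powi m * \<alpha>)
                   ((-1) powi (m + 1) * inverse (2 * \<alpha>)) (inverse (2 * \<alpha>))"

definition nu' :: "complex \<Rightarrow> complex \<Rightarrow> complex" where
  "nu' x z = exp (- (1/3) * x powi (-3) + z * x powi (-1)) / (2 * of_real pi * \<i> * x)"

definition FN_jump :: "complex \<Rightarrow> int \<Rightarrow> complex \<Rightarrow> complex \<Rightarrow> cmat2" where
  "FN_jump \<alpha> m y l =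
     sigma3_pow l m ** sigma3_pow (exp (\<i> * theta l y)) (-1) ** matrix_inv (Gmat \<alpha> m) **
     sigma3_pow (exp (\<i> * theta l y)) 1 ** sigma3_pow l (- m)"

definition problem_FN :: "complex \<Rightarrow> int \<Rightarrow> complex \<Rightarrow> (complex \<Rightarrow> cmat2) \<Rightarrow> bool" where
  "problem_FN \<alpha> m y M \<longleftrightarrow> RH_solution (FN_jump \<alpha> m y) (\<lambda>l. sigma3_pow l m) M"

definition problem_BB :: "int \<Rightarrow> complex \<Rightarrow> (complex \<Rightarrow> cmat2) \<Rightarrow> bool" where
  "problem_BB m z Y \<longleftrightarrow> RH_solution (\<lambda>x. mat2 1 (nu' x z) 0 1) (\<lambda>x. sigma3_pow x (- m)) Y"

definition C_jump :: "int \<Rightarrow> complex \<Rightarrow> complex \<Rightarrow> cmat2" where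
  "C_jump j z x = mat2 1 (x powi j * nu' x z) 0 1"

definition problem_C :: "int \<Rightarrow> int \<Rightarrow> complex \<Rightarrow> (complex \<Rightarrow> cmat2) \<Rightarrow> bool" where
  "problem_C m j z C \<longleftrightarrow> RH_solution (C_jump j z) (\<lambda>x. sigma3_pow x (- m)) C"

text \<open>\<open>C x = (I + R / x + O(1 / x^2)) ** sigma3_pow x m\<close> as \<open>x \<rightarrow> \<infinity>\<close>, read entrywise.\<close>

definition is_residue_coeff :: "int \<Rightarrow> (complex \<Rightarrow> cmat2) \<Rightarrow> cmat2 \<Rightarrow> bool" where
  "is_residue_coeff m C R \<longleftrightarrow>
     (\<forall>i j. (\<lambda>x. (C x ** sigma3_pow x (- m) - mat 1) $ i $ j - R $ i $ j / x)
              \<in> O[at_infinity](\<lambda>x. 1 / x ^ 2))"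

definition residue_coeff :: "int \<Rightarrow> (complex \<Rightarrow> cmat2) \<Rightarrow> cmat2" where
  "residue_coeff m C = (THE R. is_residue_coeff m C R)"

subsection \<open>The transformation and its inverse\<close>

text \<open>Several formulas below define an analytic function only off a set \<open>S\<close> (the origin, or a
  circle) across which it continues analytically; this fills in the values on \<open>S\<close> by continuity.\<close>

definition fill_in :: "complex set \<Rightarrow> (complex \<Rightarrow> cmat2) \<Rightarrow> complex \<Rightarrow> cmat2" where
  "fill_in S f x = (if x \<in> S then Lim (at x within - S) f else f x)"

definition c_const :: complex where
  "c_const = - \<i> * of_real (inverse (root 3 12))"

definition k_const :: "int \<Rightarrow> complex" where
  "k_const m = \<i> powi (m + 1) * c_const powi m
               / (exp (\<i> * of_real pi / 4) * of_real (sqrt (2 * pi)))"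

definition Tmat :: "complex \<Rightarrow> int \<Rightarrow> complex \<Rightarrow> complex \<Rightarrow> cmat2" where
  "Tmat \<alpha> m y l =
     mat2 (inverse (2 * \<alpha>)) ((-1) powi (m + 1) * \<alpha> * l powi (2 * m) * exp (- 2 * \<i> * theta l y))
          0 (2 * \<alpha>)"

definition M_to_P :: "complex \<Rightarrow> int \<Rightarrow> complex \<Rightarrow> (complex \<Rightarrow> cmat2) \<Rightarrow> complex \<Rightarrow> cmat2" where
  "M_to_P \<alpha> m y M l = (if norm l < 1 then M l ** matrix_inv (Tmat \<alpha> m y l) else M l)"

definition P_to_M :: "complex \<Rightarrow> int \<Rightarrow> complex \<Rightarrow> (complex \<Rightarrow> cmat2) \<Rightarrow> complex \<Rightarrow> cmat2" where
  "P_to_M \<alpha> m y P l = (if norm l < 1 then P l ** Tmat \<alpha> m y l else P l)"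

definition P_to_Q :: "int \<Rightarrow> (complex \<Rightarrow> cmat2) \<Rightarrow> complex \<Rightarrow> cmat2" where
  "P_to_Q m P = fill_in {0} (\<lambda>x.
     sigma3_pow (k_const m) 1 ** sigma1 ** matrix_inv (P 0) ** P (c_const / x) **
     sigma3_pow x (- m) ** sigma1 ** sigma3_pow (k_const m) (-1))"

text \<open>Solving the formula of \<^const>\<open>P_to_Q\<close> for \<open>P\<close>. The factor \<open>P 0\<close> is recovered from \<open>Q 0\<close>:
  as \<open>x \<rightarrow> 0\<close> the normalization of \<open>P\<close> at infinity gives
  \<open>P (c / x) ** sigma3_pow x (- m) \<rightarrow> sigma3_pow c (- m)\<close>.\<close>

definition Q_to_P :: "int \<Rightarrow> (complex \<Rightarrow> cmat2) \<Rightarrow> complex \<Rightarrow> cmat2" where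
  "Q_to_P m Q = fill_in {0} (\<lambda>l.
     sigma3_pow c_const (- m) ** sigma1 ** sigma3_pow (k_const m) (-1) ** matrix_inv (Q 0) **
     Q (c_const / l) ** sigma3_pow (k_const m) 1 ** sigma1 ** sigma3_pow (c_const / l) m)"

text \<open>Moving the jump circle from \<open>|\<xi>| = |c|\<close> to \<open>|\<xi>| = 1\<close>, and back; note \<open>|c| < 1\<close>.\<close>

definition Q_to_C :: "complex \<Rightarrow> (complex \<Rightarrow> cmat2) \<Rightarrow> complex \<Rightarrow> cmat2" where
  "Q_to_C z Q = fill_in (sphere 0 (norm c_const)) (\<lambda>x.
     if norm c_const < norm x \<and> norm x < 1 then Q x ** C_jump 1 z x else Q x)"

definition C_to_Q :: "complex \<Rightarrow> (complex \<Rightarrow> cmat2) \<Rightarrow> complex \<Rightarrow> cmat2" where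
  "C_to_Q z C = fill_in (sphere 0 1) (\<lambda>x.
     if norm c_const < norm x \<and> norm x < 1 then C x ** matrix_inv (C_jump 1 z x) else C x)"

definition decrease_j :: "int \<Rightarrow> (complex \<Rightarrow> cmat2) \<Rightarrow> complex \<Rightarrow> cmat2" where
  "decrease_j m C =
     (let R = residue_coeff m C; q = C 0 $ 1 $ 2 * inverse (C 0 $ 2 $ 2) in
      fill_in {0} (\<lambda>x.
        mat2 1 (- q) (- (R $ 2 $ 1)) (x + R $ 2 $ 1 * q) ** C x ** mat2 1 0 0 (inverse x)))"

definition increase_j :: "int \<Rightarrow> (complex \<Rightarrow> cmat2) \<Rightarrow> complex \<Rightarrow> cmat2" where
  "increase_j m C =
     (let R = residue_coeff m C; q = C 0 $ 2 $ 1 * inverse (C 0 $ 1 $ 1) in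
      fill_in {0} (\<lambda>x.
        mat2 (x + R $ 1 $ 2 * q) (- (R $ 1 $ 2)) (- q) 1 ** C x ** mat2 (inverse x) 0 0 1))"

end

theory Submission imports Defs begin

text \<open>
  Since all jump matrices are holomorphic off the origin, a solution of any of the problems amounts to
  an entire matrix function, of determinant \<open>1\<close> and unique by Liouville's theorem. The transformations
  of the context are then algebraic identities between these entire matrices, and the content of the
  theorem is solvability: of Problem FN, and (through \<open>C\<^sub>2\<^sub>2(0) \<noteq> 0\<close>) of Problem BB.

  The second column of \<open>P\<close> is polynomial and consists of a Pade approximant of \<open>exp (2 \<i> \<theta>)\<close>.
  For generic \<open>y\<close> such an approximant exists, with coefficients rational in \<open>y\<close>. Uniqueness gives
  it a Lax pair, whose compatibility says that \<open>\<kappa> = 2 \<i> a\<close>, with \<open>a\<close> the top coefficient of the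
  entry \<open>P\<^sub>1\<^sub>2\<close>, solves the second Painleve equation; as the rational solution is unique, \<open>\<kappa> = p\<close>.
  In the linear differential equation in \<open>y\<close> the only non-polynomial coefficient is \<open>p\<close>, so where \<open>p\<close> is
  regular the approximant cannot have a pole, and Problem FN is solvable there. Finally
  \<open>C\<^sub>2\<^sub>2(0)\<close> is a nonzero multiple of \<open>P\<^sub>2\<^sub>2(0)\<close>, which cannot vanish since \<open>det P(0) = 1\<close> and
  \<open>P\<^sub>1\<^sub>2(0) = - P\<^sub>2\<^sub>2(0)\<close> for \<open>m > 0\<close>.
\<close>

text \<open>The obstacle is solvability at a given regular \<open>y\<close>: for fixed
  \<open>y\<close> the Pade system may be singular, and nothing in it visibly refers to poles of
  \<open>p\<close>. Over the polynomials in \<open>y\<close> it has m equations for m + 1 unknowns,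
  hence always a nontrivial solution \<open>R\<close>, and division by \<open>R m\<close> gives the
  approximant wherever \<open>R m\<close> is nonzero. At a zero y0 of \<open>R m\<close> the first
  Lax equation, which equates the y-derivative of B to \<kappa> times the reflected A, decides: the
  poles of A at y0 are at most as bad as those of B, differentiation raises the pole order by one,
  and a regular \<kappa> cannot make up for this. So all of \<open>R\<close> is divisible by the
  power of y - y0 found in \<open>R m\<close>, and cancelling that power gives an approximant at y0.
  The entire encoding also explains why the jump circle may be moved: \<open>Q\<close> and
  \<open>C1\<close> come from the same entire matrix and differ only in the piece that is used
  between the two circles.\<close>

no_notation fps_nth (infixl "$" 75)

section \<open>Two-by-two matrices\<close>

lemma mat2_nth [simp]:
  "mat2 a b c d $ 1 $ 1 = a" "mat2 a b c d $ 1 $ 2 = b"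
  "mat2 a b c d $ 2 $ 1 = c" "mat2 a b c d $ 2 $ 2 = d"
  by (simp_all add: mat2_def)

lemma mat2_cases: obtains a b c d where "A = mat2 a b c d"
proof
  show "A = mat2 (A $ 1 $ 1) (A $ 1 $ 2) (A $ 2 $ 1) (A $ 2 $ 2)"
    by (simp add: vec_eq_iff forall_2)
qed

lemma mat2_eta: "A = mat2 (A $ 1 $ 1) (A $ 1 $ 2) (A $ 2 $ 1) (A $ 2 $ 2)"
  by (simp add: vec_eq_iff forall_2)

lemma mat2_eq_iff [simp]: "mat2 a b c d = mat2 a' b' c' d' \<longleftrightarrow> a = a' \<and> b = b' \<and> c = c' \<and> d = d'"
  by (auto simp: vec_eq_iff forall_2)

lemma mat2_mult [simp]:
  "mat2 a b c d ** mat2 a' b' c' d' =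
   mat2 (a * a' + b * c') (a * b' + b * d') (c * a' + d * c') (c * b' + d * d')"
  by (simp add: vec_eq_iff forall_2 matrix_matrix_mult_def sum_2)

lemma mat_1_mat2: "mat 1 = mat2 1 0 0 1"
  by (simp add: vec_eq_iff forall_2 mat_def)

lemma det_mat2 [simp]: "det (mat2 a b c d) = a * d - b * c"
  by (simp add: det_2)

text \<open>The inverse for determinant 1. Its entries are entries of the matrix up to sign, so it
  is total, continuous and holomorphic, which makes it more convenient than
  \<open>matrix_inv\<close>.\<close>

definition adj2 :: "cmat2 \<Rightarrow> cmat2" where
  "adj2 A = mat2 (A $ 2 $ 2) (- (A $ 1 $ 2)) (- (A $ 2 $ 1)) (A $ 1 $ 1)"

lemma adj2_mat2 [simp]: "adj2 (mat2 a b c d) = mat2 d (- b) (- c) a"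
  by (simp add: adj2_def)

lemma matrix_inv_unique':
  fixes A B :: cmat2
  assumes "A ** B = mat 1"
  shows "matrix_inv A = B" "invertible A" "B ** A = mat 1"
proof -
  have BA: "B ** A = mat 1"
    using assms matrix_left_right_inverse by blast
  thus inv: "invertible A"
    using assms by (auto simp: invertible_def)
  have "A ** matrix_inv A = mat 1 \<and> matrix_inv A ** A = mat 1"
    unfolding matrix_inv_def by (rule someI[of _ B]) (simp add: assms BA)
  hence "matrix_inv A = matrix_inv A ** (A ** B)" "matrix_inv A ** A = mat 1"
    by (simp_all add: assms)
  thus "matrix_inv A = B"
    by (metis matrix_mul_assoc matrix_mul_lid)
  show "B ** A = mat 1" by fact
qed

lemma adj2_mult:
  assumes "det A = 1"
  shows "A ** adj2 A = mat 1" "adj2 A ** A = mat 1" "matrix_inv A = adj2 A" "invertible A"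
proof -
  show *: "A ** adj2 A = mat 1"
    using assms by (cases A rule: mat2_cases) (simp add: mat_1_mat2 mult.commute)
  show "adj2 A ** A = mat 1" "matrix_inv A = adj2 A" "invertible A"
    using matrix_inv_unique'[OF *] by simp_all
qed

lemma det_adj2 [simp]: "det (adj2 A) = det A"
  by (cases A rule: mat2_cases) simp

lemma tendsto_mat_iff:
  fixes X :: "'a \<Rightarrow> cmat2"
  shows "(X \<longlongrightarrow> L) F \<longleftrightarrow> (\<forall>i j. ((\<lambda>w. X w $ i $ j) \<longlongrightarrow> L $ i $ j) F)"
proof
  assume "(X \<longlongrightarrow> L) F"
  thus "\<forall>i j. ((\<lambda>w. X w $ i $ j) \<longlongrightarrow> L $ i $ j) F"
    by (intro allI tendsto_vec_nth)
next
  assume "\<forall>i j. ((\<lambda>w. X w $ i $ j) \<longlongrightarrow> L $ i $ j) F"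
  thus "(X \<longlongrightarrow> L) F"
    by (blast intro: vec_tendstoI)
qed

lemma tendsto_mat_mult:
  fixes X Y :: "'a \<Rightarrow> cmat2"
  assumes "(X \<longlongrightarrow> A) F" "(Y \<longlongrightarrow> B) F"
  shows "((\<lambda>w. X w ** Y w) \<longlongrightarrow> A ** B) F"
  using assms unfolding tendsto_mat_iff
  by (simp add: matrix_matrix_mult_def) (intro allI tendsto_sum tendsto_mult; simp)

lemma tendsto_mat2:
  assumes "(a \<longlongrightarrow> a') F" "(b \<longlongrightarrow> b') F" "(c \<longlongrightarrow> c') F" "(d \<longlongrightarrow> d') F"
  shows "((\<lambda>w. mat2 (a w) (b w) (c w) (d w)) \<longlongrightarrow> mat2 a' b' c' d') F"
  using assms by (simp add: tendsto_mat_iff forall_2)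

definition mat_holomorphic_on :: "(complex \<Rightarrow> cmat2) \<Rightarrow> complex set \<Rightarrow> bool" (infixl "mat'_holomorphic'_on" 50)
  where "X mat_holomorphic_on S \<longleftrightarrow> (\<forall>i j. (\<lambda>w. X w $ i $ j) holomorphic_on S)"

lemma mat_holomorphic_on_mult:
  assumes "X mat_holomorphic_on S" "Y mat_holomorphic_on S"
  shows "(\<lambda>w. X w ** Y w) mat_holomorphic_on S"
  using assms unfolding mat_holomorphic_on_def
  by (auto simp: matrix_matrix_mult_def intro!: holomorphic_intros)

lemma mat_holomorphic_on_mat2:
  assumes "a holomorphic_on S" "b holomorphic_on S" "c holomorphic_on S" "d holomorphic_on S"
  shows "(\<lambda>w. mat2 (a w) (b w) (c w) (d w)) mat_holomorphic_on S"
  using assms by (simp add: mat_holomorphic_on_def forall_2)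

lemma mat_holomorphic_on_adj2:
  assumes "X mat_holomorphic_on S"
  shows "(\<lambda>w. adj2 (X w)) mat_holomorphic_on S"
  using assms by (auto simp: mat_holomorphic_on_def adj2_def forall_2 intro!: holomorphic_intros)

lemma mat_holomorphic_on_const: "(\<lambda>w. A) mat_holomorphic_on S"
  by (simp add: mat_holomorphic_on_def)

lemma mat_holomorphic_on_subset:
  "X mat_holomorphic_on S \<Longrightarrow> T \<subseteq> S \<Longrightarrow> X mat_holomorphic_on T"
  by (auto simp: mat_holomorphic_on_def intro: holomorphic_on_subset)

lemma mat_holomorphic_on_cong:
  "(\<And>w. w \<in> S \<Longrightarrow> X w = Y w) \<Longrightarrow> X mat_holomorphic_on S \<longleftrightarrow> Y mat_holomorphic_on S"
  unfolding mat_holomorphic_on_def by (intro arg_cong[where f = All] ext holomorphic_cong) auto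

lemma mat_holomorphic_on_compose:
  assumes "X mat_holomorphic_on T" "g holomorphic_on S" "g ` S \<subseteq> T"
  shows "(\<lambda>w. X (g w)) mat_holomorphic_on S"
  using assms unfolding mat_holomorphic_on_def
  by (auto intro: holomorphic_on_compose_gen[of g S _ T, unfolded o_def])

lemma mat_holomorphic_on_tendsto:
  assumes "X mat_holomorphic_on S" "open S" "s \<in> S"
  shows "(X \<longlongrightarrow> X s) (at s within T)"
  unfolding tendsto_mat_iff
proof (intro allI)
  fix i j
  have "continuous_on S (\<lambda>w. X w $ i $ j)"
    using assms by (auto simp: mat_holomorphic_on_def intro: holomorphic_on_imp_continuous_on)
  hence "isCont (\<lambda>w. X w $ i $ j) s"
    using assms by (simp add: continuous_on_eq_continuous_at)
  hence "((\<lambda>w. X w $ i $ j) \<longlongrightarrow> X s $ i $ j) (at s)"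
    by (simp add: isCont_def)
  thus "((\<lambda>w. X w $ i $ j) \<longlongrightarrow> X s $ i $ j) (at s within T)"
    using tendsto_within_subset by blast
qed

lemma mat_holomorphic_on_Un:
  assumes "X mat_holomorphic_on S" "X mat_holomorphic_on T" "open S" "open T"
  shows "X mat_holomorphic_on (S \<union> T)"
  using assms by (auto simp: mat_holomorphic_on_def intro: holomorphic_on_Un)

lemma det_holomorphic_on:
  "X mat_holomorphic_on S \<Longrightarrow> (\<lambda>w. det (X w)) holomorphic_on S"
  by (auto simp: det_2 mat_holomorphic_on_def intro!: holomorphic_intros)

text \<open>The map w -> exp (i w) turns the unit circle into the real line, for which pasting of
  continuous, piecewise holomorphic functions is available. A local branch of the logarithm carries
  the result back.\<close>

lemma holomorphic_on_paste_across_circle: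
  assumes cont: "continuous_on UNIV F" and hol: "F holomorphic_on (- sphere 0 1)"
  shows "F holomorphic_on UNIV"
proof -
  define g where "g = (\<lambda>w. F (exp (\<i> * w)))"
  have *: "g holomorphic_on {w. Im w \<noteq> 0}"
    unfolding g_def
    by (rule holomorphic_on_compose_gen[of _ _ _ "- sphere 0 1", unfolded o_def])
       (auto intro!: holomorphic_intros hol simp: norm_exp_eq_Re)
  have "g holomorphic_on UNIV"
  proof (rule holomorphic_on_paste_across_line[of _ \<i> _ 0])
    show "g holomorphic_on UNIV \<inter> {z. \<i> \<bullet> z < 0}" "g holomorphic_on UNIV \<inter> {z. 0 < \<i> \<bullet> z}"
      by (rule holomorphic_on_subset[OF *]; auto simp: inner_complex_def)+
    show "continuous_on UNIV g"
      unfolding g_def by (rule continuous_on_compose2[OF cont]) (auto intro!: continuous_intros)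
  qed auto
  have "F field_differentiable (at w)" for w
  proof (cases "norm w = 1")
    case True
    then have w0: "w \<noteq> 0" by auto
    \<comment> \<open>The plane cut along the ray opposite to \<open>w\<close>, so that a branch of
      the logarithm is holomorphic near \<open>w\<close>.\<close>
    define S where "S = {v. v / w \<notin> \<real>\<^sub>\<le>\<^sub>0}"
    have "S = (\<lambda>v. v / w) -` (- \<real>\<^sub>\<le>\<^sub>0)" by (auto simp: S_def)
    moreover have "open ((\<lambda>v. v / w) -` (- \<real>\<^sub>\<le>\<^sub>0 :: complex set))"
      using w0 by (intro open_vimage) (auto intro!: continuous_intros)
    ultimately have opS: "open S" by simp
    have wS: "w \<in> S" using w0 by (simp add: S_def)
    define h where "h = (\<lambda>v. - \<i> * (Ln w + Ln (v / w)))"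
    have "(\<lambda>v. g (h v)) holomorphic_on S"
      unfolding h_def
      by (rule holomorphic_on_compose_gen[of _ _ g UNIV, unfolded o_def])
         (auto intro!: holomorphic_intros \<open>g holomorphic_on UNIV\<close> simp: S_def)
    moreover have "g (h v) = F v" if "v \<in> S" for v
    proof -
      have "v \<noteq> 0" using that by (auto simp: S_def)
      have "\<i> * h v = Ln w + Ln (v / w)" by (simp add: h_def algebra_simps)
      thus ?thesis using w0 \<open>v \<noteq> 0\<close> by (simp add: g_def exp_add)
    qed
    ultimately have "F holomorphic_on S"
      by (metis (no_types, lifting) holomorphic_cong)
    thus ?thesis using opS wS by (rule holomorphic_on_imp_differentiable_at)
  next
    case False
    have "open (- sphere (0::complex) 1)" by (intro open_Compl closed_sphere)
    with hol show ?thesis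
      by (rule holomorphic_on_imp_differentiable_at) (use False in auto)
  qed
  thus ?thesis unfolding holomorphic_on_def by blast
qed

section \<open>Riemann--Hilbert problems with holomorphic jump matrices\<close>

lemma adj2_antimult: "adj2 (A ** B) = adj2 B ** adj2 A"
  by (cases A rule: mat2_cases, cases B rule: mat2_cases) (simp add: algebra_simps)

lemma adj2_mat_1 [simp]: "adj2 (mat 1) = mat 1"
  by (simp add: mat_1_mat2)

lemma tendsto_adj2: "(X \<longlongrightarrow> A) F \<Longrightarrow> ((\<lambda>w. adj2 (X w)) \<longlongrightarrow> adj2 A) F"
  unfolding adj2_def by (intro tendsto_mat2 tendsto_minus tendsto_vec_nth)

lemma tendsto_det: "(X \<longlongrightarrow> A) F \<Longrightarrow> ((\<lambda>w. det (X w :: cmat2)) \<longlongrightarrow> det A) F"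
  unfolding det_2 by (intro tendsto_diff tendsto_mult tendsto_vec_nth)

lemma Liouville_mat:
  assumes "X mat_holomorphic_on UNIV" "(X \<longlongrightarrow> L) at_infinity"
  shows "X w = L"
proof -
  have "X w $ i $ j = L $ i $ j" for i j
    using assms by (intro Liouville_weak) (auto simp: mat_holomorphic_on_def tendsto_mat_iff)
  thus ?thesis by (simp add: vec_eq_iff)
qed

text \<open>When the jump matrix is holomorphic off the origin, both one-sided pieces of a solution
  continue analytically, and the interior piece becomes entire. A solution is thus encoded by
  the entire matrix function \<open>E\<close>.\<close>

definition RH_entire :: "(complex \<Rightarrow> cmat2) \<Rightarrow> (complex \<Rightarrow> cmat2) \<Rightarrow> (complex \<Rightarrow> cmat2) \<Rightarrow> bool" where
  "RH_entire J N E \<longleftrightarrow> E mat_holomorphic_on UNIV \<and>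
     ((\<lambda>w. E w ** adj2 (J w) ** N w) \<longlongrightarrow> mat 1) at_infinity"

lemma circle_paste:
  fixes X Xp Y :: "complex \<Rightarrow> cmat2"
  assumes X: "X mat_holomorphic_on ball 0 1" and Y: "Y mat_holomorphic_on - cball 0 1"
    and Xp: "continuous_on (sphere 0 1) Xp"
    and limX: "\<And>s. s \<in> sphere 0 1 \<Longrightarrow> (X \<longlongrightarrow> Xp s) (at s within ball 0 1)"
    and limY: "\<And>s. s \<in> sphere 0 1 \<Longrightarrow> (Y \<longlongrightarrow> Xp s) (at s within - cball 0 1)"
  shows "(\<lambda>w. if norm w < 1 then X w else if norm w = 1 then Xp w else Y w) mat_holomorphic_on UNIV"
    (is "?F mat_holomorphic_on _")
proof -
  have 1: "?F mat_holomorphic_on ball 0 1"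
    using X by (subst mat_holomorphic_on_cong[where Y = X]) auto
  have 2: "?F mat_holomorphic_on - cball 0 1"
    using Y by (subst mat_holomorphic_on_cong[where Y = Y]) auto
  have "(?F \<longlongrightarrow> Xp s) (at s)" if s: "s \<in> sphere 0 1" for s
  proof -
    have "(?F \<longlongrightarrow> Xp s) (at s within ball 0 1)"
      by (rule Lim_transform_eventually[OF limX[OF s]]) (auto simp: eventually_at_filter)
    moreover have "(?F \<longlongrightarrow> Xp s) (at s within - cball 0 1)"
      by (rule Lim_transform_eventually[OF limY[OF s]]) (auto simp: eventually_at_filter)
    moreover have "(?F \<longlongrightarrow> Xp s) (at s within sphere 0 1)"
      using Xp s by (intro Lim_transform_eventually[of Xp "Xp s" "at s within sphere 0 1" ?F])
        (auto simp: continuous_on_def eventually_at_filter)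
    ultimately have "(?F \<longlongrightarrow> Xp s) (at s within (ball 0 1 \<union> - cball 0 1) \<union> sphere 0 1)"
      by (intro Lim_Un)
    also have "(ball 0 1 \<union> - cball 0 1) \<union> sphere 0 1 = (UNIV :: complex set)" by auto
    finally show ?thesis .
  qed
  hence lim_circle: "(?F \<longlongrightarrow> ?F s) (at s)" if "norm s = 1" for s
    using that by auto
  have lim_ball: "(?F \<longlongrightarrow> ?F s) (at s)" if "norm s < 1" for s
    using mat_holomorphic_on_tendsto[OF 1, of s UNIV] that by simp
  have lim_out: "(?F \<longlongrightarrow> ?F s) (at s)" if "norm s > 1" for s
    using mat_holomorphic_on_tendsto[OF 2, of s UNIV] that by (simp add: open_Compl)
  have lim: "(?F \<longlongrightarrow> ?F s) (at s)" for s
    using lim_circle[of s] lim_ball[of s] lim_out[of s] by linarith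
  have "(\<lambda>w. ?F w $ i $ j) holomorphic_on UNIV" for i j
  proof (rule holomorphic_on_paste_across_circle)
    show "continuous_on UNIV (\<lambda>w. ?F w $ i $ j)"
      unfolding continuous_on_def by (intro ballI tendsto_vec_nth lim)
    have "?F mat_holomorphic_on ball 0 1 \<union> - cball 0 1"
      by (intro mat_holomorphic_on_Un 1 2) (auto simp: open_Compl)
    moreover have "ball 0 1 \<union> - cball 0 1 = - sphere (0::complex) 1" by auto
    ultimately show "(\<lambda>w. ?F w $ i $ j) holomorphic_on (- sphere 0 1)"
      by (simp add: mat_holomorphic_on_def)
  qed
  thus ?thesis by (simp add: mat_holomorphic_on_def)
qed

text \<open>Multiplying the exterior piece by \<open>J\<close> makes its boundary values equal to
  the interior ones, so both pieces glue to one entire matrix. Determinant 1 lets the exterior piece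
  be recovered with \<open>adj2 (J w)\<close>.\<close>

lemma RH_solution_imp_RH_entire:
  assumes hol: "J mat_holomorphic_on (- {0})" and det: "\<And>w. w \<noteq> 0 \<Longrightarrow> det (J w) = 1"
    and X: "RH_solution J N X"
  obtains E where "RH_entire J N E" "\<And>w. norm w < 1 \<Longrightarrow> X w = E w"
    "\<And>w. norm w > 1 \<Longrightarrow> X w = E w ** adj2 (J w)"
proof -
  from X obtain Xp Xm where Xhol: "X mat_holomorphic_on (- sphere 0 1)"
    and Xp: "continuous_on (sphere 0 1) Xp"
    and limp: "\<And>s. s \<in> sphere 0 1 \<Longrightarrow> (X \<longlongrightarrow> Xp s) (at s within ball 0 1)"
    and limm: "\<And>s. s \<in> sphere 0 1 \<Longrightarrow> (X \<longlongrightarrow> Xm s) (at s within - cball 0 1)"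
    and jump: "\<And>s. s \<in> sphere 0 1 \<Longrightarrow> Xp s = Xm s ** J s"
    and lim: "((\<lambda>w. X w ** N w) \<longlongrightarrow> mat 1) at_infinity"
    unfolding RH_solution_def mat_holomorphic_on_def by blast
  define E where "E = (\<lambda>w. if norm w < 1 then X w else if norm w = 1 then Xp w else X w ** J w)"
  have E: "E mat_holomorphic_on UNIV"
    unfolding E_def
  proof (rule circle_paste[OF _ _ Xp limp])
    show "X mat_holomorphic_on ball 0 1"
      using Xhol by (rule mat_holomorphic_on_subset) auto
    show "(\<lambda>w. X w ** J w) mat_holomorphic_on - cball 0 1"
      by (intro mat_holomorphic_on_mult mat_holomorphic_on_subset[OF Xhol]
          mat_holomorphic_on_subset[OF hol]) auto
    fix s :: complex assume s: "s \<in> sphere 0 1"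
    have "(J \<longlongrightarrow> J s) (at s within - cball 0 1)"
      using s by (intro mat_holomorphic_on_tendsto[OF hol]) (auto simp: open_Compl)
    thus "((\<lambda>w. X w ** J w) \<longlongrightarrow> Xp s) (at s within - cball 0 1)"
      unfolding jump[OF s] by (intro tendsto_mat_mult limm s)
  qed
  have XE: "X w = E w ** adj2 (J w)" if "norm w > 1" for w
  proof -
    have "w \<noteq> 0" using that by auto
    hence "J w ** adj2 (J w) = mat 1" by (intro adj2_mult det)
    thus ?thesis
      using that by (simp add: E_def matrix_mul_assoc[symmetric])
  qed
  have "((\<lambda>w. E w ** adj2 (J w) ** N w) \<longlongrightarrow> mat 1) at_infinity"
    by (rule Lim_transform_eventually[OF lim])
       (auto simp: eventually_at_infinity XE intro!: exI[of _ 2])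
  with E XE show ?thesis
    by (intro that[of E]) (auto simp: RH_entire_def E_def)
qed

lemma RH_entire_imp_RH_solution:
  assumes hol: "J mat_holomorphic_on (- {0})" and det: "\<And>w. w \<noteq> 0 \<Longrightarrow> det (J w) = 1"
    and E: "RH_entire J N E" and Xin: "\<And>w. norm w < 1 \<Longrightarrow> X w = E w"
    and Xout: "\<And>w. norm w > 1 \<Longrightarrow> X w = E w ** adj2 (J w)"
  shows "RH_solution J N X"
proof -
  have Ehol: "E mat_holomorphic_on UNIV"
    and lim: "((\<lambda>w. E w ** adj2 (J w) ** N w) \<longlongrightarrow> mat 1) at_infinity"
    using E by (auto simp: RH_entire_def)
  let ?E' = "\<lambda>w. E w ** adj2 (J w)"
  have E'hol: "?E' mat_holomorphic_on (- {0})"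
    by (intro mat_holomorphic_on_mult mat_holomorphic_on_adj2 hol mat_holomorphic_on_subset[OF Ehol]) auto
  have E'lim: "(?E' \<longlongrightarrow> ?E' s) (at s within T)" if "s \<noteq> 0" for s T
    using that by (intro mat_holomorphic_on_tendsto[OF E'hol]) (auto simp: open_Compl)
  have Elim: "(E \<longlongrightarrow> E s) (at s within T)" for s T
    by (intro mat_holomorphic_on_tendsto[OF Ehol]) auto
  have "X mat_holomorphic_on ball 0 1"
    using mat_holomorphic_on_subset[OF Ehol, of "ball 0 1"] Xin
    by (subst mat_holomorphic_on_cong[where Y = E]) auto
  moreover have "X mat_holomorphic_on - cball 0 1"
    using mat_holomorphic_on_subset[OF E'hol, of "- cball 0 1"] Xout
    by (subst mat_holomorphic_on_cong[where Y = ?E']) auto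
  ultimately have "X mat_holomorphic_on ball 0 1 \<union> - cball 0 1"
    by (intro mat_holomorphic_on_Un) (auto simp: open_Compl)
  moreover have "ball 0 1 \<union> - cball 0 1 = - sphere (0::complex) 1" by auto
  ultimately have Xhol: "X mat_holomorphic_on - sphere 0 1" by simp
  have "((\<lambda>w. X w ** N w) \<longlongrightarrow> mat 1) at_infinity"
    by (rule Lim_transform_eventually[OF lim])
       (auto simp: eventually_at_infinity Xout intro!: exI[of _ 2])
  moreover have "continuous_on (sphere 0 1) E" "continuous_on (sphere 0 1) ?E'"
    unfolding continuous_on_def by (auto intro!: Elim E'lim)
  moreover have "(X \<longlongrightarrow> E s) (at s within ball 0 1)" for s
    by (rule Lim_transform_eventually[OF Elim]) (auto simp: eventually_at_filter Xin)
  moreover have "(X \<longlongrightarrow> ?E' s) (at s within - cball 0 1)" if "s \<in> sphere 0 1" for s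
  proof (rule Lim_transform_eventually[OF E'lim])
    show "s \<noteq> 0" using that by auto
  qed (auto simp: eventually_at_filter Xout)
  moreover have "E s = ?E' s ** J s" if "s \<in> sphere 0 1" for s
  proof -
    have "s \<noteq> 0" using that by auto
    hence "adj2 (J s) ** J s = mat 1" by (intro adj2_mult det)
    thus ?thesis by (simp add: matrix_mul_assoc[symmetric])
  qed
  ultimately show ?thesis
    using Xhol unfolding RH_solution_def mat_holomorphic_on_def
    by (intro conjI exI[of _ E] exI[of _ ?E']) blast+
qed

text \<open>Liouville's theorem for the determinant: \<open>J\<close> and \<open>N\<close> have
  determinant 1 near infinity, so the normalization forces the limit 1.\<close>

lemma RH_entire_det:
  assumes J: "\<And>w. w \<noteq> 0 \<Longrightarrow> det (J w) = 1" and N: "\<And>w. w \<noteq> 0 \<Longrightarrow> det (N w) = 1"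
    and E: "RH_entire J N E"
  shows "det (E w) = 1"
proof (rule Liouville_weak[of "\<lambda>w. det (E w)"])
  show "(\<lambda>w. det (E w)) holomorphic_on UNIV"
    using E by (simp add: RH_entire_def det_holomorphic_on)
  have "((\<lambda>w. det (E w ** adj2 (J w) ** N w)) \<longlongrightarrow> det (mat 1 :: cmat2)) at_infinity"
    using E by (intro tendsto_det) (simp add: RH_entire_def)
  hence "((\<lambda>w. det (E w ** adj2 (J w) ** N w)) \<longlongrightarrow> 1) at_infinity"
    by (simp only: det_I)
  thus "((\<lambda>w. det (E w)) \<longlongrightarrow> 1) at_infinity"
    by (rule Lim_transform_eventually)
       (use eventually_not_equal_at_infinity[of "0 :: complex"] in
         \<open>auto simp: det_mul J N elim: eventually_mono\<close>)
qed

text \<open>In the quotient of two solutions, written with \<open>adj2\<close>, the common factor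
  \<open>adj2 (J w) ** N w\<close> cancels; the quotient is entire and tends to the
  identity.\<close>

lemma RH_entire_unique:
  assumes J: "\<And>w. w \<noteq> 0 \<Longrightarrow> det (J w) = 1" and N: "\<And>w. w \<noteq> 0 \<Longrightarrow> det (N w) = 1"
    and E: "RH_entire J N E" and E': "RH_entire J N E'"
  shows "E' = E"
proof
  fix w
  let ?A = "\<lambda>w. adj2 (J w) ** N w"
  have "(\<lambda>w. E' w ** adj2 (E w)) mat_holomorphic_on UNIV"
    using E E' by (auto simp: RH_entire_def intro!: mat_holomorphic_on_mult mat_holomorphic_on_adj2)
  moreover have "((\<lambda>w. E' w ** adj2 (E w)) \<longlongrightarrow> mat 1) at_infinity"
  proof -
    have "((\<lambda>w. (E' w ** adj2 (J w) ** N w) ** adj2 (E w ** adj2 (J w) ** N w))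
             \<longlongrightarrow> mat 1 ** adj2 (mat 1)) at_infinity"
      using E E' by (intro tendsto_mat_mult tendsto_adj2) (auto simp: RH_entire_def)
    moreover have "(E' w ** adj2 (J w) ** N w) ** adj2 (E w ** adj2 (J w) ** N w) = E' w ** adj2 (E w)"
      if "w \<noteq> 0" for w
    proof -
      have "det (?A w) = 1" using that by (simp add: det_mul J N)
      hence "?A w ** adj2 (?A w) = mat 1" by (rule adj2_mult)
      moreover have "(E' w ** ?A w) ** adj2 (E w ** ?A w) = E' w ** (?A w ** adj2 (?A w)) ** adj2 (E w)"
        unfolding adj2_antimult by (simp only: matrix_mul_assoc)
      ultimately have "(E' w ** ?A w) ** adj2 (E w ** ?A w) = E' w ** adj2 (E w)"
        by (simp only: matrix_mul_rid)
      thus ?thesis by (simp add: matrix_mul_assoc)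
    qed
    ultimately have "((\<lambda>w. E' w ** adj2 (E w)) \<longlongrightarrow> mat 1 ** adj2 (mat 1)) at_infinity"
      by (elim Lim_transform_eventually)
         (use eventually_not_equal_at_infinity[of "0 :: complex"] in \<open>blast intro: eventually_mono\<close>)
    thus ?thesis by simp
  qed
  ultimately have "E' w ** adj2 (E w) = mat 1" by (rule Liouville_mat)
  hence "E' w ** (adj2 (E w) ** E w) = E w"
    by (simp add: matrix_mul_assoc)
  thus "E' w = E w"
    using adj2_mult(2)[OF RH_entire_det[OF J N E]] by simp
qed

lemma RH_solution_unique:
  assumes hol: "J mat_holomorphic_on (- {0})" and J: "\<And>w. w \<noteq> 0 \<Longrightarrow> det (J w) = 1"
    and N: "\<And>w. w \<noteq> 0 \<Longrightarrow> det (N w) = 1"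
    and X: "RH_solution J N X" and X': "RH_solution J N X'"
  shows "agree_off_circle 1 X X'"
proof -
  obtain E where E: "RH_entire J N E" "\<And>w. norm w < 1 \<Longrightarrow> X w = E w"
    "\<And>w. norm w > 1 \<Longrightarrow> X w = E w ** adj2 (J w)"
    using RH_solution_imp_RH_entire[OF hol J X] by blast
  obtain E' where E': "RH_entire J N E'" "\<And>w. norm w < 1 \<Longrightarrow> X' w = E' w"
    "\<And>w. norm w > 1 \<Longrightarrow> X' w = E' w ** adj2 (J w)"
    using RH_solution_imp_RH_entire[OF hol J X'] by blast
  have "E' = E" by (rule RH_entire_unique[OF J N E(1) E'(1)])
  with E E' show ?thesis
    unfolding agree_off_circle_def by (metis linorder_neqE_linordered_idom)
qed

section \<open>Linear algebra of the Pade problem\<close>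

text \<open>Fraction-free Gaussian elimination. Over an integral domain the coefficients may be
  polynomials in \<open>y\<close>, and the solution is again polynomial in \<open>y\<close>.\<close>

lemma homogeneous_system_nontrivial:
  fixes M :: "'i \<Rightarrow> 'j \<Rightarrow> 'a :: idom"
  assumes "finite I" "finite J" "card I < card J"
  shows "\<exists>x. (\<exists>j\<in>J. x j \<noteq> 0) \<and> (\<forall>i\<in>I. (\<Sum>j\<in>J. M i j * x j) = 0)"
  using assms
proof (induction I arbitrary: J M rule: finite_induct)
  case empty
  then obtain j where "j \<in> J" by fastforce
  thus ?case by (intro exI[of _ "\<lambda>_. 1"]) auto
next
  case (insert i0 I)
  show ?case
  proof (cases "\<forall>j\<in>J. M i0 j = 0")
    case True
    have "card I < card J" using insert.prems insert.hyps by simp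
    with insert.IH[of J M] insert.prems obtain x
      where "\<exists>j\<in>J. x j \<noteq> 0" "\<forall>i\<in>I. (\<Sum>j\<in>J. M i j * x j) = 0" by blast
    with True show ?thesis by (intro exI[of _ x]) auto
  next
    case False
    then obtain p where p: "p \<in> J" "M i0 p \<noteq> 0" by blast
    define K where "K = J - {p}"
    have K: "finite K" "p \<notin> K" "J = insert p K"
      using p insert.prems by (auto simp: K_def)
    have "card I < card K" using K insert.prems insert.hyps by simp
    with insert.IH[of K "\<lambda>i j. M i0 p * M i j - M i p * M i0 j"] K obtain x
      where x: "\<exists>j\<in>K. x j \<noteq> 0"
        "\<forall>i\<in>I. (\<Sum>j\<in>K. (M i0 p * M i j - M i p * M i0 j) * x j) = 0" by blast
    \<comment> \<open>Back substitution: the pivot coordinate solves row \<open>i0\<close>, and the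
      other coordinates are scaled by the pivot entry to avoid division.\<close>
    define x' where "x' = (\<lambda>j. if j = p then - (\<Sum>j\<in>K. M i0 j * x j) else M i0 p * x j)"
    have split: "(\<Sum>j\<in>J. M i j * x' j) = (\<Sum>j\<in>K. (M i0 p * M i j - M i p * M i0 j) * x j)" for i
    proof -
      have "(\<Sum>j\<in>K. M i j * x' j) = (\<Sum>j\<in>K. M i j * (M i0 p * x j))"
        using K by (intro sum.cong) (auto simp: x'_def)
      hence "(\<Sum>j\<in>J. M i j * x' j) = M i p * (- (\<Sum>j\<in>K. M i0 j * x j)) + (\<Sum>j\<in>K. M i j * (M i0 p * x j))"
        using K by (simp add: x'_def)
      also have "\<dots> = (\<Sum>j\<in>K. (M i0 p * M i j - M i p * M i0 j) * x j)"
        by (simp add: sum_distrib_left sum_subtractf algebra_simps)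
      finally show ?thesis .
    qed
    have "\<exists>j\<in>J. x' j \<noteq> 0"
      using x(1) K p by (auto simp: x'_def)
    moreover have "\<forall>i\<in>insert i0 I. (\<Sum>j\<in>J. M i j * x' j) = 0"
      using x(2) unfolding split by simp
    ultimately show ?thesis by blast
  qed
qed

text \<open>Each differentiation lowers the degree bound of \<open>V\<close> and the order of
  contact by one and replaces U by U' + c U. Once \<open>V\<close> is gone, U vanishes to order m
  while its degree is below m. On the way back, U' + c U = 0 forces U = 0, coefficient by
  coefficient from the top, since c is nonzero.\<close>

lemma exp_Pade_normal:
  fixes c :: complex
  assumes "c \<noteq> 0" and "\<And>k. k \<ge> m \<Longrightarrow> fps_nth U k = 0" and "\<And>k. k \<ge> n \<Longrightarrow> fps_nth V k = 0"
    and "\<And>k. k < m + n \<Longrightarrow> fps_nth (U * fps_exp c + V) k = 0"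
  shows "U = 0"
  using assms(2-4)
proof (induction n arbitrary: U V)
  case 0
  have "V = 0" using 0 by (intro fps_ext) auto
  have 1: "fps_nth U k = 0" if "k < m" for k
  proof -
    have "U = (U * fps_exp c) * fps_exp (- c)"
      by (simp add: mult.assoc fps_exp_add_mult[symmetric])
    also have "fps_nth \<dots> k = 0"
      unfolding fps_mult_nth[of "U * fps_exp c"] using 0(3) \<open>V = 0\<close> that by (intro sum.neutral) auto
    finally show ?thesis .
  qed
  show ?case
  proof (rule fps_ext)
    fix k show "fps_nth U k = fps_nth 0 k" using 1[of k] 0(1)[of k] by (cases "k < m") auto
  qed
next
  case (Suc n)
  let ?U = "fps_deriv U + fps_const c * U"
  have "?U = 0"
  proof (rule Suc.IH)
    show "fps_nth ?U k = 0" if "k \<ge> m" for k using that Suc.prems(1) by simp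
    show "fps_nth (fps_deriv V) k = 0" if "k \<ge> n" for k using that Suc.prems(2) by simp
    have "?U * fps_exp c + fps_deriv V = fps_deriv (U * fps_exp c + V)"
      by (simp add: algebra_simps)
    thus "fps_nth (?U * fps_exp c + fps_deriv V) k = 0" if "k < m + n" for k
      using that Suc.prems(3)[of "Suc k"] by (simp del: fps_deriv_add fps_deriv_mult)
  qed
  hence rec: "of_nat (Suc k) * fps_nth U (Suc k) + c * fps_nth U k = 0" for k
    by (metis fps_add_nth fps_deriv_nth fps_mult_left_const_nth fps_zero_nth Suc_eq_plus1)
  have "fps_nth U k = 0" for k
  proof (cases "k \<le> m")
    case True
    thus ?thesis
    proof (induction k rule: inc_induct)
      case base
      show ?case using Suc.prems(1) by simp
    next
      case (step k)
      thus ?case using rec[of k] \<open>c \<noteq> 0\<close> by simp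
    qed
  qed (use Suc.prems(1) in auto)
  thus ?case by (intro fps_ext) auto
qed

section \<open>Pade systems with coefficients polynomial in y\<close>

definition exp_coeff_poly :: "complex fps \<Rightarrow> nat \<Rightarrow> complex poly" where
  "exp_coeff_poly g k = (\<Sum>i\<le>k. monom ((2 * \<i>) ^ i / fact i * fps_nth g (k - i)) i)"

lemma poly_exp_coeff_poly: "poly (exp_coeff_poly g k) y = fps_nth (fps_exp (2 * \<i> * y) * g) k"
  unfolding fps_mult_nth exp_coeff_poly_def poly_sum poly_monom
  by (auto simp: power_mult_distrib atLeast0AtMost field_simps intro!: sum.cong)

lemma coeff_exp_coeff_poly:
  "coeff (exp_coeff_poly g k) i = (if i \<le> k then (2 * \<i>) ^ i / fact i * fps_nth g (k - i) else 0)"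
  by (auto simp: exp_coeff_poly_def coeff_sum)

lemma degree_exp_coeff_poly: "degree (exp_coeff_poly g k) \<le> k"
  by (intro degree_le) (auto simp: coeff_exp_coeff_poly)

lemma coeff_mult_bounds:
  assumes "degree p \<le> a" "degree q \<le> b"
  shows "coeff (p * q) (a + b) = coeff p a * coeff q b"
proof -
  have "coeff (p * q) (a + b) = (\<Sum>i\<le>a + b. coeff p i * coeff q (a + b - i))"
    by (rule coeff_mult)
  also have "\<dots> = (\<Sum>i\<in>{a}. coeff p i * coeff q (a + b - i))"
  proof (rule sum.mono_neutral_right)
    show "\<forall>i\<in>{..a + b} - {a}. coeff p i * coeff q (a + b - i) = 0"
    proof
      fix i assume "i \<in> {..a + b} - {a}"
      hence "i > a \<or> a + b - i > b" by auto
      thus "coeff p i * coeff q (a + b - i) = 0"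
        using assms coeff_eq_0[of p i] coeff_eq_0[of q "a + b - i"] by auto
    qed
  qed auto
  finally show ?thesis by simp
qed

lemma sum_fps_truncated:
  fixes U F :: "complex fps"
  assumes "\<And>k. k > m \<Longrightarrow> fps_nth U k = 0" "m \<le> k"
  shows "fps_nth (U * F) k = (\<Sum>j\<le>m. fps_nth U j * fps_nth F (k - j))"
  unfolding fps_mult_nth using assms by (intro sum.mono_neutral_right) auto

text \<open>At the top weighted degree in \<open>y\<close> (with \<open>R j\<close> given weight \<open>- j\<close>) the linear system
  below becomes the one for the Pade approximants of the exponential function, which is nonsingular;
  this excludes \<open>R m = 0\<close>.\<close>

lemma Pade_polynomials_exist:
  assumes g0: "fps_nth g 0 = 1"
  obtains R :: "nat \<Rightarrow> complex poly" where "R m \<noteq> 0"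
    "\<And>k. m \<le> k \<Longrightarrow> k < 2 * m \<Longrightarrow> (\<Sum>j\<le>m. R j * exp_coeff_poly g (k - j)) = 0"
proof -
  have "\<exists>x. (\<exists>j\<in>{..m}. x j \<noteq> 0) \<and>
          (\<forall>k\<in>{m..<2 * m}. (\<Sum>j\<in>{..m}. exp_coeff_poly g (k - j) * x j) = 0)"
    by (rule homogeneous_system_nontrivial) auto
  then obtain R where R0: "\<exists>j\<in>{..m}. R j \<noteq> 0"
    and "\<forall>k\<in>{m..<2 * m}. (\<Sum>j\<in>{..m}. exp_coeff_poly g (k - j) * R j) = 0" by blast
  hence R: "(\<Sum>j\<le>m. R j * exp_coeff_poly g (k - j)) = 0" if "m \<le> k" "k < 2 * m" for k
    using that by (simp add: mult.commute)
  have "R m \<noteq> 0"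
  proof
    assume Rm: "R m = 0"
    define S where "S = {j. j \<le> m \<and> R j \<noteq> 0}"
    define W where "W = Max ((\<lambda>j. degree (R j) + (m - j)) ` S)"
    have S: "finite S" "S \<noteq> {}" using R0 by (auto simp: S_def)
    have W_ge: "degree (R j) + (m - j) \<le> W" if "j \<in> S" for j
      unfolding W_def using S that by (intro Max_ge) auto
    have "W \<in> (\<lambda>j. degree (R j) + (m - j)) ` S"
      unfolding W_def using S by (intro Max_in) auto
    then obtain j0 where j0: "j0 \<in> S" "W = degree (R j0) + (m - j0)" by blast
    \<comment> \<open>Coefficients at the maximal weight \<open>W\<close>; the index
      \<open>j0\<close> attains it, so this vector is nonzero.\<close>
    define x where "x = (\<lambda>j. if j \<in> S then coeff (R j) (W - (m - j)) else 0)"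
    have "x j0 \<noteq> 0" using j0 by (simp add: x_def S_def)
    define U where "U = Abs_fps x"
    \<comment> \<open>The system prescribes only the orders from m to 2m - 1; \<open>V\<close>
      absorbs the lower ones.\<close>
    define V where "V = Abs_fps (\<lambda>k. if k < m then - fps_nth (U * fps_exp (2 * \<i>)) k else 0)"
    \<comment> \<open>Here \<open>R m = 0\<close> is used: it brings the degree of \<open>U\<close>
      below m, the bound required by \<open>exp_Pade_normal\<close>.\<close>
    have U: "fps_nth U k = 0" if "k \<ge> m" for k
      using that Rm by (auto simp: U_def x_def S_def)
    have "fps_nth (U * fps_exp (2 * \<i>)) k = 0" if k: "m \<le> k" "k < 2 * m" for k
    proof -
      have "0 = coeff (\<Sum>j\<le>m. R j * exp_coeff_poly g (k - j)) (W + (k - m))"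
        by (simp add: R k)
      also have "\<dots> = (\<Sum>j\<le>m. coeff (R j * exp_coeff_poly g (k - j)) (W + (k - m)))"
        by (rule coeff_sum)
      also have "\<dots> = (\<Sum>j\<le>m. fps_nth U j * fps_nth (fps_exp (2 * \<i>)) (k - j))"
      proof (rule sum.cong)
        fix j assume j: "j \<in> {..m}"
        show "coeff (R j * exp_coeff_poly g (k - j)) (W + (k - m)) =
                fps_nth U j * fps_nth (fps_exp (2 * \<i>)) (k - j)"
        proof (cases "j \<in> S")
          case True
          have "W + (k - m) = (W - (m - j)) + (k - j)"
            using W_ge[OF True] k j by simp
          moreover have "degree (R j) \<le> W - (m - j)"
            using W_ge[OF True] by simp
          ultimately show ?thesis
            using True by (simp add: coeff_mult_bounds degree_exp_coeff_poly U_def x_def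
                coeff_exp_coeff_poly g0 power_mult_distrib)
        next
          case False
          thus ?thesis using j by (auto simp: U_def x_def S_def)
        qed
      qed auto
      also have "\<dots> = fps_nth (U * fps_exp (2 * \<i>)) k"
        using U k by (intro sum_fps_truncated[symmetric]) auto
      finally show ?thesis by simp
    qed
    hence "fps_nth (U * fps_exp (2 * \<i>) + V) k = 0" if "k < m + m" for k
      using that by (cases "k < m") (auto simp: V_def)
    hence "U = 0"
      using U by (intro exp_Pade_normal[of "2 * \<i>" m U m V]) (auto simp: V_def)
    hence "x j0 = 0" by (metis U_def fps_nth_Abs_fps fps_zero_nth)
    thus False using \<open>x j0 \<noteq> 0\<close> by simp
  qed
  with R show ?thesis by (intro that) auto
qed

section \<open>Problem FN as a Pade problem\<close>

text \<open>The lower triangular factor that remains when the upper triangular factor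
  \<open>Tmat\<close> is split off the Flaschka-Newell jump.\<close>

definition P_jump :: "int \<Rightarrow> complex \<Rightarrow> complex \<Rightarrow> cmat2" where
  "P_jump m y l = mat2 1 0 ((-1) powi m * l powi (- 2 * m) * exp (2 * \<i> * theta l y)) 1"

lemma theta_holomorphic [holomorphic_intros]:
  "f holomorphic_on S \<Longrightarrow> (\<lambda>l. theta (f l) y) holomorphic_on S"
  by (auto simp: theta_def intro!: holomorphic_intros)

lemma mat_holomorphic_on_P_jump: "P_jump m y mat_holomorphic_on - {0}"
  unfolding P_jump_def by (intro mat_holomorphic_on_mat2) (auto intro!: holomorphic_intros)

lemma det_P_jump [simp]: "det (P_jump m y l) = 1"
  by (simp add: P_jump_def)

lemma det_sigma3_pow [simp]: "a \<noteq> 0 \<Longrightarrow> det (sigma3_pow a n) = 1"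
  by (simp add: sigma3_pow_def power_int_minus)

lemma minus_one_powi_square [simp]: "(-1 :: complex) powi m * (-1) powi m = 1"
  by (cases "even m") (auto simp: power_int_minus_left)

lemma det_Tmat [simp]: "\<alpha> \<noteq> 0 \<Longrightarrow> det (Tmat \<alpha> m y l) = 1"
  by (simp add: Tmat_def)

text \<open>The sign of \<open>m\<close> enters here: for m \<ge> 0 the power in \<open>Tmat\<close>
  is holomorphic at the origin, so passing from M to P keeps the interior piece analytic.\<close>

lemma mat_holomorphic_on_Tmat: "m \<ge> 0 \<Longrightarrow> Tmat \<alpha> m y mat_holomorphic_on S"
  unfolding Tmat_def by (intro mat_holomorphic_on_mat2) (auto intro!: holomorphic_intros)

text \<open>An LU factorization: conjugation by the diagonal matrices only rescales the off-diagonal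
  entries of the inverse of G, and (-1)^m squares to 1.\<close>

lemma FN_jump_eq:
  assumes "\<alpha> \<noteq> 0" "l \<noteq> 0"
  shows "FN_jump \<alpha> m y l = P_jump m y l ** Tmat \<alpha> m y l"
proof -
  define s where "s = (-1 :: complex) powi m"
  define L where "L = l powi m"
  define e where "e = exp (\<i> * theta l y)"
  have s: "s * s = 1" by (simp add: s_def)
  have s1: "(-1 :: complex) powi (m + 1) = - s" by (simp add: s_def power_int_add)
  have L2: "l powi (2 * m) = L * L"
    using assms by (simp only: L_def mult_2 power_int_add simp_thms)
  have "l powi (- 2 * m) = inverse (l powi (2 * m))"
    by (simp flip: power_int_minus)
  hence L: "L \<noteq> 0" "l powi (2 * m) = L * L" "l powi (- m) = inverse L" "l powi (- 2 * m) = inverse (L * L)"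
    using assms L2 by (simp_all add: L_def power_int_minus)
  have e: "e \<noteq> 0" "exp (2 * \<i> * theta l y) = e * e" "exp (- 2 * \<i> * theta l y) = inverse (e * e)"
    by (simp_all add: e_def exp_add[symmetric] exp_minus[symmetric] mult.assoc)
  have G: "Gmat \<alpha> m = mat2 \<alpha> (s * \<alpha>) (- s * inverse (2 * \<alpha>)) (inverse (2 * \<alpha>))"
    by (simp add: Gmat_def s1 flip: s_def)
  have detG: "det (Gmat \<alpha> m) = 1"
    using assms s by (simp add: G field_simps)
  have "FN_jump \<alpha> m y l = mat2 L 0 0 (inverse L) ** mat2 (inverse e) 0 0 e ** adj2 (Gmat \<alpha> m) **
      mat2 e 0 0 (inverse e) ** mat2 (inverse L) 0 0 L"
    unfolding FN_jump_def adj2_mult(3)[OF detG] sigma3_pow_def L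
    by (simp add: power_int_minus e_def L_def)
  also have "\<dots> = mat2 1 0 (s * inverse (L * L) * (e * e)) 1 **
      mat2 (inverse (2 * \<alpha>)) (- s * \<alpha> * (L * L) * inverse (e * e)) 0 (2 * \<alpha>)"
    using assms s L(1) e(1) by (simp add: G field_simps)
  also have "\<dots> = P_jump m y l ** Tmat \<alpha> m y l"
    unfolding P_jump_def Tmat_def L e s1 by (simp add: s_def)
  finally show ?thesis .
qed

lemma det_FN_jump:
  assumes "\<alpha> \<noteq> 0" "l \<noteq> 0"
  shows "det (FN_jump \<alpha> m y l) = 1"
  using assms by (simp add: FN_jump_eq det_mul)

lemma mat_holomorphic_on_FN_jump:
  assumes "\<alpha> \<noteq> 0" "m \<ge> 0"
  shows "FN_jump \<alpha> m y mat_holomorphic_on - {0}"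
proof -
  have "(\<lambda>l. P_jump m y l ** Tmat \<alpha> m y l) mat_holomorphic_on - {0}"
    by (intro mat_holomorphic_on_mult mat_holomorphic_on_P_jump mat_holomorphic_on_Tmat assms)
  thus ?thesis
    by (subst mat_holomorphic_on_cong[where Y = "\<lambda>l. P_jump m y l ** Tmat \<alpha> m y l"])
       (auto simp: FN_jump_eq assms)
qed

lemma RH_entire_FN_to_P:
  assumes "\<alpha> \<noteq> 0" "m \<ge> 0" "RH_entire (FN_jump \<alpha> m y) N E"
  shows "RH_entire (P_jump m y) N (\<lambda>l. E l ** adj2 (Tmat \<alpha> m y l))"
  unfolding RH_entire_def
proof
  show "(\<lambda>l. E l ** adj2 (Tmat \<alpha> m y l)) mat_holomorphic_on UNIV"
    using assms by (intro mat_holomorphic_on_mult mat_holomorphic_on_adj2 mat_holomorphic_on_Tmat)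
      (auto simp: RH_entire_def)
  have "((\<lambda>l. E l ** adj2 (FN_jump \<alpha> m y l) ** N l) \<longlongrightarrow> mat 1) at_infinity"
    using assms by (simp add: RH_entire_def)
  thus "((\<lambda>l. E l ** adj2 (Tmat \<alpha> m y l) ** adj2 (P_jump m y l) ** N l) \<longlongrightarrow> mat 1) at_infinity"
    by (rule Lim_transform_eventually)
       (rule eventually_mono[OF eventually_not_equal_at_infinity[of 0]],
        simp add: FN_jump_eq assms adj2_antimult matrix_mul_assoc)
qed

lemma RH_entire_P_to_FN:
  assumes "\<alpha> \<noteq> 0" "m \<ge> 0" "RH_entire (P_jump m y) N E"
  shows "RH_entire (FN_jump \<alpha> m y) N (\<lambda>l. E l ** Tmat \<alpha> m y l)"
  unfolding RH_entire_def
proof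
  show "(\<lambda>l. E l ** Tmat \<alpha> m y l) mat_holomorphic_on UNIV"
    using assms by (intro mat_holomorphic_on_mult mat_holomorphic_on_Tmat) (auto simp: RH_entire_def)
  have "((\<lambda>l. E l ** adj2 (P_jump m y l) ** N l) \<longlongrightarrow> mat 1) at_infinity"
    using assms by (simp add: RH_entire_def)
  moreover have "E l ** Tmat \<alpha> m y l ** adj2 (FN_jump \<alpha> m y l) ** N l = E l ** adj2 (P_jump m y l) ** N l"
    if "l \<noteq> 0" for l
  proof -
    have "E l ** Tmat \<alpha> m y l ** adj2 (FN_jump \<alpha> m y l) ** N l =
        E l ** (Tmat \<alpha> m y l ** adj2 (Tmat \<alpha> m y l)) ** adj2 (P_jump m y l) ** N l"
      by (simp only: FN_jump_eq assms that adj2_antimult matrix_mul_assoc not_False_eq_True)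
    thus ?thesis
      by (simp add: adj2_mult assms)
  qed
  ultimately show "((\<lambda>l. E l ** Tmat \<alpha> m y l ** adj2 (FN_jump \<alpha> m y l) ** N l) \<longlongrightarrow> mat 1) at_infinity"
    by (elim Lim_transform_eventually)
       (rule eventually_mono[OF eventually_not_equal_at_infinity[of 0]], simp)
qed

section \<open>The Taylor series of exp (2 i \<theta>) and its Pade pair\<close>

definition g_fps :: "complex fps" where
  "g_fps = fps_expansion (\<lambda>l. exp (4 * \<i> * l ^ 3)) 0"

text \<open>Factored so that \<open>y\<close> occurs only in an exponential series: the coefficients
  are polynomials in \<open>y\<close> and easy to differentiate.\<close>

definition F_fps :: "complex \<Rightarrow> complex fps" where
  "F_fps y = fps_exp (2 * \<i> * y) * g_fps"

lemma g_fps_expansion: "(\<lambda>l. exp (4 * \<i> * l ^ 3)) has_fps_expansion g_fps"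
  unfolding g_fps_def by (rule has_fps_expansion_fps_expansion[of UNIV]) (auto intro!: holomorphic_intros)

lemma F_fps_expansion: "(\<lambda>l. exp (2 * \<i> * theta l y)) has_fps_expansion F_fps y"
proof -
  have "(\<lambda>l. exp (2 * \<i> * y * l) * exp (4 * \<i> * l ^ 3)) has_fps_expansion F_fps y"
    unfolding F_fps_def by (intro has_fps_expansion_mult has_fps_expansion_exp g_fps_expansion)
  moreover have "exp (2 * \<i> * y * l) * exp (4 * \<i> * l ^ 3) = exp (2 * \<i> * theta l y)" for l
    by (simp add: exp_add[symmetric] theta_def algebra_simps)
  ultimately show ?thesis by simp
qed

lemma g_fps_0: "fps_nth g_fps 0 = 1"
  using has_fps_expansion_imp_0_eq_fps_nth_0[OF g_fps_expansion] by simp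

lemma F_fps_0: "fps_nth (F_fps y) 0 = 1"
  by (simp add: F_fps_def g_fps_0)

text \<open>For \<open>F = exp (2 \<i> \<theta>)\<close> the second column of \<open>P\<close> has the entries \<open>a (- \<lambda>)\<close> and \<open>b \<lambda>\<close>.\<close>

definition Pade :: "nat \<Rightarrow> complex fps \<Rightarrow> complex poly \<Rightarrow> complex poly \<Rightarrow> bool" where
  "Pade m F b a \<longleftrightarrow> degree b \<le> m \<and> coeff b m = 1 \<and> (\<forall>k\<ge>m. coeff a k = 0) \<and>
     (\<forall>k<2*m. fps_nth (fps_of_poly b * F + fps_of_poly a) k = 0)"

lemma holomorphic_factor_power:
  assumes v: "v holomorphic_on UNIV" "v has_fps_expansion G" and G: "\<And>k. k < n \<Longrightarrow> fps_nth G k = 0"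
  obtains h :: "complex \<Rightarrow> complex" where "h holomorphic_on UNIV" "\<And>x. v x = x ^ n * h x"
proof
  have "ereal r \<le> fps_conv_radius G" for r
    using v by (intro holomorphic_on_imp_fps_conv_radius_ge[of v]) (auto intro: holomorphic_on_subset)
  hence R: "fps_conv_radius G = \<infinity>" by (meson ereal_infty_less_eq2(1) ereal_top)
  show "eval_fps (fps_shift n G) holomorphic_on UNIV"
    by (intro holomorphic_on_eval_fps) (auto simp: R)
  show "v x = x ^ n * eval_fps (fps_shift n G) x" for x
  proof -
    have vx: "eval_fps G x = v x" for x
      using v by (intro has_fps_expansion_imp_eval_fps_eq[of v G x "norm x + 1"])
        (auto intro: holomorphic_on_subset)
    show ?thesis
    proof (cases "G = 0")
      case True
      thus ?thesis using vx[of x] by simp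
    next
      case False
      hence "n \<le> subdegree G" using G by (intro subdegree_geI) auto
      moreover have "v 0 = fps_nth G 0"
        using vx[of 0] by (simp add: eval_fps_at_0)
      ultimately show ?thesis
        using G[of 0] by (cases "n = 0") (auto simp: eval_fps_shift R vx)
    qed
  qed
qed

lemma poly_over_power_tendsto:
  fixes p :: "complex poly"
  assumes "degree p \<le> m"
  shows "((\<lambda>x. poly p x / x ^ m) \<longlongrightarrow> coeff p m) at_infinity"
proof (cases "degree p = m")
  case True
  thus ?thesis using poly_divide_tendsto_aux[of p] by simp
next
  case False
  hence "degree p < degree (monom 1 m :: complex poly)"
    using assms by (simp add: degree_monom_eq)
  from poly_divide_tendsto_0_at_infinity[OF this] show ?thesis
    using False assms by (simp add: poly_monom coeff_eq_0)
qed

lemma poly_reflect_over_power_tendsto: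
  fixes p :: "complex poly"
  assumes "degree p \<le> m"
  shows "((\<lambda>x. poly p (- x) / x ^ m) \<longlongrightarrow> (- 1) ^ m * coeff p m) at_infinity"
  using poly_over_power_tendsto[of "pcompose p [:0, -1:]" m] assms
  by (simp add: poly_pcompose coeff_pcompose_linear degree_pcompose)

text \<open>The second column of the entire matrix is polynomial. The first one is determined by it:
  its entries \<open>F * h (- l)\<close> and \<open>h l\<close> come from the Pade remainder, using
  \<open>F (- l) = 1 / F l\<close> for \<open>F = exp (2 \<i> \<theta>)\<close>.\<close>

lemma Pade_imp_RH_entire_P:
  assumes "Pade m (F_fps y) b a"
  obtains E :: "complex \<Rightarrow> cmat2" where "RH_entire (P_jump (int m) y) (\<lambda>l. sigma3_pow l (int m)) E"
    "\<And>l. E l $ 1 $ 2 = poly a (- l)" "\<And>l. E l $ 2 $ 2 = poly b l"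
proof -
  have b: "degree b \<le> m" "coeff b m = 1" and a: "\<And>k. k \<ge> m \<Longrightarrow> coeff a k = 0"
    and van: "\<And>k. k < 2 * m \<Longrightarrow> fps_nth (fps_of_poly b * F_fps y + fps_of_poly a) k = 0"
    using assms by (auto simp: Pade_def)
  have dega: "degree a \<le> m" using a by (intro degree_le) auto
  define F where "F = (\<lambda>l. exp (2 * \<i> * theta l y))"
  define s where "s = (- 1 :: complex) ^ m"
  have s: "s * s = 1" by (simp add: s_def flip: power_mult_distrib)
  define v where "v = (\<lambda>l. poly b l * F l + poly a l)"
  have "(\<lambda>l. eval_fps (fps_of_poly p) l) has_fps_expansion fps_of_poly p" for p :: "complex poly"
    by (rule eval_fps_has_fps_expansion) simp
  hence "v has_fps_expansion fps_of_poly b * F_fps y + fps_of_poly a"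
    unfolding v_def F_def
    by (intro has_fps_expansion_add has_fps_expansion_mult F_fps_expansion) simp_all
  moreover have "v holomorphic_on UNIV"
    unfolding v_def F_def by (auto intro!: holomorphic_intros)
  ultimately obtain h where h: "h holomorphic_on UNIV" "\<And>x. v x = x ^ (2 * m) * h x"
    using holomorphic_factor_power van by blast
  define E where "E = (\<lambda>l. mat2 (s * F l * h (- l)) (poly a (- l)) (s * h l) (poly b l))"
  have FF: "F (- l) * F l = 1" for l
    by (simp add: F_def theta_def exp_add[symmetric] algebra_simps)
  have "(\<lambda>l. h (- l)) holomorphic_on UNIV"
    by (rule holomorphic_on_compose_gen[of _ _ h UNIV, unfolded o_def]) (auto intro!: holomorphic_intros h)
  hence "E mat_holomorphic_on UNIV"
    unfolding E_def F_def by (intro mat_holomorphic_on_mat2) (auto intro!: holomorphic_intros h)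
  moreover have "((\<lambda>l. E l ** adj2 (P_jump (int m) y l) ** sigma3_pow l (int m)) \<longlongrightarrow> mat 1) at_infinity"
  proof -
    \<comment> \<open>With the jump factor removed, the exponentials cancel. Only polynomials
      divided by l^m remain, and their limits are top coefficients, which vanish for
      \<open>a\<close> and give 1 for \<open>b\<close> once the signs are collected.\<close>
    have eq: "mat2 (s * (poly b (- l) / l ^ m)) (poly a (- l) / l ^ m)
                (s * (poly a l / l ^ m)) (poly b l / l ^ m) =
          E l ** adj2 (P_jump (int m) y l) ** sigma3_pow l (int m)" if l: "l \<noteq> 0" for l
    proof -
      define L where "L = l ^ m"
      have L: "L \<noteq> 0" "l powi (int m) = L" "l powi (- int m) = inverse L" "l ^ (2 * m) = L * L"
        using l by (simp_all add: L_def power_int_minus mult_2 power_add)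
      have "l powi (2 * int m) = L * L"
        using l L(2) by (simp only: mult_2 power_int_add simp_thms)
      moreover have "l powi (- 2 * int m) = inverse (l powi (2 * int m))"
        by (simp flip: power_int_minus)
      ultimately have L': "l powi (- 2 * int m) = inverse (L * L)" by simp
      have Fl: "exp (2 * \<i> * theta l y) = F l" by (simp add: F_def)
      have sm: "(-1 :: complex) powi int m = s" by (simp add: s_def)
      have F0: "F l \<noteq> 0" "F (- l) = inverse (F l)"
        using FF[of l] by (auto simp: F_def field_simps)
      have "h l = (poly b l * F l + poly a l) * inverse (L * L)"
        using h(2)[of l] L l by (simp add: v_def field_simps)
      moreover have "h (- l) = (poly b (- l) * inverse (F l) + poly a (- l)) * inverse (L * L)"
        using h(2)[of "- l"] L l F0 by (simp add: v_def field_simps)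
      ultimately have El: "E l = mat2 (s * F l * ((poly b (- l) * inverse (F l) + poly a (- l)) * inverse (L * L)))
          (poly a (- l)) (s * ((poly b l * F l + poly a l) * inverse (L * L))) (poly b l)"
        by (simp only: E_def)
      have Nl: "sigma3_pow l (int m) = mat2 L 0 0 (inverse L)"
        by (simp only: sigma3_pow_def L)
      have Pl: "adj2 (P_jump (int m) y l) = mat2 1 0 (- (s * inverse (L * L) * F l)) 1"
        by (simp only: P_jump_def L' Fl sm adj2_mat2 minus_zero)
      show ?thesis
        unfolding El Nl Pl mat2_mult mat2_eq_iff L_def[symmetric]
        using L(1) F0(1) by (simp add: field_simps)
    qed
    have "((\<lambda>l. mat2 (s * (poly b (- l) / l ^ m)) (poly a (- l) / l ^ m)
                (s * (poly a l / l ^ m)) (poly b l / l ^ m)) \<longlongrightarrow>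
             mat2 (s * ((-1) ^ m * coeff b m)) ((-1) ^ m * coeff a m) (s * coeff a m) (coeff b m))
             at_infinity"
      by (intro tendsto_mat2 tendsto_mult tendsto_const poly_over_power_tendsto
          poly_reflect_over_power_tendsto b dega)
    also have "mat2 (s * ((-1) ^ m * coeff b m)) ((-1) ^ m * coeff a m) (s * coeff a m) (coeff b m) = mat 1"
      using s by (simp add: b a mat_1_mat2 flip: s_def)
    finally show ?thesis
      by (rule Lim_transform_eventually)
         (rule eventually_mono[OF eventually_not_equal_at_infinity[of 0]], rule eq)
  qed
  ultimately show ?thesis
    by (intro that[of E]) (auto simp: RH_entire_def E_def)
qed

text \<open>The pair is the second column of an entire solution of the Riemann-Hilbert problem,
  where Liouville's theorem gives uniqueness.\<close>

lemma Pade_unique: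
  assumes "Pade m (F_fps y) b a" "Pade m (F_fps y) b' a'"
  shows "b' = b" "a' = a"
proof -
  obtain E :: "complex \<Rightarrow> cmat2" where E: "RH_entire (P_jump (int m) y) (\<lambda>l. sigma3_pow l (int m)) E"
    "\<And>l. E l $ 1 $ 2 = poly a (- l)" "\<And>l. E l $ 2 $ 2 = poly b l"
    using Pade_imp_RH_entire_P[OF assms(1)] by blast
  obtain E' :: "complex \<Rightarrow> cmat2" where E': "RH_entire (P_jump (int m) y) (\<lambda>l. sigma3_pow l (int m)) E'"
    "\<And>l. E' l $ 1 $ 2 = poly a' (- l)" "\<And>l. E' l $ 2 $ 2 = poly b' l"
    using Pade_imp_RH_entire_P[OF assms(2)] by blast
  have "E' = E"
    by (rule RH_entire_unique[OF _ _ E(1) E'(1)]) auto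
  hence "poly b' l = poly b l" "poly a' l = poly a l" for l
    using E(2)[of "- l"] E'(2)[of "- l"] E(3)[of l] E'(3)[of l] by auto
  thus "b' = b" "a' = a" by (auto simp: poly_eq_poly_eq_iff[symmetric])
qed

text \<open>Adding a homogeneous solution to a Pade pair gives another pair. This is the principle
  behind the Lax equations: a combination of small degree and high order of contact has to
  vanish.\<close>

lemma Pade_homogeneous:
  assumes P: "Pade m (F_fps y) b a"
    and "\<And>k. k \<ge> m \<Longrightarrow> coeff u k = 0" "\<And>k. k \<ge> m \<Longrightarrow> coeff v k = 0"
    and "\<And>k. k < 2 * m \<Longrightarrow> fps_nth (fps_of_poly u * F_fps y + fps_of_poly v) k = 0"
  shows "u = 0" "v = 0"
proof -
  have "degree (b + u) \<le> m"
    using P assms(2) by (intro degree_le) (auto simp: Pade_def coeff_eq_0)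
  moreover have "fps_of_poly (b + u) * F_fps y + fps_of_poly (a + v) =
      (fps_of_poly b * F_fps y + fps_of_poly a) + (fps_of_poly u * F_fps y + fps_of_poly v)"
    by (simp add: fps_of_poly_add algebra_simps)
  ultimately have "Pade m (F_fps y) (b + u) (a + v)"
    using assms by (simp add: Pade_def)
  from Pade_unique[OF P this] show "u = 0" "v = 0" by auto
qed

text \<open>For m > 0 the order-0 condition gives a(0) = - b(0), so b(0) = 0 would make the second
  column of \<open>E 0\<close> vanish, against determinant 1. For m = 0 the normalization gives b(0)
  = 1.\<close>

lemma Pade_coeff_0:
  assumes P: "Pade m (F_fps y) b a"
  shows "coeff b 0 \<noteq> 0" "m > 0 \<Longrightarrow> coeff a 0 = - coeff b 0"
proof -
  show a: "coeff a 0 = - coeff b 0" if "m > 0"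
  proof -
    have "fps_nth (fps_of_poly b * F_fps y + fps_of_poly a) 0 = 0"
      using P that unfolding Pade_def by (metis mult_pos_pos zero_less_numeral)
    thus ?thesis by (simp add: F_fps_0 add_eq_0_iff)
  qed
  obtain E :: "complex \<Rightarrow> cmat2" where E: "RH_entire (P_jump (int m) y) (\<lambda>l. sigma3_pow l (int m)) E"
    "\<And>l. E l $ 1 $ 2 = poly a (- l)" "\<And>l. E l $ 2 $ 2 = poly b l"
    using Pade_imp_RH_entire_P[OF P] by blast
  have "det (E 0) = 1"
    by (rule RH_entire_det[OF _ _ E(1)]) auto
  hence "E 0 $ 1 $ 1 * coeff b 0 - coeff a 0 * E 0 $ 2 $ 1 = 1"
    by (simp add: det_2 E poly_0_coeff_0)
  moreover have "m = 0 \<Longrightarrow> coeff b 0 = 1" using P by (auto simp: Pade_def)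
  ultimately show "coeff b 0 \<noteq> 0" using a by (cases "m = 0") auto
qed

section \<open>The Lax pair\<close>

lemma F_fps_deriv: "fps_deriv (F_fps y) = fps_const (2 * \<i>) * (fps_const y + fps_const 6 * fps_X ^ 2) * F_fps y"
proof (rule fps_expansion_unique_complex)
  let ?F = "\<lambda>l. exp (2 * \<i> * theta l y)"
  have d: "(?F has_field_derivative 2 * \<i> * (y + 6 * l ^ 2) * ?F l) (at l)" for l
    unfolding theta_def by (auto intro!: derivative_eq_intros simp: algebra_simps)
  hence "deriv ?F = (\<lambda>l. 2 * \<i> * (y + 6 * l ^ 2) * ?F l)" by (auto intro: DERIV_imp_deriv)
  with has_fps_expansion_deriv[OF F_fps_expansion[of y]]
  show "(\<lambda>l. 2 * \<i> * (y + 6 * l ^ 2) * ?F l) has_fps_expansion fps_deriv (F_fps y)" by simp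
  show "(\<lambda>l. 2 * \<i> * (y + 6 * l ^ 2) * ?F l) has_fps_expansion
     fps_const (2 * \<i>) * (fps_const y + fps_const 6 * fps_X ^ 2) * F_fps y"
    by (intro has_fps_expansion_mult has_fps_expansion_add has_fps_expansion_const
        has_fps_expansion_fps_X_power F_fps_expansion)
qed

section \<open>The reflection \<lambda> -> - \<lambda>\<close>

definition fps_reflect :: "complex fps \<Rightarrow> complex fps" where
  "fps_reflect F = fps_compose F (- fps_X)"

lemma fps_reflect_nth [simp]: "fps_nth (fps_reflect F) n = (- 1) ^ n * fps_nth F n"
  by (simp add: fps_reflect_def fps_compose_uminus')

lemma fps_reflect_mult: "fps_reflect (F * G) = fps_reflect F * fps_reflect G"
  by (simp add: fps_reflect_def fps_compose_mult_distrib)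

lemma fps_reflect_add: "fps_reflect (F + G) = fps_reflect F + fps_reflect G"
  by (simp add: fps_reflect_def fps_compose_add_distrib)

lemma fps_reflect_reflect [simp]: "fps_reflect (fps_reflect F) = F"
  by (rule fps_ext) (simp flip: mult.assoc power_mult_distrib)

lemma F_fps_reflect: "fps_reflect (F_fps y) * F_fps y = 1"
proof (rule fps_expansion_unique_complex)
  let ?F = "\<lambda>l. exp (2 * \<i> * theta l y)"
  have "(?F \<circ> (\<lambda>l. - l)) has_fps_expansion fps_reflect (F_fps y)"
    unfolding fps_reflect_def
    by (intro has_fps_expansion_compose has_fps_expansion_minus has_fps_expansion_fps_X F_fps_expansion) simp
  hence "(\<lambda>l. ?F (- l) * ?F l) has_fps_expansion fps_reflect (F_fps y) * F_fps y"
    by (intro has_fps_expansion_mult F_fps_expansion) (simp add: o_def)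
  moreover have "?F (- l) * ?F l = 1" for l
    by (simp add: theta_def exp_add[symmetric] algebra_simps)
  ultimately show "(\<lambda>l. 1) has_fps_expansion fps_reflect (F_fps y) * F_fps y" by simp
qed auto

lemma fps_mult_nth_eq_0:
  fixes P W :: "complex fps"
  assumes "\<And>k. k < n \<Longrightarrow> fps_nth W k = 0" "k < n"
  shows "fps_nth (P * W) k = 0"
  unfolding fps_mult_nth using assms by (intro sum.neutral) auto

text \<open>\<open>Pade\<close> for terminating power series, so that reflection, multiplication by
  \<open>F_fps y\<close> and derivatives all stay in one ring.\<close>

definition fps_Pade :: "nat \<Rightarrow> complex fps \<Rightarrow> complex fps \<Rightarrow> complex fps \<Rightarrow> bool" where
  "fps_Pade m F B A \<longleftrightarrow> fps_nth B m = 1 \<and> (\<forall>k>m. fps_nth B k = 0) \<and> (\<forall>k\<ge>m. fps_nth A k = 0) \<and>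
     (\<forall>k<2*m. fps_nth (B * F + A) k = 0)"

definition poly_of_fps :: "nat \<Rightarrow> complex fps \<Rightarrow> complex poly" where
  "poly_of_fps n F = (\<Sum>k<n. monom (fps_nth F k) k)"

lemma coeff_poly_of_fps: "coeff (poly_of_fps n F) k = (if k < n then fps_nth F k else 0)"
  by (auto simp: poly_of_fps_def coeff_sum)

lemma fps_of_poly_of_fps: "(\<And>k. k \<ge> n \<Longrightarrow> fps_nth F k = 0) \<Longrightarrow> fps_of_poly (poly_of_fps n F) = F"
  by (rule fps_ext) (auto simp: coeff_poly_of_fps)

lemma fps_Pade_imp_Pade:
  assumes "fps_Pade m F B A"
  shows "Pade m F (poly_of_fps (Suc m) B) (poly_of_fps m A)"
proof -
  have "fps_of_poly (poly_of_fps (Suc m) B) = B" "fps_of_poly (poly_of_fps m A) = A"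
    using assms by (auto simp: fps_Pade_def intro!: fps_of_poly_of_fps)
  thus ?thesis
    using assms unfolding Pade_def fps_Pade_def
    by (auto simp: coeff_poly_of_fps intro!: degree_le)
qed

lemma fps_Pade_homogeneous:
  assumes P: "fps_Pade m (F_fps y) B A"
    and U: "\<And>k. k \<ge> m \<Longrightarrow> fps_nth U k = 0" and V: "\<And>k. k \<ge> m \<Longrightarrow> fps_nth V k = 0"
    and "\<And>k. k < 2 * m \<Longrightarrow> fps_nth (U * F_fps y + V) k = 0"
  shows "U = 0" "V = 0"
proof -
  have "fps_of_poly (poly_of_fps m U) = U" "fps_of_poly (poly_of_fps m V) = V"
    using U V by (auto intro: fps_of_poly_of_fps)
  moreover from this have "poly_of_fps m U = 0" "poly_of_fps m V = 0"
    using Pade_homogeneous[OF fps_Pade_imp_Pade[OF P], of "poly_of_fps m U" "poly_of_fps m V"] assms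
    by (simp_all add: coeff_poly_of_fps)
  ultimately show "U = 0" "V = 0" by auto
qed

lemma fps_Pade_coeff_0:
  assumes P: "fps_Pade m (F_fps y) B A"
  shows "fps_nth B 0 \<noteq> 0" "m > 0 \<Longrightarrow> fps_nth A 0 = - fps_nth B 0"
  using Pade_coeff_0[OF fps_Pade_imp_Pade[OF P]] by (auto simp: coeff_poly_of_fps)

text \<open>Replacing \<open>\<lambda>\<close> by \<open>- \<lambda>\<close> and multiplying by \<open>F\<close> exchanges the two members of the pair.\<close>

lemma fps_Pade_reflect:
  assumes P: "fps_Pade m (F_fps y) B A" and k: "k < 2 * m"
  shows "fps_nth (fps_reflect A * F_fps y + fps_reflect B) k = 0"
proof -
  have "fps_reflect A * F_fps y + fps_reflect B = F_fps y * fps_reflect (B * F_fps y + A)"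
    using F_fps_reflect[of y] by (simp add: fps_reflect_add fps_reflect_mult algebra_simps)
  also have "fps_nth \<dots> k = 0"
  proof (rule fps_mult_nth_eq_0[of "2 * m", OF _ k])
    fix j assume "j < 2 * m"
    thus "fps_nth (fps_reflect (B * F_fps y + A)) j = 0"
      using P unfolding fps_reflect_nth fps_Pade_def by simp
  qed
  finally show ?thesis .
qed

text \<open>From the y-derivative of the Pade relation, 2 i \<lambda> times the relation and
  \<kappa> times its reflected form are subtracted. The result is a homogeneous solution: \<kappa>
  is chosen to cancel the coefficient of degree m in \<open>V\<close>. The derivatives enter as
  arbitrary series \<open>dB\<close> and \<open>dA\<close>, which keeps the argument purely
  algebraic; the bound on \<open>dB\<close> reflects that B is monic.\<close>

lemma Lax_y:
  assumes P: "fps_Pade m (F_fps y) B A"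
    and dB: "\<And>k. k \<ge> m \<Longrightarrow> fps_nth dB k = 0" and dA: "\<And>k. k \<ge> m \<Longrightarrow> fps_nth dA k = 0"
    and d: "\<And>k. k < 2 * m \<Longrightarrow>
      fps_nth (dB * F_fps y + B * (fps_const (2 * \<i>) * fps_X * F_fps y) + dA) k = 0"
  defines "\<kappa> \<equiv> 2 * \<i> * fps_nth (fps_X * fps_reflect A) m"
  shows "dB = fps_const \<kappa> * fps_reflect A"
    "fps_reflect dA = - fps_const (2 * \<i>) * fps_X * fps_reflect A + fps_const \<kappa> * B"
proof -
  define U where "U = dB - fps_const \<kappa> * fps_reflect A"
  define V where "V = dA - fps_const (2 * \<i>) * (fps_X * A) - fps_const \<kappa> * fps_reflect B"
  have Bm: "fps_nth B m = 1" and B: "\<And>k. k > m \<Longrightarrow> fps_nth B k = 0"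
    and A: "\<And>k. k \<ge> m \<Longrightarrow> fps_nth A k = 0"
    and W: "\<And>k. k < 2 * m \<Longrightarrow> fps_nth (B * F_fps y + A) k = 0"
    using P by (auto simp: fps_Pade_def)
  have U0: "fps_nth U k = 0" if "k \<ge> m" for k
    using that dB A by (simp add: U_def)
  have V0: "fps_nth V k = 0" if "k \<ge> m" for k
  proof (cases "k = m")
    case True
    show ?thesis
    proof (cases m)
      case 0
      thus ?thesis using True dA by (simp add: V_def \<kappa>_def)
    next
      case (Suc n)
      have "(-1 :: complex) ^ n * (-1) ^ n = 1" by (simp flip: power_mult_distrib)
      thus ?thesis using True dA[of m] Bm Suc by (simp add: V_def \<kappa>_def)
    qed
  next
    case False
    with that have "k > m" by simp
    thus ?thesis using dA[of k] B[of k] A[of "k - 1"] by (simp add: V_def)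
  qed
  have eq: "U * F_fps y + V =
     (dB * F_fps y + B * (fps_const (2 * \<i>) * fps_X * F_fps y) + dA)
     - fps_const (2 * \<i>) * fps_X * (B * F_fps y + A)
     - fps_const \<kappa> * (fps_reflect A * F_fps y + fps_reflect B)"
    unfolding U_def V_def by (simp add: algebra_simps)
  have "fps_nth (U * F_fps y + V) k = 0" if "k < 2 * m" for k
    unfolding eq fps_sub_nth
    by (simp only: d that fps_mult_nth_eq_0[of "2 * m", OF W that]
        fps_mult_nth_eq_0[of "2 * m", OF fps_Pade_reflect[OF P] that] diff_zero)
  hence UV: "U = 0" "V = 0"
    using fps_Pade_homogeneous[OF P, of U V] U0 V0 by blast+
  show "dB = fps_const \<kappa> * fps_reflect A" using UV(1) by (simp add: U_def)
  have "dA = fps_const (2 * \<i>) * (fps_X * A) + fps_const \<kappa> * fps_reflect B"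
    using UV(2) by (simp add: V_def algebra_simps)
  hence "fps_reflect dA = fps_const (2 * \<i>) * (fps_reflect fps_X * fps_reflect A) +
      fps_const \<kappa> * B"
    by (simp add: fps_reflect_add fps_reflect_mult) (simp add: fps_reflect_def)
  thus "fps_reflect dA = - fps_const (2 * \<i>) * fps_X * fps_reflect A + fps_const \<kappa> * B"
    by (simp add: fps_reflect_def mult.assoc fps_const_neg[symmetric] del: fps_const_neg)
qed

text \<open>The coefficients of \<open>\<alpha>\<close> and \<open>\<beta>\<close> are chosen to cancel all terms of degree at least \<open>m\<close> in
  \<open>U = \<lambda> B' - \<alpha> B - \<beta> A\<close> and \<open>V\<close>; evaluating \<open>U = 0\<close> at the origin gives the relation.\<close>

lemma Lax_lambda:
  assumes P: "fps_Pade m (F_fps y) B At"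
  defines "A \<equiv> fps_reflect At"
  defines "a \<equiv> fps_nth (fps_X ^ 1 * A) m" and "a2 \<equiv> fps_nth (fps_X ^ 2 * A) m"
    and "a3 \<equiv> fps_nth (fps_X ^ 3 * A) m"
    and "b1 \<equiv> fps_nth (fps_X ^ 1 * B) m" and "b2 \<equiv> fps_nth (fps_X ^ 2 * B) m"
  shows "of_nat m = 12 * \<i> * a3 - 12 * \<i> * a ^ 3 + 2 * \<i> * y * a
    - 12 * \<i> * (a2 - a * b1) * b1 - 12 * \<i> * a * b2"
proof -
  define \<alpha>1 \<beta>2 \<beta>1 where "\<alpha>1 = - 12 * \<i> * a ^ 2" and "\<beta>2 = 12 * \<i> * a"
    and "\<beta>1 = - 12 * \<i> * (a2 - a * b1)"
  define \<beta>0 where "\<beta>0 = 12 * \<i> * a3 + \<alpha>1 * a + 2 * \<i> * y * a + \<beta>1 * b1 - \<beta>2 * b2"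
  define \<alpha> where "\<alpha> = fps_const (of_nat m) + fps_const \<alpha>1 * fps_X"
  define \<beta> where "\<beta> = fps_const \<beta>0 + fps_const \<beta>1 * fps_X + fps_const \<beta>2 * fps_X ^ 2"
  define \<tau> where "\<tau> = fps_const (2 * \<i>) * (fps_const y + fps_const 6 * fps_X ^ 2)"
  define U where "U = fps_X * fps_deriv B - \<alpha> * B - \<beta> * A"
  define V where "V = fps_X * fps_deriv At - fps_X * \<tau> * At - \<alpha> * At - \<beta> * fps_reflect B"
  define F where "F = F_fps y"
  have Bm: "fps_nth B m = 1" and B: "\<And>k. k > m \<Longrightarrow> fps_nth B k = 0"
    and At: "\<And>k. k \<ge> m \<Longrightarrow> fps_nth At k = 0"
    and W: "\<And>k. k < 2 * m \<Longrightarrow> fps_nth (B * F + At) k = 0"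
    using P by (auto simp: fps_Pade_def F_def)
  have A: "\<And>k. k \<ge> m \<Longrightarrow> fps_nth A k = 0" using At by (simp add: A_def)
  have shift: "fps_nth (fps_X ^ j * At) k = (- 1) ^ k * (- 1) ^ j * fps_nth (fps_X ^ j * A) k"
    "fps_nth (fps_X ^ j * fps_reflect B) k = (- 1) ^ k * (- 1) ^ j * fps_nth (fps_X ^ j * B) k" for j k
  proof -
    have "(-1 :: complex) ^ k * (-1) ^ j * (-1) ^ (k - j) = 1" if "k \<ge> j"
    proof -
      have "(-1 :: complex) ^ k = (-1) ^ j * (-1) ^ (k - j)" using that by (simp flip: power_add)
      thus ?thesis by (simp add: mult_ac flip: power_mult_distrib)
    qed
    moreover have "(-1 :: complex) ^ (k - j) = (-1) ^ k * (-1) ^ j" if "k \<ge> j"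
      using that by (simp add: power_diff_conv_inverse)
    ultimately show "fps_nth (fps_X ^ j * At) k = (- 1) ^ k * (- 1) ^ j * fps_nth (fps_X ^ j * A) k"
      "fps_nth (fps_X ^ j * fps_reflect B) k = (- 1) ^ k * (- 1) ^ j * fps_nth (fps_X ^ j * B) k"
      by (auto simp: fps_X_power_mult_nth A_def mult.assoc[symmetric])
  qed
  have Uk: "fps_nth U k = of_nat k * fps_nth B k - of_nat m * fps_nth B k - \<alpha>1 * fps_nth (fps_X ^ 1 * B) k
     - \<beta>0 * fps_nth A k - \<beta>1 * fps_nth (fps_X ^ 1 * A) k - \<beta>2 * fps_nth (fps_X ^ 2 * A) k" for k
  proof -
    have "U = fps_X * fps_deriv B - fps_const (of_nat m) * B - fps_const \<alpha>1 * (fps_X ^ 1 * B)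
       - fps_const \<beta>0 * A - fps_const \<beta>1 * (fps_X ^ 1 * A) - fps_const \<beta>2 * (fps_X ^ 2 * A)"
      by (simp add: U_def \<alpha>_def \<beta>_def algebra_simps)
    moreover have "fps_nth (fps_X * fps_deriv B) k = of_nat k * fps_nth B k" by (cases k) simp_all
    ultimately show ?thesis by (simp only: fps_sub_nth fps_mult_left_const_nth)
  qed
  have Vk: "fps_nth V k = of_nat k * fps_nth At k - of_nat m * fps_nth At k - (-1) ^ k *
     (- (2 * \<i> * y + \<alpha>1) * fps_nth (fps_X ^ 1 * A) k - 12 * \<i> * fps_nth (fps_X ^ 3 * A) k
      + \<beta>0 * fps_nth (fps_X ^ 0 * B) k - \<beta>1 * fps_nth (fps_X ^ 1 * B) k + \<beta>2 * fps_nth (fps_X ^ 2 * B) k)" for k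
  proof -
    have "V = fps_X * fps_deriv At - fps_const (of_nat m) * At - fps_const (2 * \<i> * y + \<alpha>1) * (fps_X ^ 1 * At)
       - fps_const (12 * \<i>) * (fps_X ^ 3 * At) - fps_const \<beta>0 * (fps_X ^ 0 * fps_reflect B)
       - fps_const \<beta>1 * (fps_X ^ 1 * fps_reflect B) - fps_const \<beta>2 * (fps_X ^ 2 * fps_reflect B)"
      by (simp add: V_def \<alpha>_def \<beta>_def \<tau>_def algebra_simps power2_eq_square power3_eq_cube
          fps_const_add[symmetric] fps_const_mult[symmetric] del: fps_const_add fps_const_mult)
    moreover have "fps_nth (fps_X * fps_deriv At) k = of_nat k * fps_nth At k" by (cases k) simp_all
    ultimately show ?thesis
      by (simp only: fps_sub_nth fps_mult_left_const_nth shift) (simp add: algebra_simps)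
  qed
  have U0: "fps_nth U k = 0" if km: "k \<ge> m" for k
  proof -
    consider "k = m" | "k = m + 1" | "k > m + 1" using km by atomize_elim presburger
    thus ?thesis
    proof cases
      case 1
      have e: "fps_nth B k = 1" "fps_nth A k = 0" "fps_nth (fps_X ^ 1 * B) k = b1"
        "fps_nth (fps_X ^ 1 * A) k = a" "fps_nth (fps_X ^ 2 * A) k = a2"
        using 1 Bm A[of m] by (simp_all only: b1_def a_def a2_def)
      show ?thesis unfolding Uk e using 1
        by (simp add: \<alpha>1_def \<beta>1_def \<beta>2_def algebra_simps power2_eq_square)
    next
      case 2
      have e: "fps_nth B k = 0" "fps_nth A k = 0" "fps_nth (fps_X ^ 2 * A) k = a"
        "fps_nth (fps_X ^ 1 * A) k = 0" "fps_nth (fps_X ^ 1 * B) k = 1"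
        using 2 A[of m] A[of k] B[of k] Bm by (auto simp: fps_X_power_mult_nth a_def simp del: power_one_right)
      show ?thesis unfolding Uk e by (simp add: \<alpha>1_def \<beta>2_def power2_eq_square)
    next
      case 3
      have e: "fps_nth B k = 0" "fps_nth A k = 0" "fps_nth (fps_X ^ 2 * A) k = 0"
        "fps_nth (fps_X ^ 1 * A) k = 0" "fps_nth (fps_X ^ 1 * B) k = 0"
        using 3 A B by (auto simp: fps_X_power_mult_nth simp del: power_one_right)
      show ?thesis unfolding Uk e by simp
    qed
  qed
  have V0: "fps_nth V k = 0" if km: "k \<ge> m" for k
  proof -
    have At': "fps_nth At k = 0" using At km by simp
    consider "k = m" | "k = m + 1" | "k = m + 2" | "k > m + 2" using km by atomize_elim presburger
    thus ?thesis
    proof cases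
      case 1
      have e: "fps_nth (fps_X ^ 0 * B) k = 1" "fps_nth (fps_X ^ 1 * B) k = b1" "fps_nth (fps_X ^ 2 * B) k = b2"
        "fps_nth (fps_X ^ 1 * A) k = a" "fps_nth (fps_X ^ 3 * A) k = a3"
        using 1 Bm by (simp_all only: b1_def b2_def a_def a3_def power_0 mult_1_left)
      show ?thesis unfolding Vk e At' by (simp add: \<beta>0_def algebra_simps)
    next
      case 2
      have e: "fps_nth (fps_X ^ 0 * B) k = 0" "fps_nth (fps_X ^ 1 * B) k = 1" "fps_nth (fps_X ^ 2 * B) k = b1"
        "fps_nth (fps_X ^ 1 * A) k = 0" "fps_nth (fps_X ^ 3 * A) k = a2"
        using 2 A[of m] Bm B[of k]
        by (auto simp: fps_X_power_mult_nth a2_def b1_def simp del: power_one_right)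
      show ?thesis unfolding Vk e At' by (simp add: \<beta>1_def \<beta>2_def algebra_simps)
    next
      case 3
      have e: "fps_nth (fps_X ^ 0 * B) k = 0" "fps_nth (fps_X ^ 1 * B) k = 0" "fps_nth (fps_X ^ 2 * B) k = 1"
        "fps_nth (fps_X ^ 1 * A) k = 0" "fps_nth (fps_X ^ 3 * A) k = a"
        using 3 A[of "m + 1"] B[of "m + 1"] B[of k] Bm
        by (auto simp: fps_X_power_mult_nth a_def simp del: power_one_right)
      show ?thesis unfolding Vk e At' by (simp add: \<beta>2_def)
    next
      case 4
      have e: "fps_nth (fps_X ^ 0 * B) k = 0" "fps_nth (fps_X ^ 1 * B) k = 0" "fps_nth (fps_X ^ 2 * B) k = 0"
        "fps_nth (fps_X ^ 1 * A) k = 0" "fps_nth (fps_X ^ 3 * A) k = 0"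
        using 4 A B by (auto simp: fps_X_power_mult_nth simp del: power_one_right)
      show ?thesis unfolding Vk e At' by simp
    qed
  qed
  have dF: "fps_deriv F = \<tau> * F"
    by (simp only: F_def F_fps_deriv \<tau>_def)
  \<comment> \<open>The Euler operator \<lambda> d/d\<lambda> multiplies the k-th coefficient by k,
    so it keeps the full order of contact 2m, which a bare derivative would lower by one.\<close>
  have "U * F + V = fps_X * fps_deriv (B * F + At) - (fps_X * \<tau> + \<alpha>) * (B * F + At)
     - \<beta> * (A * F + fps_reflect B)"
    unfolding U_def V_def by (simp add: dF algebra_simps)
  moreover have "fps_nth (fps_X * fps_deriv (B * F + At)) k = 0" if "k < 2 * m" for k
  proof -
    have "fps_nth (fps_X * fps_deriv (B * F + At)) k = of_nat k * fps_nth (B * F + At) k"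
      by (cases k) (simp_all del: fps_add_nth fps_deriv_add fps_deriv_mult)
    thus ?thesis using W[OF that] by simp
  qed
  ultimately have "fps_nth (U * F + V) k = 0" if "k < 2 * m" for k
    using that by (simp only: fps_sub_nth fps_mult_nth_eq_0[of "2 * m", OF W that]
        fps_mult_nth_eq_0[of "2 * m", OF fps_Pade_reflect[OF P, folded F_def A_def] that] diff_zero)
  hence "U = 0"
    using fps_Pade_homogeneous(1)[OF P, of U V] U0 V0 unfolding F_def by blast
  hence rel: "of_nat m * fps_nth B 0 + \<beta>0 * fps_nth A 0 = 0"
    using Uk[of 0] by (simp add: algebra_simps eq_neg_iff_add_eq_0)
  \<comment> \<open>At the origin A = - B with B(0) nonzero, so the relation reads m = \<beta>0. For
    m = 0 the series \<open>A\<close> is zero and \<beta>0 with it.\<close>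
  have "of_nat m = \<beta>0"
  proof (cases "m = 0")
    case True
    thus ?thesis using A by (simp add: \<beta>0_def \<beta>2_def \<alpha>1_def \<beta>1_def a_def a2_def a3_def)
  next
    case False
    hence "fps_nth A 0 = - fps_nth B 0" "fps_nth B 0 \<noteq> 0"
      using fps_Pade_coeff_0[OF P] by (simp_all add: A_def)
    with rel show ?thesis by (simp add: left_diff_distrib[symmetric])
  qed
  thus ?thesis
    unfolding \<beta>0_def \<alpha>1_def \<beta>1_def \<beta>2_def by (simp add: algebra_simps power2_eq_square power3_eq_cube)
qed

section \<open>Dependence on the parameter \<open>y\<close>\<close>

text \<open>Differentiation in the parameter, coefficient by coefficient: each coefficient of a
  product is a finite sum, so the product rule needs no topology on series.\<close>

definition fps_has_deriv :: "(complex \<Rightarrow> complex fps) \<Rightarrow> complex fps \<Rightarrow> complex \<Rightarrow> bool" where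
  "fps_has_deriv \<Phi> \<Phi>' y \<longleftrightarrow>
     (\<forall>k. ((\<lambda>y. fps_nth (\<Phi> y) k) has_field_derivative fps_nth \<Phi>' k) (at y))"

lemma fps_has_derivD:
  "fps_has_deriv \<Phi> \<Phi>' y \<Longrightarrow> ((\<lambda>y. fps_nth (\<Phi> y) k) has_field_derivative fps_nth \<Phi>' k) (at y)"
  by (simp add: fps_has_deriv_def)

lemma fps_has_deriv_const: "fps_has_deriv (\<lambda>_. G) 0 y"
  by (simp add: fps_has_deriv_def)

lemma fps_has_deriv_mult:
  assumes "fps_has_deriv \<Phi> \<Phi>' y" "fps_has_deriv \<Psi> \<Psi>' y"
  shows "fps_has_deriv (\<lambda>y. \<Phi> y * \<Psi> y) (\<Phi>' * \<Psi> y + \<Phi> y * \<Psi>') y"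
  unfolding fps_has_deriv_def
proof
  fix k
  have "((\<lambda>y. \<Sum>i=0..k. fps_nth (\<Phi> y) i * fps_nth (\<Psi> y) (k - i)) has_field_derivative
     (\<Sum>i=0..k. fps_nth (\<Phi> y) i * fps_nth \<Psi>' (k - i) + fps_nth \<Phi>' i * fps_nth (\<Psi> y) (k - i))) (at y)"
    by (intro DERIV_sum DERIV_mult' fps_has_derivD assms)
  thus "((\<lambda>y. fps_nth (\<Phi> y * \<Psi> y) k) has_field_derivative
      fps_nth (\<Phi>' * \<Psi> y + \<Phi> y * \<Psi>') k) (at y)"
    by (simp add: fps_mult_nth sum.distrib add.commute)
qed

lemma fps_has_deriv_cmult:
  "fps_has_deriv \<Phi> \<Phi>' y \<Longrightarrow> fps_has_deriv (\<lambda>y. G * \<Phi> y) (G * \<Phi>') y"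
  using fps_has_deriv_mult[OF fps_has_deriv_const, of \<Phi> \<Phi>' y G] by simp

lemma fps_has_deriv_reflect:
  "fps_has_deriv \<Phi> \<Phi>' y \<Longrightarrow> fps_has_deriv (\<lambda>y. fps_reflect (\<Phi> y)) (fps_reflect \<Phi>') y"
  by (auto simp: fps_has_deriv_def intro!: DERIV_cmult)

lemma fps_has_deriv_F: "fps_has_deriv F_fps (fps_const (2 * \<i>) * fps_X * F_fps y) y"
proof -
  have "fps_has_deriv (\<lambda>y. fps_exp (2 * \<i> * y)) (fps_const (2 * \<i>) * fps_X * fps_exp (2 * \<i> * y)) y"
    unfolding fps_has_deriv_def
  proof
    fix k
    show "((\<lambda>y. fps_nth (fps_exp (2 * \<i> * y)) k) has_field_derivative
        fps_nth (fps_const (2 * \<i>) * fps_X * fps_exp (2 * \<i> * y)) k) (at y)"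
    proof (cases k)
      case (Suc n)
      have "((\<lambda>y. (2 * \<i> * y) ^ Suc n / fact (Suc n)) has_field_derivative
         of_nat (Suc n) * (2 * \<i> * y) ^ n * (2 * \<i>) / fact (Suc n)) (at y)"
        by (auto intro!: derivative_eq_intros simp del: fact_Suc power_Suc)
      also have "of_nat (Suc n) * (2 * \<i> * y) ^ n * (2 * \<i>) / fact (Suc n) = 2 * \<i> * ((2 * \<i> * y) ^ n / fact n)"
        by (simp add: field_simps del: of_nat_Suc)
      finally show ?thesis using Suc by (simp add: mult.assoc del: fact_Suc power_Suc)
    qed (simp add: mult.assoc)
  qed
  from fps_has_deriv_mult[OF this fps_has_deriv_const[of g_fps]]
  show ?thesis unfolding F_fps_def[abs_def] by (simp add: mult.assoc)
qed

text \<open>\<open>R\<close> solves the Pade system over the polynomials in \<open>y\<close>. Common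
  factors are permitted, so that the locale can be instantiated again once a power of y - y0 has
  been cancelled.\<close>

locale Pade_family =
  fixes m :: nat and R :: "nat \<Rightarrow> complex poly"
  assumes Rm: "R m \<noteq> 0"
    and R: "m \<le> k \<Longrightarrow> k < 2 * m \<Longrightarrow> (\<Sum>j\<le>m. R j * exp_coeff_poly g_fps (k - j)) = 0"
begin

definition S :: "complex set" where "S = {y. poly (R m) y \<noteq> 0}"

definition Bf :: "complex \<Rightarrow> complex fps" where
  "Bf y = Abs_fps (\<lambda>j. if j \<le> m then poly (R j) y / poly (R m) y else 0)"

definition Af :: "complex \<Rightarrow> complex fps" where
  "Af y = Abs_fps (\<lambda>k. if k < m then - fps_nth (Bf y * F_fps y) k else 0)"

definition \<kappa> :: "complex \<Rightarrow> complex" where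
  "\<kappa> y = 2 * \<i> * fps_nth (fps_X * fps_reflect (Af y)) m"

definition dB :: "complex \<Rightarrow> complex fps" where
  "dB y = Abs_fps (\<lambda>j. if j \<le> m then (poly (pderiv (R j)) y * poly (R m) y -
     poly (R j) y * poly (pderiv (R m)) y) / (poly (R m) y) ^ 2 else 0)"

definition dA :: "complex \<Rightarrow> complex fps" where
  "dA y = Abs_fps (\<lambda>k. if k < m then
     - fps_nth (dB y * F_fps y + Bf y * (fps_const (2 * \<i>) * fps_X * F_fps y)) k else 0)"

lemma open_S: "open S"
proof -
  have "S = UNIV - {y. poly (R m) y = 0}" by (auto simp: S_def)
  thus ?thesis using poly_roots_finite[OF Rm] by (simp add: finite_imp_closed open_Diff)
qed

lemma Bf_F_nth:
  "fps_nth (Bf y * F_fps y) k =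
     poly (\<Sum>j\<le>min k m. R j * exp_coeff_poly g_fps (k - j)) y / poly (R m) y"
proof -
  have "fps_nth (Bf y * F_fps y) k = (\<Sum>j\<le>min k m. fps_nth (Bf y) j * fps_nth (F_fps y) (k - j))"
    unfolding fps_mult_nth by (intro sum.mono_neutral_right) (auto simp: Bf_def)
  also have "\<dots> = (\<Sum>j\<le>min k m. poly (R j) y / poly (R m) y * poly (exp_coeff_poly g_fps (k - j)) y)"
    by (intro sum.cong) (auto simp: Bf_def poly_exp_coeff_poly F_fps_def)
  also have "\<dots> = poly (\<Sum>j\<le>min k m. R j * exp_coeff_poly g_fps (k - j)) y / poly (R m) y"
    by (simp add: poly_sum sum_divide_distrib)
  finally show ?thesis .
qed

lemma Bf_F_nth_0: "m \<le> k \<Longrightarrow> k < 2 * m \<Longrightarrow> fps_nth (Bf y * F_fps y) k = 0"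
  using R[of k] by (simp add: Bf_F_nth min.absorb2)

lemma Pade_S: "y \<in> S \<Longrightarrow> fps_Pade m (F_fps y) (Bf y) (Af y)"
  unfolding fps_Pade_def using Bf_F_nth_0[of _ y]
  by (auto simp: S_def Af_def Bf_def not_less)

lemma Bf_deriv: "y \<in> S \<Longrightarrow> fps_has_deriv Bf (dB y) y"
  unfolding fps_has_deriv_def Bf_def dB_def S_def
  by (auto intro!: derivative_eq_intros simp: power2_eq_square)

lemma Bf_F_deriv:
  "y \<in> S \<Longrightarrow> fps_has_deriv (\<lambda>y. Bf y * F_fps y)
     (dB y * F_fps y + Bf y * (fps_const (2 * \<i>) * fps_X * F_fps y)) y"
  by (intro fps_has_deriv_mult Bf_deriv fps_has_deriv_F)

lemma Af_deriv: "y \<in> S \<Longrightarrow> fps_has_deriv Af (dA y) y"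
  unfolding fps_has_deriv_def Af_def dA_def
  by (auto intro!: DERIV_minus fps_has_derivD[OF Bf_F_deriv] simp del: fps_add_nth)

lemma d_cond:
  assumes y: "y \<in> S" and k: "k < 2 * m"
  shows "fps_nth (dB y * F_fps y + Bf y * (fps_const (2 * \<i>) * fps_X * F_fps y) + dA y) k = 0"
proof (cases "k < m")
  case True
  thus ?thesis by (simp add: dA_def)
next
  case False
  let ?d = "dB y * F_fps y + Bf y * (fps_const (2 * \<i>) * fps_X * F_fps y)"
  have "((\<lambda>y. fps_nth (Bf y * F_fps y) k) has_field_derivative fps_nth ?d k) (at y)"
    by (rule fps_has_derivD[OF Bf_F_deriv[OF y]])
  \<comment> \<open>The numerator is the zero polynomial, so this coefficient vanishes for every
    \<open>y\<close>, including the zeros of \<open>R m\<close>, and so does its derivative.\<close>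
  moreover have "(\<lambda>y. fps_nth (Bf y * F_fps y) k) = (\<lambda>_. 0)"
    using False k by (simp add: Bf_F_nth_0)
  ultimately have "fps_nth ?d k = 0" by (metis DERIV_const DERIV_unique)
  thus ?thesis using False by (simp add: dA_def)
qed

lemma dB_top: "k \<ge> m \<Longrightarrow> fps_nth (dB y) k = 0"
  by (simp add: dB_def)

lemma Lax:
  assumes "y \<in> S"
  shows "dB y = fps_const (\<kappa> y) * fps_reflect (Af y)"
    "fps_reflect (dA y) = - fps_const (2 * \<i>) * fps_X * fps_reflect (Af y) + fps_const (\<kappa> y) * Bf y"
  using Lax_y[OF Pade_S[OF assms] dB_top _ d_cond[OF assms]]
  unfolding \<kappa>_def by (auto simp: dA_def)

text \<open>The coefficient of \<lambda>^(m - j), read off after a shift so that it is 0 for j > m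
  without a case distinction.\<close>

definition cA :: "nat \<Rightarrow> complex \<Rightarrow> complex" where
  "cA j y = fps_nth (fps_X ^ j * fps_reflect (Af y)) m"

definition cB :: "nat \<Rightarrow> complex \<Rightarrow> complex" where
  "cB j y = fps_nth (fps_X ^ j * Bf y) m"

lemma \<kappa>_cA: "\<kappa> y = 2 * \<i> * cA 1 y"
  by (simp add: \<kappa>_def cA_def)

lemma cA_deriv:
  assumes "y \<in> S"
  shows "(cA j has_field_derivative - 2 * \<i> * cA (Suc j) y + \<kappa> y * cB j y) (at y)"
proof -
  have "fps_has_deriv (\<lambda>y. fps_X ^ j * fps_reflect (Af y)) (fps_X ^ j * fps_reflect (dA y)) y"
    by (intro fps_has_deriv_cmult fps_has_deriv_reflect Af_deriv assms)
  from fps_has_derivD[OF this, of m]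
  have "(cA j has_field_derivative fps_nth (fps_X ^ j * fps_reflect (dA y)) m) (at y)"
    by (simp only: cA_def[abs_def])
  also have "fps_X ^ j * fps_reflect (dA y) =
      fps_const (- 2 * \<i>) * (fps_X ^ Suc j * fps_reflect (Af y)) + fps_const (\<kappa> y) * (fps_X ^ j * Bf y)"
    unfolding Lax(2)[OF assms] by (simp add: algebra_simps fps_const_neg[symmetric] del: fps_const_neg)
  finally show ?thesis
    by (simp only: fps_add_nth fps_mult_left_const_nth cA_def[symmetric] cB_def[symmetric])
qed

lemma cB_deriv:
  assumes "y \<in> S"
  shows "(cB j has_field_derivative \<kappa> y * cA j y) (at y)"
proof -
  have "fps_has_deriv (\<lambda>y. fps_X ^ j * Bf y) (fps_X ^ j * dB y) y"
    by (intro fps_has_deriv_cmult Bf_deriv assms)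
  from fps_has_derivD[OF this, of m]
  have "(cB j has_field_derivative fps_nth (fps_X ^ j * dB y) m) (at y)"
    by (simp only: cB_def[abs_def])
  also have "fps_X ^ j * dB y = fps_const (\<kappa> y) * (fps_X ^ j * fps_reflect (Af y))"
    unfolding Lax(1)[OF assms] by (simp add: algebra_simps)
  finally show ?thesis
    by (simp only: fps_mult_left_const_nth cA_def[symmetric])
qed

text \<open>Compatibility of the equations in \<lambda> and \<open>y\<close>: two derivatives in
  \<open>y\<close> produce \<open>cA 2\<close>, \<open>cA 3\<close>, \<open>cB 1\<close> and
  \<open>cB 2\<close>, and the relation of \<open>Lax_lambda\<close>, times -2/3, accounts for
  exactly these.\<close>

lemma \<kappa>_PII:
  assumes y: "y \<in> S"
  shows "deriv (deriv \<kappa>) y = 2 * \<kappa> y ^ 3 + 2/3 * y * \<kappa> y - 2/3 * of_nat m"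
proof -
  have \<kappa>: "\<kappa> = (\<lambda>y. 2 * \<i> * cA 1 y)" by (rule ext) (rule \<kappa>_cA)
  have d1: "deriv \<kappa> u = 4 * cA 2 u - 4 * cA 1 u * cB 1 u" if "u \<in> S" for u
  proof -
    have "(\<kappa> has_field_derivative 2 * \<i> * (- 2 * \<i> * cA (Suc 1) u + \<kappa> u * cB 1 u)) (at u)"
      unfolding \<kappa> by (intro DERIV_cmult cA_deriv[OF that, unfolded \<kappa>])
    hence "deriv \<kappa> u = 2 * \<i> * (- 2 * \<i> * cA (Suc 1) u + \<kappa> u * cB 1 u)" by (rule DERIV_imp_deriv)
    thus ?thesis by (simp add: \<kappa>_cA numeral_2_eq_2 algebra_simps)
  qed
  have "((\<lambda>u. 4 * cA 2 u - 4 * cA 1 u * cB 1 u) has_field_derivative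
      4 * (- 2 * \<i> * cA (Suc 2) y + \<kappa> y * cB 2 y) -
      (4 * (- 2 * \<i> * cA (Suc 1) y + \<kappa> y * cB 1 y) * cB 1 y + \<kappa> y * cA 1 y * (4 * cA 1 y))) (at y)"
    by (intro DERIV_diff DERIV_mult DERIV_cmult cA_deriv cB_deriv y)
  hence "(deriv \<kappa> has_field_derivative
      4 * (- 2 * \<i> * cA (Suc 2) y + \<kappa> y * cB 2 y) -
      (4 * (- 2 * \<i> * cA (Suc 1) y + \<kappa> y * cB 1 y) * cB 1 y + \<kappa> y * cA 1 y * (4 * cA 1 y))) (at y)"
    by (rule has_field_derivative_transform_within_open[OF _ open_S y]) (simp add: d1)
  hence "deriv (deriv \<kappa>) y =
      4 * (- 2 * \<i> * cA (Suc 2) y + \<kappa> y * cB 2 y) -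
      (4 * (- 2 * \<i> * cA (Suc 1) y + \<kappa> y * cB 1 y) * cB 1 y + \<kappa> y * cA 1 y * (4 * cA 1 y))"
    by (rule DERIV_imp_deriv)
  also have "\<dots> = 4 * (- 2 * \<i> * cA 3 y + \<kappa> y * cB 2 y) -
      (4 * (- 2 * \<i> * cA 2 y + \<kappa> y * cB 1 y) * cB 1 y + \<kappa> y * cA 1 y * (4 * cA 1 y))"
    by (simp add: numeral_2_eq_2 numeral_3_eq_3)
  finally have dd: "deriv (deriv \<kappa>) y = \<dots>" .
  have m: "of_nat m = 12 * \<i> * cA 3 y - 12 * \<i> * cA 1 y ^ 3 + 2 * \<i> * y * cA 1 y
    - 12 * \<i> * (cA 2 y - cA 1 y * cB 1 y) * cB 1 y - 12 * \<i> * cA 1 y * cB 2 y"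
    using Lax_lambda[OF Pade_S[OF y]] by (simp only: cA_def cB_def)
  have i3: "(2 * \<i> * cA 1 y) ^ 3 = - 8 * \<i> * cA 1 y ^ 3"
    by (simp add: power_mult_distrib power3_eq_cube)
  show ?thesis
    unfolding dd m \<kappa>_cA i3 by (simp add: field_simps power3_eq_cube)
qed

definition N\<kappa> :: "complex poly" where
  "N\<kappa> = (if m = 0 then 0 else
     smult (- 2 * \<i> * (- 1) ^ (m - 1)) (\<Sum>j\<le>m - 1. R j * exp_coeff_poly g_fps (m - 1 - j)))"

lemma \<kappa>_rational: "\<kappa> y = poly N\<kappa> y / poly (R m) y"
proof (cases m)
  case 0
  show ?thesis unfolding \<kappa>_def N\<kappa>_def using 0 by simp
next
  case (Suc n)
  hence m: "n < m" "m \<noteq> 0" "m - 1 = n" "min n m = n" by simp_all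
  have "fps_nth (Af y) n = - (poly (\<Sum>j\<le>n. R j * exp_coeff_poly g_fps (n - j)) y / poly (R m) y)"
    using m by (simp add: Af_def Bf_F_nth)
  thus ?thesis
    unfolding \<kappa>_def N\<kappa>_def using m by (simp add: sum_divide_distrib)
qed

text \<open>The numerators over \<open>R m\<close> of the coefficients of the reflected
  \<open>Af\<close>.\<close>

definition T :: "nat \<Rightarrow> complex poly" where
  "T j = (if j < m then smult (- ((- 1) ^ j)) (\<Sum>i\<le>j. R i * exp_coeff_poly g_fps (j - i)) else 0)"

text \<open>The first Lax equation with denominators cleared; \<kappa> is its only coefficient that
  may be singular.\<close>

lemma R_ode:
  assumes y: "y \<in> S" and j: "j \<le> m"
  shows "poly (pderiv (R j) * R m - R j * pderiv (R m)) y = \<kappa> y * poly (R m) y * poly (T j) y"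
proof -
  have D: "poly (R m) y \<noteq> 0" using y by (simp add: S_def)
  have "fps_nth (dB y) j = \<kappa> y * ((- 1) ^ j * fps_nth (Af y) j)"
    by (simp add: Lax[OF y])
  hence "poly (pderiv (R j) * R m - R j * pderiv (R m)) y = (poly (R m) y) ^ 2 * (\<kappa> y * ((- 1) ^ j * fps_nth (Af y) j))"
    using D j by (simp add: dB_def field_simps)
  moreover have "(- 1) ^ j * fps_nth (Af y) j = poly (T j) y / poly (R m) y"
    using j by (auto simp: Af_def T_def Bf_F_nth min_def)
  ultimately show ?thesis using D by (simp add: power2_eq_square)
qed

end

section \<open>Rational solutions of the second Painleve equation\<close>

lemma poly_eq_off_zeros:
  fixes D P Q :: "complex poly"
  assumes "D \<noteq> 0" "\<And>y. poly D y \<noteq> 0 \<Longrightarrow> poly P y = poly Q y"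
  shows "P = Q"
proof -
  have "poly ((P - Q) * D) y = 0" for y using assms(2)[of y] by (cases "poly D y = 0") auto
  hence "(P - Q) * D = 0" using poly_all_0_iff_0 by blast
  thus ?thesis using assms(1) by simp
qed

definition deriv_numerator :: "complex poly \<Rightarrow> complex poly \<Rightarrow> complex poly" where
  "deriv_numerator N D = pderiv N * D - N * pderiv D"

definition deriv2_numerator :: "complex poly \<Rightarrow> complex poly \<Rightarrow> complex poly" where
  "deriv2_numerator N D = pderiv (deriv_numerator N D) * D - 2 * deriv_numerator N D * pderiv D"

lemma open_poly_nonzero: "open {y. poly D y \<noteq> (0 :: complex)}"
proof (cases "D = 0")
  case False
  have "{y. poly D y \<noteq> 0} = UNIV - {y. poly D y = 0}" by auto
  thus ?thesis using poly_roots_finite[OF False] by (simp add: finite_imp_closed open_Diff)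
qed simp

lemma deriv2_rational:
  assumes p: "\<And>y. poly D y \<noteq> 0 \<Longrightarrow> p y = poly N y / poly D y" and y: "poly D y \<noteq> 0"
  shows "deriv (deriv p) y = poly (deriv2_numerator N D) y / poly D y ^ 3"
proof -
  note op = open_poly_nonzero[of D]
  have 1: "deriv p u = poly (deriv_numerator N D) u / poly D u ^ 2" if "poly D u \<noteq> 0" for u
  proof -
    have "((\<lambda>u. poly N u / poly D u) has_field_derivative
        poly (deriv_numerator N D) u / poly D u ^ 2) (at u)"
      using that by (auto intro!: derivative_eq_intros simp: deriv_numerator_def power2_eq_square)
    hence "(p has_field_derivative poly (deriv_numerator N D) u / poly D u ^ 2) (at u)"
      by (rule has_field_derivative_transform_within_open[OF _ op]) (use that p in auto)
    thus ?thesis by (rule DERIV_imp_deriv)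
  qed
  have "((\<lambda>u. poly (deriv_numerator N D) u / poly D u ^ 2) has_field_derivative
      (poly (pderiv (deriv_numerator N D)) y * poly D y ^ 2 -
        poly (deriv_numerator N D) y * (2 * poly (pderiv D) y * poly D y)) /
      (poly D y ^ 2 * poly D y ^ 2)) (at y)"
    using y by (auto intro!: derivative_eq_intros)
  also have "(poly (pderiv (deriv_numerator N D)) y * poly D y ^ 2 -
        poly (deriv_numerator N D) y * (2 * poly (pderiv D) y * poly D y)) /
      (poly D y ^ 2 * poly D y ^ 2) = poly (deriv2_numerator N D) y / poly D y ^ 3"
    using y by (simp add: deriv2_numerator_def divide_simps power2_eq_square power3_eq_cube)
      (simp add: algebra_simps)
  finally have "(deriv p has_field_derivative poly (deriv2_numerator N D) y / poly D y ^ 3) (at y)"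
    by (rule has_field_derivative_transform_within_open[OF _ op]) (use y 1 in auto)
  thus ?thesis by (rule DERIV_imp_deriv)
qed

lemma degree_deriv2_numerator: "degree (deriv2_numerator N D) \<le> degree N + 2 * degree D"
proof -
  have d: "degree (pderiv p) \<le> degree p" for p :: "complex poly"
    using degree_pderiv[of p] by simp
  have m: "degree (p * q) \<le> a + b" if "degree p \<le> a" "degree q \<le> b" for p q :: "complex poly" and a b
    using degree_mult_le[of p q] that by linarith
  have W: "degree (deriv_numerator N D) \<le> degree N + degree D"
    unfolding deriv_numerator_def by (intro degree_diff_le m order_refl d)
  have "degree (pderiv (deriv_numerator N D) * D) \<le> (degree N + degree D) + degree D"
    by (intro m order_refl order_trans[OF d W])
  moreover have "degree (2 * deriv_numerator N D * pderiv D) \<le> (0 + (degree N + degree D)) + degree D"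
    by (intro m d W) simp
  ultimately show ?thesis
    unfolding deriv2_numerator_def by (intro degree_diff_le) simp_all
qed

lemma deriv2_numerator_diff:
  "deriv2_numerator (N1 * D2 - N2 * D1) (D1 * D2) =
     deriv2_numerator N1 D1 * D2 ^ 3 - deriv2_numerator N2 D2 * D1 ^ 3"
proof -
  define W1 W2 where "W1 = deriv_numerator N1 D1" and "W2 = deriv_numerator N2 D2"
  have W: "deriv_numerator (N1 * D2 - N2 * D1) (D1 * D2) = W1 * (D2 * D2) - W2 * (D1 * D1)"
    unfolding deriv_numerator_def W1_def W2_def by (simp add: pderiv_mult pderiv_diff algebra_simps)
  show ?thesis
    unfolding deriv2_numerator_def W W1_def[symmetric] W2_def[symmetric]
    by (simp add: pderiv_mult pderiv_diff algebra_simps power3_eq_cube)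
qed

text \<open>The Painleve equation for N/D multiplied by D^3: a polynomial identity, in which the
  values of the solution at the zeros of D do not occur.\<close>

definition PII_polys :: "int \<Rightarrow> complex poly \<Rightarrow> complex poly \<Rightarrow> bool" where
  "PII_polys m N D \<longleftrightarrow> D \<noteq> 0 \<and> deriv2_numerator N D =
     2 * N ^ 3 + [:0, 2/3:] * (N * D ^ 2) - [:2/3 * of_int m:] * D ^ 3"

lemma rational_PII_imp_polys:
  assumes "D \<noteq> 0" and
    "\<And>y. poly D y \<noteq> 0 \<Longrightarrow> p y = poly N y / poly D y \<and>
        deriv (deriv p) y = 2 * p y ^ 3 + 2/3 * y * p y - 2/3 * of_int m"
  shows "PII_polys m N D"
  unfolding PII_polys_def
proof (intro conjI assms(1) poly_eq_off_zeros[of D])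
  fix y assume y: "poly D y \<noteq> 0"
  have "poly (deriv2_numerator N D) y / poly D y ^ 3 =
      2 * (poly N y / poly D y) ^ 3 + 2/3 * y * (poly N y / poly D y) - 2/3 * of_int m"
    using assms(2)[OF y] deriv2_rational[of D p N y] assms(2) y by simp
  moreover have "poly (deriv2_numerator N D) y = poly (deriv2_numerator N D) y / poly D y ^ 3 * poly D y ^ 3"
    using y by simp
  ultimately have "poly (deriv2_numerator N D) y = (2 * (poly N y / poly D y) ^ 3 +
      2/3 * y * (poly N y / poly D y) - 2/3 * of_int m) * poly D y ^ 3"
    by simp
  also have "\<dots> = poly (2 * N ^ 3 + [:0, 2/3:] * (N * D ^ 2) - [:2/3 * of_int m:] * D ^ 3) y"
    using y by (simp add: field_simps power2_eq_square power3_eq_cube)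
  finally show "poly (deriv2_numerator N D) y = \<dots>" .
qed

lemma degree_X_mult: "p \<noteq> 0 \<Longrightarrow> degree ([:0, 2/3:] * p :: complex poly) = Suc (degree p)"
  by (subst degree_mult_eq) auto

text \<open>Growth at infinity. If p = N/D did not decay, then y p (for a finite nonzero limit) or
  p^3 (for growing p) would outweigh all remaining terms.\<close>

lemma PII_degree:
  assumes "PII_polys m N D" "N \<noteq> 0"
  shows "degree N < degree D"
proof (rule ccontr)
  assume "\<not> degree N < degree D"
  hence ge: "degree D \<le> degree N" by simp
  define A where "A = deriv2_numerator N D"
  define B where "B = 2 * N ^ 3"
  define C where "C = [:0, 2/3:] * (N * D ^ 2)"
  define E where "E = [:2/3 * of_int m:] * D ^ 3"
  have eq: "A = B + C - E" and D: "D \<noteq> 0"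
    using assms(1) by (simp_all only: PII_polys_def A_def B_def C_def E_def simp_thms)
  have dA: "degree A \<le> degree N + 2 * degree D" unfolding A_def by (rule degree_deriv2_numerator)
  have dB: "degree B = 3 * degree N" using assms(2) by (simp add: B_def degree_mult_eq degree_power_eq)
  have dC: "degree C = Suc (degree N + 2 * degree D)"
    unfolding C_def using assms(2) D by (subst degree_X_mult) (auto simp: degree_mult_eq degree_power_eq)
  have dE: "degree E \<le> 3 * degree D"
    using D by (simp add: E_def degree_power_eq)
  show False
  proof (cases "degree N = degree D")
    case True
    have "C = A - B + E" using eq by (simp add: algebra_simps)
    moreover have "degree (A - B + E) \<le> 3 * degree N"
      using dA dB dE True by (intro degree_add_le degree_diff_le) simp_all
    ultimately show False using dC True by simp
  next
    case False
    have "B = A - C + E" using eq by (simp add: algebra_simps)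
    moreover have "degree (A - C + E) < 3 * degree N"
      using dA dC dE False ge by (intro degree_add_less degree_diff_less) simp_all
    ultimately show False using dB by simp
  qed
qed

text \<open>The difference w of two solutions satisfies w'' = 2 q w + 2/3 y w with q = p1^2 + p1 p2
  + p2^2, whose numerator is \<open>Q\<close>. Both solutions are bounded at infinity, so y w grows
  too fast to be balanced unless w = 0.\<close>

lemma PII_unique:
  assumes P1: "PII_polys m N1 D1" and P2: "PII_polys m N2 D2"
  shows "N1 * D2 = N2 * D1"
proof (rule ccontr)
  assume "N1 * D2 \<noteq> N2 * D1"
  define N where "N = N1 * D2 - N2 * D1"
  define D where "D = D1 * D2"
  define Q where "Q = N1 * N1 * (D2 * D2) + N1 * N2 * (D1 * D2) + N2 * N2 * (D1 * D1)"
  have N: "N \<noteq> 0" using \<open>N1 * D2 \<noteq> N2 * D1\<close> by (simp add: N_def)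
  have D12: "D1 \<noteq> 0" "D2 \<noteq> 0" using P1 P2 by (simp_all add: PII_polys_def)
  have deg: "degree N1 \<le> degree D1" "degree N2 \<le> degree D2"
    using PII_degree[OF P1] PII_degree[OF P2] by (metis degree_0 le0 less_imp_le)+
  have eq: "deriv2_numerator N D = 2 * (N * Q) + [:0, 2/3:] * (N * D ^ 2)"
  proof -
    have ring: "(2 * N1 ^ 3 + X * (N1 * D1 ^ 2) - c * D1 ^ 3) * D2 ^ 3 -
        (2 * N2 ^ 3 + X * (N2 * D2 ^ 2) - c * D2 ^ 3) * D1 ^ 3 = 2 * (N * Q) + X * (N * D ^ 2)"
      for X c
      unfolding N_def D_def Q_def by (simp add: algebra_simps power3_eq_cube power2_eq_square)
    have e: "deriv2_numerator N1 D1 = 2 * N1 ^ 3 + [:0, 2/3:] * (N1 * D1 ^ 2) - [:2/3 * of_int m:] * D1 ^ 3"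
      "deriv2_numerator N2 D2 = 2 * N2 ^ 3 + [:0, 2/3:] * (N2 * D2 ^ 2) - [:2/3 * of_int m:] * D2 ^ 3"
      using P1 P2 unfolding PII_polys_def by blast+
    have "deriv2_numerator N D = deriv2_numerator N1 D1 * D2 ^ 3 - deriv2_numerator N2 D2 * D1 ^ 3"
      unfolding N_def D_def by (rule deriv2_numerator_diff)
    thus ?thesis unfolding e ring .
  qed
  have m: "degree (p * q) \<le> a + b" if "degree p \<le> a" "degree q \<le> b" for p q :: "complex poly" and a b
    using degree_mult_le[of p q] that by linarith
  have "degree Q \<le> (degree D1 + degree D2) + (degree D1 + degree D2)"
  proof -
    have "degree (N1 * N1 * (D2 * D2)) \<le> (degree D1 + degree D1) + (degree D2 + degree D2)"
      "degree (N1 * N2 * (D1 * D2)) \<le> (degree D1 + degree D2) + (degree D1 + degree D2)"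
      "degree (N2 * N2 * (D1 * D1)) \<le> (degree D2 + degree D2) + (degree D1 + degree D1)"
      by (intro m deg order_refl)+
    thus ?thesis unfolding Q_def by (intro degree_add_le) simp_all
  qed
  moreover have dD: "degree D = degree D1 + degree D2"
    using D12 by (simp add: D_def degree_mult_eq)
  ultimately have "degree (N * Q) \<le> degree N + 2 * degree D"
    by (intro m) simp_all
  hence "degree (2 * (N * Q)) \<le> degree N + 2 * degree D"
    using m[of 2 0 "N * Q" "degree N + 2 * degree D"] by simp
  hence "degree (deriv2_numerator N D - 2 * (N * Q)) \<le> degree N + 2 * degree D"
    by (intro degree_diff_le degree_deriv2_numerator)
  moreover have "deriv2_numerator N D - 2 * (N * Q) = [:0, 2/3:] * (N * D ^ 2)"
    unfolding eq by simp
  moreover have "D \<noteq> 0" using D12 by (simp add: D_def)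
  hence "degree ([:0, 2/3:] * (N * D ^ 2)) = Suc (degree N + 2 * degree D)"
    using N by (subst degree_X_mult) (auto simp: degree_mult_eq degree_power_eq)
  ultimately show False by simp
qed

text \<open>\<open>is_pole\<close> sees only a punctured neighbourhood, so zeros of D may be
  cancelled by zeros of N. If the order of y0 in D exceeds that in N, the quotient tends to
  infinity.\<close>

lemma rational_regular_at:
  assumes D: "D \<noteq> 0" and p: "\<And>y. poly D y \<noteq> 0 \<Longrightarrow> p y = poly N y / poly D y"
    and np: "\<not> is_pole p y0"
  obtains N' D' :: "complex poly" where "poly D' y0 \<noteq> 0" "N * D' = N' * D"
proof (cases "N = 0")
  case True
  thus ?thesis by (intro that[of 1 0]) auto
next
  case False
  define q where "q = [:- y0, 1:]"
  obtain N1 where N1: "N = q ^ order y0 N * N1" "\<not> q dvd N1"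
    using order_decomp[OF False, of y0] unfolding q_def by blast
  obtain D1 where D1: "D = q ^ order y0 D * D1" "\<not> q dvd D1"
    using order_decomp[OF D, of y0] unfolding q_def by blast
  have nz: "poly N1 y0 \<noteq> 0" "poly D1 y0 \<noteq> 0"
    using N1(2) D1(2) by (auto simp: q_def poly_eq_0_iff_dvd)
  show ?thesis
  proof (cases "order y0 D \<le> order y0 N")
    case True
    have "N * D1 = (q ^ (order y0 N - order y0 D) * N1) * D"
      by (subst N1(1), subst (2) D1(1)) (use True in \<open>simp add: mult_ac flip: power_add\<close>)
    thus ?thesis by (rule that[OF nz(2)])
  next
    case False
    define e where "e = order y0 D - order y0 N"
    have "filterlim (\<lambda>y. (poly N1 y / poly D1 y) / (y - y0) ^ e) at_infinity (at y0)"
    proof (rule filterlim_divide_at_infinity)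
      show "((\<lambda>y. poly N1 y / poly D1 y) \<longlongrightarrow> poly N1 y0 / poly D1 y0) (at y0)"
        using nz by (intro tendsto_intros) auto
      have "((\<lambda>y. (y - y0) ^ e) \<longlongrightarrow> (y0 - y0) ^ e) (at y0)" by (intro tendsto_intros)
      thus "filterlim (\<lambda>y. (y - y0) ^ e) (at 0) (at y0)"
        using False by (auto simp: filterlim_at e_def eventually_at_filter power_0_left split: if_splits)
    qed (use nz in auto)
    moreover have "eventually (\<lambda>y. (poly N1 y / poly D1 y) / (y - y0) ^ e = p y) (at y0)"
    proof -
      have "finite ({y. poly D y = 0} - {y0})" using D poly_roots_finite by blast
      hence "eventually (\<lambda>y. y \<in> - ({y. poly D y = 0} - {y0})) (nhds y0)"
        by (intro eventually_nhds_in_open open_Compl finite_imp_closed) auto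
      hence "eventually (\<lambda>y. poly D y \<noteq> 0) (at y0)"
        unfolding eventually_at_filter by eventually_elim auto
      moreover have "eventually (\<lambda>y. y \<noteq> y0) (at y0)" by (simp add: eventually_at_filter)
      ultimately show ?thesis
      proof eventually_elim
        case (elim y)
        have "order y0 D = e + order y0 N" using False by (simp add: e_def)
        hence "poly D y = (y - y0) ^ e * (y - y0) ^ order y0 N * poly D1 y"
          by (subst D1(1)) (simp add: q_def power_add)
        moreover have "poly N y = (y - y0) ^ order y0 N * poly N1 y"
          by (subst N1(1)) (simp add: q_def)
        ultimately show ?case using elim p[of y] by (simp add: field_simps)
      qed
    qed
    ultimately have "filterlim p at_infinity (at y0)"
      by (rule filterlim_mono_eventually[OF _ order_refl order_refl])
    thus ?thesis using np by (simp add: is_pole_def)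
  qed
qed

section \<open>Pade approximants at regular points\<close>

context Pade_family
begin

lemma \<kappa>_PII_polys: "PII_polys (int m) N\<kappa> (R m)"
  using \<kappa>_PII \<kappa>_rational Rm by (intro rational_PII_imp_polys[of _ \<kappa>]) (auto simp: S_def)

text \<open>If all \<open>R k\<close> vanish at \<open>y0\<close> to order \<open>i\<close> less than the order \<open>e\<close> of the common denominator
  \<open>R m\<close>, then comparing the leading singular terms of the linear differential equation for
  \<open>R k / R m\<close> gives \<open>(i - e) * G y0 = 0\<close> where \<open>R k = (y - y0) ^ i * G\<close>.\<close>

lemma order_propagates:
  assumes Dn: "poly Dn y0 \<noteq> 0" and N: "N\<kappa> * Dn = N * R m" and i: "i \<le> order y0 (R m)" and k: "k \<le> m"
  shows "[:- y0, 1:] ^ i dvd R k"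
  using i k
proof (induction i arbitrary: k)
  case (Suc i)
  define q where "q = [:- y0, 1:]"
  define e where "e = order y0 (R m)"
  have IH: "q ^ i dvd R j" if "j \<le> m" for j
    using Suc that by (simp add: q_def)
  \<comment> \<open>\<open>T k\<close> combines the \<open>R j\<close> with j \<le> k, which is why
    the induction treats all indices up to m together.\<close>
  have "q ^ i dvd T k"
    unfolding T_def using Suc.prems IH by (auto intro!: dvd_smult dvd_sum dvd_mult2)
  then obtain T1 where T1: "T k = q ^ i * T1" by (elim dvdE)
  obtain G where G: "R k = q ^ i * G" using IH[OF Suc.prems(2)] by (elim dvdE)
  obtain D1 where D1: "R m = q ^ e * D1" "\<not> q dvd D1"
    using order_decomp[OF Rm, of y0] unfolding q_def e_def by blast
  have D1y: "poly D1 y0 \<noteq> 0" using D1(2) by (simp add: q_def poly_eq_0_iff_dvd)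
  have q: "q \<noteq> 0" "poly q y0 = 0" "pderiv q = 1"
    by (simp_all add: q_def pderiv_pCons)
  have dq: "q * pderiv (q ^ n) = of_nat n * q ^ n" for n
  proof (cases n)
    case (Suc j)
    thus ?thesis by (simp only: pderiv_power_Suc q(3)) (simp add: of_nat_poly)
  qed simp
  have id: "(pderiv (R k) * R m - R k * pderiv (R m)) * Dn = N * R m * T k"
  proof (rule poly_eq_off_zeros[OF Rm])
    fix y assume y: "poly (R m) y \<noteq> 0"
    have "poly N\<kappa> y * poly Dn y = poly N y * poly (R m) y"
      using arg_cong[OF N, of "\<lambda>p. poly p y"] by simp
    moreover have "poly (pderiv (R k) * R m - R k * pderiv (R m)) y = \<kappa> y * poly (R m) y * poly (T k) y"
      using y Suc.prems by (intro R_ode) (auto simp: S_def)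
    ultimately show "poly ((pderiv (R k) * R m - R k * pderiv (R m)) * Dn) y = poly (N * R m * T k) y"
      using y by (simp add: \<kappa>_rational mult_ac)
  qed
  \<comment> \<open>What is left of the left-hand side of the equation, multiplied by q, after q^(i
    + e) is taken out; at y0 it equals (i - e) times the values of G and D1.\<close>
  define H where "H = (of_nat i * G + q * pderiv G) * D1 - G * (of_nat e * D1 + q * pderiv D1)"
  have qR: "q * pderiv (R k) = q ^ i * (of_nat i * G + q * pderiv G)"
    using dq[of i] by (simp add: G pderiv_mult algebra_simps)
  have qD: "q * pderiv (R m) = q ^ e * (of_nat e * D1 + q * pderiv D1)"
    using dq[of e] by (simp add: D1(1) pderiv_mult algebra_simps)
  have "q * ((pderiv (R k) * R m - R k * pderiv (R m)) * Dn) =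
      ((q * pderiv (R k)) * R m - R k * (q * pderiv (R m))) * Dn"
    by (simp add: algebra_simps)
  also have "\<dots> = (q ^ i * q ^ e) * (H * Dn)"
    unfolding qR qD unfolding G D1(1) H_def by (simp add: algebra_simps)
  finally have "(q ^ i * q ^ e) * (H * Dn) = (q ^ i * q ^ e) * (q * (N * D1 * T1))"
    unfolding id unfolding T1 D1(1) by (simp only: mult_ac)
  moreover have "q ^ i * q ^ e \<noteq> 0" using q by simp
  ultimately have "H * Dn = q * (N * D1 * T1)" by (simp only: mult_cancel_left simp_thms)
  hence "poly H y0 * poly Dn y0 = 0" by (metis mult_zero_left poly_mult q(2))
  hence "poly H y0 = 0" using Dn by simp
  hence "(of_nat i - of_nat e) * (poly G y0 * poly D1 y0) = 0"
    by (simp add: H_def q(2) of_nat_poly algebra_simps)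
  moreover have "i \<noteq> e" using Suc.prems by (simp add: e_def)
  ultimately have "poly G y0 = 0" using D1y by simp
  hence "q dvd G" by (simp add: q_def poly_eq_0_iff_dvd)
  thus ?case unfolding q_def[symmetric] G power_Suc by (simp add: mult.commute mult_dvd_mono)
qed simp

text \<open>Every \<open>R k\<close> contains the full power of y - y0 found in \<open>R m\<close>.
  Cancelling it gives a second family whose top polynomial is nonzero at y0.\<close>

lemma Pade_regular:
  assumes Dn: "poly Dn y0 \<noteq> 0" and N: "N\<kappa> * Dn = N * R m"
  shows "\<exists>b a. Pade m (F_fps y0) b a"
proof -
  define q where "q = [:- y0, 1:]"
  define e where "e = order y0 (R m)"
  have "\<forall>k\<in>{..m}. \<exists>G. R k = q ^ e * G"
    using order_propagates[OF Dn N, of e] by (auto simp: q_def e_def dvd_def)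
  then obtain G where G: "\<And>k. k \<le> m \<Longrightarrow> R k = q ^ e * G k" by (metis atMost_iff)
  have q: "q \<noteq> 0" by (simp add: q_def)
  interpret G: Pade_family m G
  proof
    show "G m \<noteq> 0" using G[of m] Rm by auto
    fix k assume k: "m \<le> k" "k < 2 * m"
    have "q ^ e * (\<Sum>j\<le>m. G j * exp_coeff_poly g_fps (k - j)) =
        (\<Sum>j\<le>m. R j * exp_coeff_poly g_fps (k - j))"
      unfolding sum_distrib_left by (intro sum.cong) (auto simp: G)
    thus "(\<Sum>j\<le>m. G j * exp_coeff_poly g_fps (k - j)) = 0" using R[OF k] q by simp
  qed
  have "\<not> q dvd G m"
  proof
    assume "q dvd G m"
    hence "q ^ Suc e dvd R m" using G[of m] by (simp add: mult.commute mult_dvd_mono)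
    thus False using order_2[OF Rm, of y0] by (simp add: q_def e_def)
  qed
  hence "y0 \<in> G.S" by (simp add: G.S_def q_def poly_eq_0_iff_dvd)
  from fps_Pade_imp_Pade[OF G.Pade_S[OF this]] show ?thesis by blast
qed

end

text \<open>Uniqueness of the rational solution identifies \<open>N\<kappa>\<close> over
  \<open>R m\<close> with p, so a representation of p with denominator nonzero at y0 also represents
  \<kappa>.\<close>

lemma Pade_exists:
  assumes "rational_PII_solution (int m) p" "\<not> is_pole p y0"
  obtains b a where "Pade m (F_fps y0) b a"
proof -
  obtain R where "R m \<noteq> 0"
    "\<And>k. m \<le> k \<Longrightarrow> k < 2 * m \<Longrightarrow> (\<Sum>j\<le>m. R j * exp_coeff_poly g_fps (k - j)) = 0"
    using Pade_polynomials_exist[OF g_fps_0] by blast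
  then interpret Pade_family m R by unfold_locales
  obtain N D :: "complex poly" where D: "D \<noteq> 0" and
    p: "\<And>y. poly D y \<noteq> 0 \<Longrightarrow> p y = poly N y / poly D y \<and>
         deriv (deriv p) y = 2 * p y ^ 3 + 2/3 * y * p y - 2/3 * of_int (int m)"
    using assms(1) unfolding rational_PII_solution_def by blast
  have "PII_polys (int m) N D" by (rule rational_PII_imp_polys[OF D p])
  hence eq: "N * R m = N\<kappa> * D" using \<kappa>_PII_polys by (rule PII_unique)
  obtain N' D' where D': "poly D' y0 \<noteq> 0" "N * D' = N' * D"
    using rational_regular_at[OF D _ assms(2), of N] p by blast
  have "(N\<kappa> * D') * D = (N' * R m) * D"
    using eq D'(2) by (metis mult.assoc mult.commute)
  hence "N\<kappa> * D' = N' * R m" using D by simp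
  from Pade_regular[OF D'(1) this] that show ?thesis by blast
qed

section \<open>The intermediate problem\<close>

definition RH_pieces ::
  "(complex \<Rightarrow> cmat2) \<Rightarrow> (complex \<Rightarrow> cmat2) \<Rightarrow> (complex \<Rightarrow> cmat2) \<Rightarrow> (complex \<Rightarrow> cmat2) \<Rightarrow> bool" where
  "RH_pieces J N X E \<longleftrightarrow> RH_entire J N E \<and> (\<forall>w. norm w < 1 \<longrightarrow> X w = E w) \<and>
     (\<forall>w. norm w > 1 \<longrightarrow> X w = E w ** adj2 (J w))"

section \<open>Filling in values at the origin and on circles\<close>

lemma fill_in_limit:
  assumes "x \<in> S" "(f \<longlongrightarrow> L) (at x within - S)" "at x within - S \<noteq> bot"
  shows "fill_in S f x = L"
  using assms by (simp add: fill_in_def tendsto_Lim)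

lemma at_within_minus_0: "at (0::complex) within - {0} \<noteq> bot"
  using islimpt_punctured[of "0 :: complex" UNIV]
  by (simp add: trivial_limit_within Compl_eq_Diff_UNIV islimpt_UNIV)

lemma at_within_minus_sphere:
  assumes "norm (x::complex) = r" "r > 0"
  shows "at x within - sphere 0 r \<noteq> bot"
proof -
  have "x islimpt ball 0 r" using assms by (simp add: islimpt_ball)
  hence "x islimpt - sphere 0 r" by (rule islimpt_subset) auto
  thus ?thesis by (simp add: trivial_limit_within)
qed

lemma fill_in_0:
  assumes E: "E mat_holomorphic_on UNIV" and r: "r > 0"
    and f: "\<And>x. x \<noteq> 0 \<Longrightarrow> norm x < r \<Longrightarrow> f x = E x"
  shows "fill_in {0} f 0 = E 0"
proof (rule fill_in_limit[OF _ _ at_within_minus_0])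
  have "(E \<longlongrightarrow> E 0) (at 0 within - {0})" by (rule mat_holomorphic_on_tendsto[OF E]) auto
  moreover have "eventually (\<lambda>x. x \<in> ball 0 r) (nhds (0::complex))"
    using r by (intro eventually_nhds_in_open) auto
  hence "eventually (\<lambda>x. E x = f x) (at 0 within - {0})"
    unfolding eventually_at_filter by eventually_elim (auto simp: f)
  ultimately show "(f \<longlongrightarrow> E 0) (at 0 within - {0})" by (rule Lim_transform_eventually)
qed simp

lemma fill_in_sphere:
  assumes E: "E mat_holomorphic_on S" "open S" "x \<in> S" and x: "norm x = r" "r > 0"
    and f: "\<And>w. norm w \<noteq> r \<Longrightarrow> w \<in> S \<Longrightarrow> f w = E w"
  shows "fill_in (sphere 0 r) f x = E x"
proof (rule fill_in_limit[OF _ _ at_within_minus_sphere[OF x]])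
  have "(E \<longlongrightarrow> E x) (at x within - sphere 0 r)" by (rule mat_holomorphic_on_tendsto[OF E])
  moreover have "eventually (\<lambda>w. w \<in> S) (nhds x)"
    using E by (intro eventually_nhds_in_open) auto
  hence "eventually (\<lambda>w. E w = f w) (at x within - sphere 0 r)"
    unfolding eventually_at_filter by eventually_elim (auto simp: f)
  ultimately show "(f \<longlongrightarrow> E x) (at x within - sphere 0 r)" by (rule Lim_transform_eventually)
qed (use x in simp)

lemma mat_holomorphic_on_removable:
  assumes "X mat_holomorphic_on - {0}" "(X \<longlongrightarrow> X 0) (at 0)"
  shows "X mat_holomorphic_on UNIV"
  unfolding mat_holomorphic_on_def
proof (intro allI)
  fix i j
  let ?f = "\<lambda>w. X w $ i $ j"
  have hol: "?f holomorphic_on - {0}"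
    using assms(1) by (simp add: mat_holomorphic_on_def)
  have op: "open (- {0 :: complex})" by (intro open_Compl closed_singleton)
  have "isCont ?f w" for w
  proof (cases "w = 0")
    case True
    show ?thesis unfolding isCont_def True by (intro tendsto_vec_nth assms(2))
  next
    case False
    have "continuous_on (- {0}) ?f" by (rule holomorphic_on_imp_continuous_on[OF hol])
    thus ?thesis using False op continuous_on_eq_continuous_at by blast
  qed
  hence cont: "continuous_on UNIV ?f" by (intro continuous_at_imp_continuous_on) blast
  show "?f holomorphic_on UNIV"
  proof (rule no_isolated_singularity[OF cont])
    show "?f holomorphic_on UNIV - {0}" using hol by (simp only: Compl_eq_Diff_UNIV)
  qed simp_all
qed

lemma det_C_jump [simp]: "det (C_jump j z x) = 1"
  by (simp add: C_jump_def)

lemma mat_holomorphic_on_C_jump: "C_jump j z mat_holomorphic_on - {0}"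
  unfolding C_jump_def nu'_def by (intro mat_holomorphic_on_mat2) (auto intro!: holomorphic_intros)

lemma mat_holomorphic_on_sigma3_pow: "(\<lambda>x. sigma3_pow x n) mat_holomorphic_on - {0}"
  unfolding sigma3_pow_def by (intro mat_holomorphic_on_mat2) (auto intro!: holomorphic_intros)

lemma problem_C_0_eq_BB: "problem_C m 0 z = problem_BB m z"
  by (rule ext) (simp add: problem_C_def problem_BB_def C_jump_def[abs_def])

lemma problem_C_pieces:
  assumes "problem_C m j z X"
  obtains E where "RH_pieces (C_jump j z) (\<lambda>x. sigma3_pow x (- m)) X E"
proof (rule RH_solution_imp_RH_entire[OF mat_holomorphic_on_C_jump _ assms[unfolded problem_C_def]])
  fix E :: "complex \<Rightarrow> cmat2"
  assume "RH_entire (C_jump j z) (\<lambda>x. sigma3_pow x (- m)) E" "\<And>w. norm w < 1 \<Longrightarrow> X w = E w"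
    "\<And>w. norm w > 1 \<Longrightarrow> X w = E w ** adj2 (C_jump j z w)"
  thus thesis by (intro that[of E]) (simp add: RH_pieces_def)
qed simp

lemma pieces_problem_C:
  assumes "RH_pieces (C_jump j z) (\<lambda>x. sigma3_pow x (- m)) X E"
  shows "problem_C m j z X"
  unfolding problem_C_def using assms
  by (intro RH_entire_imp_RH_solution[of _ _ E] mat_holomorphic_on_C_jump)
     (auto simp: RH_pieces_def)

lemma RH_entire_C_unique:
  assumes "RH_entire (C_jump j z) (\<lambda>x. sigma3_pow x (- m)) E" "RH_entire (C_jump j z) (\<lambda>x. sigma3_pow x (- m)) E'"
  shows "E' = E"
  by (rule RH_entire_unique[OF _ _ assms]) auto

lemma RH_entire_C_det:
  assumes "RH_entire (C_jump j z) (\<lambda>x. sigma3_pow x (- m)) E"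
  shows "det (E w) = 1"
  by (rule RH_entire_det[OF _ _ assms]) auto

lemma pieces_agree:
  assumes "RH_pieces J N X E" "RH_pieces J N X' E"
  shows "agree_off_circle 1 X X'"
  unfolding agree_off_circle_def
proof (intro allI impI)
  fix w :: complex assume "norm w \<noteq> 1"
  then consider "norm w < 1" | "norm w > 1" by linarith
  thus "X w = X' w" using assms by cases (simp_all add: RH_pieces_def)
qed

text \<open>An error O(1/x^2) is o(1/x), so the coefficient is a limit; uniqueness of limits then
  makes \<open>residue_coeff\<close> well defined.\<close>

lemma is_residue_coeff_tendsto:
  assumes "is_residue_coeff m C R"
  shows "((\<lambda>x. x * (C x ** sigma3_pow x (- m) - mat 1) $ i $ j) \<longlongrightarrow> R $ i $ j) at_infinity"
proof -
  let ?f = "\<lambda>x. (C x ** sigma3_pow x (- m) - mat 1) $ i $ j"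
  have "(\<lambda>x. ?f x - R $ i $ j / x) \<in> O[at_infinity](\<lambda>x. 1 / x ^ 2)"
    using assms by (simp add: is_residue_coeff_def)
  also have "(\<lambda>x::complex. 1 / x ^ 2) \<in> o[at_infinity](\<lambda>x. 1 / x)"
  proof (rule smalloI_tendsto)
    have "((\<lambda>x::complex. inverse x) \<longlongrightarrow> 0) at_infinity" by (rule tendsto_inverse_0)
    thus "((\<lambda>x::complex. 1 / x ^ 2 / (1 / x)) \<longlongrightarrow> 0) at_infinity"
      by (rule Lim_transform_eventually)
         (rule eventually_mono[OF eventually_not_equal_at_infinity[of 0]],
          simp add: field_simps power2_eq_square)
  qed (rule eventually_mono[OF eventually_not_equal_at_infinity[of 0]], simp)
  finally have "((\<lambda>x. (?f x - R $ i $ j / x) / (1 / x)) \<longlongrightarrow> 0) at_infinity"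
    by (rule smalloD_tendsto)
  hence "((\<lambda>x. (?f x - R $ i $ j / x) / (1 / x) + R $ i $ j) \<longlongrightarrow> 0 + R $ i $ j) at_infinity"
    by (intro tendsto_add tendsto_const)
  hence "((\<lambda>x. (?f x - R $ i $ j / x) / (1 / x) + R $ i $ j) \<longlongrightarrow> R $ i $ j) at_infinity"
    by simp
  thus ?thesis
    by (rule Lim_transform_eventually)
       (rule eventually_mono[OF eventually_not_equal_at_infinity[of 0]], simp add: field_simps)
qed

lemma residue_coeff_eq:
  assumes "is_residue_coeff m C R"
  shows "residue_coeff m C = R"
  unfolding residue_coeff_def
proof (rule the_equality[of _ R])
  fix R' assume "is_residue_coeff m C R'"
  hence "R' $ i $ j = R $ i $ j" for i j
    using is_residue_coeff_tendsto assms
    by (intro tendsto_unique[OF trivial_limit_at_infinity is_residue_coeff_tendsto is_residue_coeff_tendsto])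
  thus "R' = R" by (simp add: vec_eq_iff)
qed fact

text \<open>In the variable \<open>t = 1 / x\<close> the normalized solution is holomorphic at \<open>0\<close>, so its Taylor
  expansion supplies the coefficient.\<close>

lemma is_residue_coeff_exists:
  assumes "RH_pieces (C_jump j z) (\<lambda>x. sigma3_pow x (- m)) X E"
  obtains R where "is_residue_coeff m X R"
proof -
  define G where "G = (\<lambda>x. E x ** adj2 (C_jump j z x) ** sigma3_pow x (- m))"
  have E: "E mat_holomorphic_on UNIV" and G: "(G \<longlongrightarrow> mat 1) at_infinity"
    and X: "\<And>w. norm w > 1 \<Longrightarrow> X w = E w ** adj2 (C_jump j z w)"
    using assms by (auto simp: RH_pieces_def RH_entire_def G_def)
  have Ghol: "G mat_holomorphic_on - {0}"
    unfolding G_def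
    by (intro mat_holomorphic_on_mult mat_holomorphic_on_adj2 mat_holomorphic_on_C_jump
        mat_holomorphic_on_sigma3_pow mat_holomorphic_on_subset[OF E]) auto
  define g where "g = (\<lambda>t. if t = 0 then mat 1 else G (inverse t))"
  have ghol: "g mat_holomorphic_on UNIV"
  proof (rule mat_holomorphic_on_removable)
    have "(\<lambda>t. G (inverse t)) mat_holomorphic_on - {0}"
      by (rule mat_holomorphic_on_compose[OF Ghol]) (auto intro!: holomorphic_intros)
    thus "g mat_holomorphic_on - {0}"
      by (subst mat_holomorphic_on_cong[where Y = "\<lambda>t. G (inverse t)"]) (auto simp: g_def)
    have "filterlim inverse at_infinity (at (0::complex))" by (rule filterlim_inverse_at_infinity)
    hence "((\<lambda>t. G (inverse t)) \<longlongrightarrow> mat 1) (at 0)" by (rule filterlim_compose[OF G])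
    hence "(g \<longlongrightarrow> mat 1) (at 0)"
      by (rule Lim_transform_eventually) (auto simp: eventually_at_filter g_def)
    thus "(g \<longlongrightarrow> g 0) (at 0)" by (simp add: g_def)
  qed
  have "\<exists>c. (\<lambda>x. (X x ** sigma3_pow x (- m) - mat 1) $ i $ k - c / x) \<in> O[at_infinity](\<lambda>x. 1 / x ^ 2)" for i k
  proof -
    define F where "F = fps_expansion (\<lambda>t. g t $ i $ k) 0"
    have h: "(\<lambda>t. g t $ i $ k) holomorphic_on UNIV" using ghol by (simp add: mat_holomorphic_on_def)
    have F: "(\<lambda>t. g t $ i $ k) has_fps_expansion F"
      unfolding F_def by (rule has_fps_expansion_fps_expansion[OF _ _ h]) auto
    define c where "c = fps_nth F 1"
    have F0: "fps_nth F 0 = (mat 1 :: cmat2) $ i $ k"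
      using has_fps_expansion_imp_0_eq_fps_nth_0[OF F] by (simp add: g_def)
    \<comment> \<open>Subtracting the first two Taylor terms leaves t^2 times an entire function,
      which is the bound O(1/x^2) for x = 1/t.\<close>
    define v where "v = (\<lambda>t. g t $ i $ k - (mat 1 :: cmat2) $ i $ k - c * t)"
    have "v has_fps_expansion F - fps_const ((mat 1 :: cmat2) $ i $ k) - fps_const c * fps_X"
      unfolding v_def by (intro has_fps_expansion_diff has_fps_expansion_mult F
          has_fps_expansion_const has_fps_expansion_fps_X)
    moreover have "v holomorphic_on UNIV" unfolding v_def by (intro holomorphic_intros h)
    moreover have "fps_nth (F - fps_const ((mat 1 :: cmat2) $ i $ k) - fps_const c * fps_X) n = 0" if "n < 2" for n
      using that by (auto simp: less_2_cases_iff F0 c_def)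
    ultimately obtain u where u: "u holomorphic_on UNIV" "\<And>t. v t = t ^ 2 * u t"
      using holomorphic_factor_power[of v _ 2] by blast
    have "isCont u 0"
      using holomorphic_on_imp_continuous_on[OF u(1)] by (simp add: continuous_on_eq_continuous_at)
    hence "((\<lambda>x. u (inverse x)) \<longlongrightarrow> u 0) at_infinity"
      using tendsto_inverse_0 by (rule isCont_tendsto_compose)
    moreover have "eventually (\<lambda>x. u (inverse x) =
        ((X x ** sigma3_pow x (- m) - mat 1) $ i $ k - c / x) / (1 / x ^ 2)) at_infinity"
      unfolding eventually_at_infinity
    proof (intro exI[of _ 2] allI impI)
      fix x :: complex assume x: "2 \<le> norm x"
      hence x': "x \<noteq> 0" "norm x > 1" by auto
      have "(X x ** sigma3_pow x (- m) - mat 1) $ i $ k - c / x = v (inverse x)"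
        using x' by (simp add: v_def g_def G_def X divide_inverse)
      also have "\<dots> = inverse x ^ 2 * u (inverse x)" by (rule u(2))
      finally show "u (inverse x) = ((X x ** sigma3_pow x (- m) - mat 1) $ i $ k - c / x) / (1 / x ^ 2)"
        using x' by (simp add: field_simps)
    qed
    ultimately have "((\<lambda>x. ((X x ** sigma3_pow x (- m) - mat 1) $ i $ k - c / x) / (1 / x ^ 2)) \<longlongrightarrow> u 0) at_infinity"
      by (rule Lim_transform_eventually)
    hence "(\<lambda>x. (X x ** sigma3_pow x (- m) - mat 1) $ i $ k - c / x) \<in> O[at_infinity](\<lambda>x. 1 / x ^ 2)"
      by (rule bigoI_tendsto) (rule eventually_mono[OF eventually_not_equal_at_infinity[of 0]], simp)
    thus ?thesis ..
  qed
  moreover define P where "P = (\<lambda>i k c. (\<lambda>x. (X x ** sigma3_pow x (- m) - mat 1) $ i $ k - c / x)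
      \<in> O[at_infinity](\<lambda>x. 1 / x ^ 2))"
  ultimately have "\<And>i k. \<exists>c. P i k c" by simp
  then obtain c where "\<And>i k. P i k (c i k)" by metis
  hence "is_residue_coeff m X (\<chi> i k. c i k)" by (simp add: is_residue_coeff_def P_def)
  thus ?thesis by (rule that)
qed

text \<open>The limits that check the normalization after a change of \<open>j\<close>: off the
  diagonal, the factor x brought in by that change exposes an entry of \<open>R\<close>.\<close>

lemma normalized_limits:
  fixes X E G :: "complex \<Rightarrow> cmat2" and R :: cmat2
  assumes X: "RH_pieces (C_jump j z) (\<lambda>x. sigma3_pow x (- m)) X E" and R: "is_residue_coeff m X R"
  defines "G \<equiv> \<lambda>x. E x ** adj2 (C_jump j z x) ** sigma3_pow x (- m)"
  shows "((\<lambda>x. G x $ i $ k) \<longlongrightarrow> (mat 1 :: cmat2) $ i $ k) at_infinity"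
    "((\<lambda>x. x * (G x $ 1 $ 2)) \<longlongrightarrow> R $ 1 $ 2) at_infinity"
    "((\<lambda>x. x * (G x $ 2 $ 1)) \<longlongrightarrow> R $ 2 $ 1) at_infinity"
proof -
  show "((\<lambda>x. G x $ i $ k) \<longlongrightarrow> (mat 1 :: cmat2) $ i $ k) at_infinity"
    using X by (intro tendsto_vec_nth) (auto simp: RH_pieces_def RH_entire_def G_def)
  have ev: "eventually (\<lambda>x. x * (X x ** sigma3_pow x (- m) - mat 1) $ i $ k = x * (G x $ i $ k)) at_infinity"
    if "(mat 1 :: cmat2) $ i $ k = 0" for i k
    unfolding eventually_at_infinity
    using X that by (intro exI[of _ 2]) (auto simp: RH_pieces_def G_def)
  show "((\<lambda>x. x * (G x $ 1 $ 2)) \<longlongrightarrow> R $ 1 $ 2) at_infinity"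
    "((\<lambda>x. x * (G x $ 2 $ 1)) \<longlongrightarrow> R $ 2 $ 1) at_infinity"
    by (rule Lim_transform_eventually[OF is_residue_coeff_tendsto[OF R] ev]; simp add: mat_1_mat2)+
qed

lemma holomorphic_zero_factor:
  assumes "g holomorphic_on UNIV" "g 0 = (0::complex)"
  obtains h where "h holomorphic_on UNIV" "\<And>x. g x = x * h x"
proof -
  have F: "g has_fps_expansion fps_expansion g 0"
    by (rule has_fps_expansion_fps_expansion[OF _ _ assms(1)]) auto
  have "fps_nth (fps_expansion g 0) k = 0" if "k < 1" for k
    using that has_fps_expansion_imp_0_eq_fps_nth_0[OF F] assms(2) by simp
  then obtain h where "h holomorphic_on UNIV" "\<And>x. g x = x ^ 1 * h x"
    using holomorphic_factor_power[OF assms(1) F, of 1] by blast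
  thus ?thesis by (intro that[of h]) simp_all
qed

text \<open>A diagonal factor diag(1, 1/x) or diag(1/x, 1) scales the upper right jump entry by one
  power of x, hence shifts \<open>j\<close>.\<close>

lemma C_jump_Suc:
  assumes "x \<noteq> 0"
  shows "mat2 1 0 0 (inverse x) ** adj2 (C_jump j z x) = adj2 (C_jump (j + 1) z x) ** mat2 1 0 0 (inverse x)"
    "mat2 (inverse x) 0 0 1 ** adj2 (C_jump (j + 1) z x) = adj2 (C_jump j z x) ** mat2 (inverse x) 0 0 1"
  using assms by (simp_all add: C_jump_def power_int_add)

lemma sigma3_pow_diag_commute: "mat2 a 0 0 d ** sigma3_pow x n = sigma3_pow x n ** mat2 a 0 0 d"
  by (simp add: sigma3_pow_def mult.commute)

section \<open>Changing the index \<open>j\<close>\<close>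

lemma eventually_nonzero_at_infinity:
  "(\<And>x. x \<noteq> 0 \<Longrightarrow> P x) \<Longrightarrow> eventually P (at_infinity :: complex filter)"
  by (rule eventually_mono[OF eventually_not_equal_at_infinity[of 0]])

text \<open>The right factor diag(1, 1/x) changes the jump but can put a pole into the second column
  and disturbs the normalization. The constant \<open>q\<close> removes the pole, the coefficient
  \<open>r\<close> restores the limit. The second conclusion supplies the nonzero denominator for
  the way back.\<close>

lemma decrease_j_pieces:
  assumes C: "RH_pieces (C_jump (j + 1) z) (\<lambda>x. sigma3_pow x (- m)) C E" and nz: "E 0 $ 2 $ 2 \<noteq> 0"
  obtains E' where "RH_pieces (C_jump j z) (\<lambda>x. sigma3_pow x (- m)) (decrease_j m C) E'"
    "E' 0 $ 1 $ 1 * E 0 $ 2 $ 2 = 1"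
proof -
  obtain R where R: "is_residue_coeff m C R" using is_residue_coeff_exists[OF C] by blast
  define r where "r = R $ 2 $ 1"
  define q where "q = E 0 $ 1 $ 2 * inverse (E 0 $ 2 $ 2)"
  define L where "L = (\<lambda>x. mat2 1 (- q) (- r) (x + r * q))"
  have Cin: "\<And>x. norm x < 1 \<Longrightarrow> C x = E x"
    and Cout: "\<And>x. norm x > 1 \<Longrightarrow> C x = E x ** adj2 (C_jump (j + 1) z x)"
    and Eent: "RH_entire (C_jump (j + 1) z) (\<lambda>x. sigma3_pow x (- m)) E"
    using C by (auto simp: RH_pieces_def)
  have hol: "(\<lambda>x. E x $ a $ b) holomorphic_on UNIV" for a b
    using Eent by (simp add: RH_entire_def mat_holomorphic_on_def)
  have dec: "decrease_j m C = fill_in {0} (\<lambda>x. L x ** C x ** mat2 1 0 0 (inverse x))"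
    unfolding decrease_j_def residue_coeff_eq[OF R] L_def q_def r_def by (simp add: Let_def Cin)
  \<comment> \<open>\<open>q\<close> is the ratio that makes this combination vanish at the origin,
    so it can be divided by x.\<close>
  obtain h where h: "h holomorphic_on UNIV" "\<And>x. E x $ 1 $ 2 - q * E x $ 2 $ 2 = x * h x"
    by (rule holomorphic_zero_factor[of "\<lambda>x. E x $ 1 $ 2 - q * E x $ 2 $ 2"])
       (auto intro!: holomorphic_intros hol simp: q_def nz)
  define E' where "E' = (\<lambda>x. mat2 (E x $ 1 $ 1 - q * E x $ 2 $ 1) (h x)
      (- r * E x $ 1 $ 1 + (x + r * q) * E x $ 2 $ 1) (E x $ 2 $ 2 - r * h x))"
  have E'hol: "E' mat_holomorphic_on UNIV"
    unfolding E'_def by (intro mat_holomorphic_on_mat2) (auto intro!: holomorphic_intros hol h)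
  have E': "L x ** E x ** mat2 1 0 0 (inverse x) = E' x" if x: "x \<noteq> 0" for x
  proof -
    have "E x $ 1 $ 2 = x * h x + q * E x $ 2 $ 2" using h(2)[of x] by (simp add: algebra_simps)
    thus ?thesis
      using x by (subst mat2_eta[of "E x"]) (simp add: L_def E'_def field_simps)
  qed
  have E'jump: "E' x ** adj2 (C_jump j z x) =
      L x ** (E x ** adj2 (C_jump (j + 1) z x)) ** mat2 1 0 0 (inverse x)" if x: "x \<noteq> 0" for x
    unfolding E'[OF x, symmetric] matrix_mul_assoc[symmetric] C_jump_Suc(1)[OF x] ..
  define G where "G = (\<lambda>x. E x ** adj2 (C_jump (j + 1) z x) ** sigma3_pow x (- m))"
  have lim: "((\<lambda>x. G x $ a $ b) \<longlongrightarrow> (mat 1 :: cmat2) $ a $ b) at_infinity"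
    "((\<lambda>x. x * (G x $ 1 $ 2)) \<longlongrightarrow> R $ 1 $ 2) at_infinity"
    "((\<lambda>x. x * (G x $ 2 $ 1)) \<longlongrightarrow> R $ 2 $ 1) at_infinity" for a b
    unfolding G_def by (rule normalized_limits[OF C R])+
  have E'N: "mat2 (G x $ 1 $ 1 - q * G x $ 2 $ 1) ((G x $ 1 $ 2 - q * G x $ 2 $ 2) * inverse x)
        (- r * G x $ 1 $ 1 + x * G x $ 2 $ 1 + r * q * G x $ 2 $ 1)
        (- r * G x $ 1 $ 2 * inverse x + G x $ 2 $ 2 + r * q * G x $ 2 $ 2 * inverse x) =
      E' x ** adj2 (C_jump j z x) ** sigma3_pow x (- m)" if x: "x \<noteq> 0" for x
  proof -
    have "E' x ** adj2 (C_jump j z x) ** sigma3_pow x (- m) = L x ** G x ** mat2 1 0 0 (inverse x)"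
      unfolding E'jump[OF x] G_def by (simp only: matrix_mul_assoc[symmetric] sigma3_pow_diag_commute)
    also have "\<dots> = mat2 (G x $ 1 $ 1 - q * G x $ 2 $ 1) ((G x $ 1 $ 2 - q * G x $ 2 $ 2) * inverse x)
        (- r * G x $ 1 $ 1 + x * G x $ 2 $ 1 + r * q * G x $ 2 $ 1)
        (- r * G x $ 1 $ 2 * inverse x + G x $ 2 $ 2 + r * q * G x $ 2 $ 2 * inverse x)"
      using x by (subst mat2_eta[of "G x"]) (simp add: L_def field_simps)
    finally show ?thesis ..
  qed
  let ?I = "mat 1 :: cmat2"
  \<comment> \<open>In the lower left entry, x times the entry of G tends to
    \<open>R $ 2 $ 1\<close>, and the term with - r tends to its negative.\<close>
  have "((\<lambda>x. mat2 (G x $ 1 $ 1 - q * G x $ 2 $ 1) ((G x $ 1 $ 2 - q * G x $ 2 $ 2) * inverse x)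
        (- r * G x $ 1 $ 1 + x * G x $ 2 $ 1 + r * q * G x $ 2 $ 1)
        (- r * G x $ 1 $ 2 * inverse x + G x $ 2 $ 2 + r * q * G x $ 2 $ 2 * inverse x)) \<longlongrightarrow>
      mat2 (?I $ 1 $ 1 - q * ?I $ 2 $ 1) ((?I $ 1 $ 2 - q * ?I $ 2 $ 2) * 0)
        (- r * ?I $ 1 $ 1 + R $ 2 $ 1 + r * q * ?I $ 2 $ 1)
        (- r * ?I $ 1 $ 2 * 0 + ?I $ 2 $ 2 + r * q * ?I $ 2 $ 2 * 0)) at_infinity"
    by (intro tendsto_mat2 tendsto_add tendsto_diff tendsto_mult tendsto_const lim tendsto_inverse_0)
  also have "mat2 (?I $ 1 $ 1 - q * ?I $ 2 $ 1) ((?I $ 1 $ 2 - q * ?I $ 2 $ 2) * 0)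
        (- r * ?I $ 1 $ 1 + R $ 2 $ 1 + r * q * ?I $ 2 $ 1)
        (- r * ?I $ 1 $ 2 * 0 + ?I $ 2 $ 2 + r * q * ?I $ 2 $ 2 * 0) = mat 1"
    by (simp add: mat_1_mat2 r_def)
  finally have "((\<lambda>x. E' x ** adj2 (C_jump j z x) ** sigma3_pow x (- m)) \<longlongrightarrow> mat 1) at_infinity"
    by (rule Lim_transform_eventually) (rule eventually_nonzero_at_infinity, rule E'N)
  moreover have "decrease_j m C x = E' x" if "norm x < 1" for x
  proof (cases "x = 0")
    case True
    show ?thesis unfolding dec True
      by (rule fill_in_0[OF E'hol, of 1]) (simp_all add: Cin E')
  next
    case False
    thus ?thesis using that by (simp add: dec fill_in_def Cin E')
  qed
  moreover have "decrease_j m C x = E' x ** adj2 (C_jump j z x)" if "norm x > 1" for x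
  proof -
    have "x \<noteq> 0" using that by auto
    thus ?thesis using that by (simp add: dec fill_in_def Cout E'jump)
  qed
  ultimately have "RH_pieces (C_jump j z) (\<lambda>x. sigma3_pow x (- m)) (decrease_j m C) E'"
    using E'hol by (simp add: RH_pieces_def RH_entire_def)
  moreover have "E' 0 $ 1 $ 1 * E 0 $ 2 $ 2 = 1"
    using RH_entire_C_det[OF Eent, of 0] nz by (simp add: E'_def q_def det_2 field_simps)
  ultimately show ?thesis by (rule that)
qed

text \<open>The mirror image of \<open>decrease_j_pieces\<close>: now the pole arises in the first
  column, and the upper right coefficient restores the normalization.\<close>

lemma increase_j_pieces:
  assumes C: "RH_pieces (C_jump j z) (\<lambda>x. sigma3_pow x (- m)) C E" and nz: "E 0 $ 1 $ 1 \<noteq> 0"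
  obtains E' where "RH_pieces (C_jump (j + 1) z) (\<lambda>x. sigma3_pow x (- m)) (increase_j m C) E'"
proof -
  obtain R where R: "is_residue_coeff m C R" using is_residue_coeff_exists[OF C] by blast
  define r where "r = R $ 1 $ 2"
  define q where "q = E 0 $ 2 $ 1 * inverse (E 0 $ 1 $ 1)"
  define L where "L = (\<lambda>x. mat2 (x + r * q) (- r) (- q) 1)"
  have Cin: "\<And>x. norm x < 1 \<Longrightarrow> C x = E x"
    and Cout: "\<And>x. norm x > 1 \<Longrightarrow> C x = E x ** adj2 (C_jump j z x)"
    and Eent: "RH_entire (C_jump j z) (\<lambda>x. sigma3_pow x (- m)) E"
    using C by (auto simp: RH_pieces_def)
  have hol: "(\<lambda>x. E x $ a $ b) holomorphic_on UNIV" for a b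
    using Eent by (simp add: RH_entire_def mat_holomorphic_on_def)
  have inc: "increase_j m C = fill_in {0} (\<lambda>x. L x ** C x ** mat2 (inverse x) 0 0 1)"
    unfolding increase_j_def residue_coeff_eq[OF R] L_def q_def r_def by (simp add: Let_def Cin)
  obtain h where h: "h holomorphic_on UNIV" "\<And>x. E x $ 2 $ 1 - q * E x $ 1 $ 1 = x * h x"
    by (rule holomorphic_zero_factor[of "\<lambda>x. E x $ 2 $ 1 - q * E x $ 1 $ 1"])
       (auto intro!: holomorphic_intros hol simp: q_def nz)
  define E' where "E' = (\<lambda>x. mat2 (E x $ 1 $ 1 - r * h x) ((x + r * q) * E x $ 1 $ 2 - r * E x $ 2 $ 2)
      (h x) (E x $ 2 $ 2 - q * E x $ 1 $ 2))"
  have E'hol: "E' mat_holomorphic_on UNIV"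
    unfolding E'_def by (intro mat_holomorphic_on_mat2) (auto intro!: holomorphic_intros hol h)
  have E': "L x ** E x ** mat2 (inverse x) 0 0 1 = E' x" if x: "x \<noteq> 0" for x
  proof -
    have "E x $ 2 $ 1 = x * h x + q * E x $ 1 $ 1" using h(2)[of x] by (simp add: algebra_simps)
    thus ?thesis
      using x by (subst mat2_eta[of "E x"]) (simp add: L_def E'_def field_simps)
  qed
  have E'jump: "E' x ** adj2 (C_jump (j + 1) z x) =
      L x ** (E x ** adj2 (C_jump j z x)) ** mat2 (inverse x) 0 0 1" if x: "x \<noteq> 0" for x
    unfolding E'[OF x, symmetric] matrix_mul_assoc[symmetric] C_jump_Suc(2)[OF x] ..
  define G where "G = (\<lambda>x. E x ** adj2 (C_jump j z x) ** sigma3_pow x (- m))"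
  have lim: "((\<lambda>x. G x $ a $ b) \<longlongrightarrow> (mat 1 :: cmat2) $ a $ b) at_infinity"
    "((\<lambda>x. x * (G x $ 1 $ 2)) \<longlongrightarrow> R $ 1 $ 2) at_infinity"
    "((\<lambda>x. x * (G x $ 2 $ 1)) \<longlongrightarrow> R $ 2 $ 1) at_infinity" for a b
    unfolding G_def by (rule normalized_limits[OF C R])+
  have E'N: "mat2 (G x $ 1 $ 1 + r * q * G x $ 1 $ 1 * inverse x - r * G x $ 2 $ 1 * inverse x)
        (x * G x $ 1 $ 2 + r * q * G x $ 1 $ 2 - r * G x $ 2 $ 2)
        ((G x $ 2 $ 1 - q * G x $ 1 $ 1) * inverse x) (G x $ 2 $ 2 - q * G x $ 1 $ 2) =
      E' x ** adj2 (C_jump (j + 1) z x) ** sigma3_pow x (- m)" if x: "x \<noteq> 0" for x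
  proof -
    have "E' x ** adj2 (C_jump (j + 1) z x) ** sigma3_pow x (- m) = L x ** G x ** mat2 (inverse x) 0 0 1"
      unfolding E'jump[OF x] G_def by (simp only: matrix_mul_assoc[symmetric] sigma3_pow_diag_commute)
    also have "\<dots> = mat2 (G x $ 1 $ 1 + r * q * G x $ 1 $ 1 * inverse x - r * G x $ 2 $ 1 * inverse x)
        (x * G x $ 1 $ 2 + r * q * G x $ 1 $ 2 - r * G x $ 2 $ 2)
        ((G x $ 2 $ 1 - q * G x $ 1 $ 1) * inverse x) (G x $ 2 $ 2 - q * G x $ 1 $ 2)"
      using x by (subst mat2_eta[of "G x"]) (simp add: L_def field_simps)
    finally show ?thesis ..
  qed
  let ?I = "mat 1 :: cmat2"
  have "((\<lambda>x. mat2 (G x $ 1 $ 1 + r * q * G x $ 1 $ 1 * inverse x - r * G x $ 2 $ 1 * inverse x)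
        (x * G x $ 1 $ 2 + r * q * G x $ 1 $ 2 - r * G x $ 2 $ 2)
        ((G x $ 2 $ 1 - q * G x $ 1 $ 1) * inverse x) (G x $ 2 $ 2 - q * G x $ 1 $ 2)) \<longlongrightarrow>
      mat2 (?I $ 1 $ 1 + r * q * ?I $ 1 $ 1 * 0 - r * ?I $ 2 $ 1 * 0)
        (R $ 1 $ 2 + r * q * ?I $ 1 $ 2 - r * ?I $ 2 $ 2)
        ((?I $ 2 $ 1 - q * ?I $ 1 $ 1) * 0) (?I $ 2 $ 2 - q * ?I $ 1 $ 2)) at_infinity"
    by (intro tendsto_mat2 tendsto_add tendsto_diff tendsto_mult tendsto_const lim tendsto_inverse_0)
  also have "mat2 (?I $ 1 $ 1 + r * q * ?I $ 1 $ 1 * 0 - r * ?I $ 2 $ 1 * 0)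
        (R $ 1 $ 2 + r * q * ?I $ 1 $ 2 - r * ?I $ 2 $ 2)
        ((?I $ 2 $ 1 - q * ?I $ 1 $ 1) * 0) (?I $ 2 $ 2 - q * ?I $ 1 $ 2) = mat 1"
    by (simp add: mat_1_mat2 r_def)
  finally have "((\<lambda>x. E' x ** adj2 (C_jump (j + 1) z x) ** sigma3_pow x (- m)) \<longlongrightarrow> mat 1) at_infinity"
    by (rule Lim_transform_eventually) (rule eventually_nonzero_at_infinity, rule E'N)
  moreover have "increase_j m C x = E' x" if "norm x < 1" for x
  proof (cases "x = 0")
    case True
    show ?thesis unfolding inc True
      by (rule fill_in_0[OF E'hol, of 1]) (simp_all add: Cin E')
  next
    case False
    thus ?thesis using that by (simp add: inc fill_in_def Cin E')
  qed
  moreover have "increase_j m C x = E' x ** adj2 (C_jump (j + 1) z x)" if "norm x > 1" for x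
  proof -
    have "x \<noteq> 0" using that by auto
    thus ?thesis using that by (simp add: inc fill_in_def Cout E'jump)
  qed
  ultimately have "RH_pieces (C_jump (j + 1) z) (\<lambda>x. sigma3_pow x (- m)) (increase_j m C) E'"
    using E'hol by (simp add: RH_pieces_def RH_entire_def)
  thus ?thesis by (rule that)
qed

section \<open>From Problem FN to the intermediate problem\<close>

text \<open>Since \<open>FN_jump\<close> is \<open>P_jump\<close> times \<open>Tmat\<close>,
  multiplying only the interior piece by the inverse of \<open>Tmat\<close> leaves the jump
  \<open>P_jump\<close>.\<close>

lemma FN_pieces_P:
  assumes \<alpha>: "\<alpha> \<noteq> 0" and m: "m \<ge> 0" and M: "problem_FN \<alpha> m y M"
  obtains E where "RH_pieces (P_jump m y) (\<lambda>l. sigma3_pow l m) (M_to_P \<alpha> m y M) E"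
proof (rule RH_solution_imp_RH_entire[OF mat_holomorphic_on_FN_jump[OF \<alpha> m] _ M[unfolded problem_FN_def]])
  fix w :: complex assume "w \<noteq> 0"
  thus "det (FN_jump \<alpha> m y w) = 1" using \<alpha> by (rule det_FN_jump[rotated])
next
  fix E :: "complex \<Rightarrow> cmat2"
  assume E: "RH_entire (FN_jump \<alpha> m y) (\<lambda>l. sigma3_pow l m) E"
    and Min: "\<And>w. norm w < 1 \<Longrightarrow> M w = E w"
    and Mout: "\<And>w. norm w > 1 \<Longrightarrow> M w = E w ** adj2 (FN_jump \<alpha> m y w)"
  have inv: "matrix_inv (Tmat \<alpha> m y w) = adj2 (Tmat \<alpha> m y w)" for w
    using \<alpha> by (intro adj2_mult) simp
  have "M_to_P \<alpha> m y M w = E w ** adj2 (Tmat \<alpha> m y w) ** adj2 (P_jump m y w)" if "norm w > 1" for w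
  proof -
    have "w \<noteq> 0" using that by auto
    hence "adj2 (FN_jump \<alpha> m y w) = adj2 (Tmat \<alpha> m y w) ** adj2 (P_jump m y w)"
      by (simp only: FN_jump_eq[OF \<alpha>] adj2_antimult not_False_eq_True)
    thus ?thesis using that by (simp add: M_to_P_def Mout matrix_mul_assoc)
  qed
  moreover have "M_to_P \<alpha> m y M w = E w ** adj2 (Tmat \<alpha> m y w)" if "norm w < 1" for w
    using that by (simp add: M_to_P_def Min inv)
  ultimately show thesis
    using RH_entire_FN_to_P[OF \<alpha> m E]
    by (intro that[of "\<lambda>l. E l ** adj2 (Tmat \<alpha> m y l)"]) (simp add: RH_pieces_def)
qed

lemma FN_solution_exists:
  assumes \<alpha>: "\<alpha> \<noteq> 0" and m: "m \<ge> 0" and E: "RH_entire (P_jump m y) (\<lambda>l. sigma3_pow l m) E"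
  shows "\<exists>M. problem_FN \<alpha> m y M"
proof -
  define E' where "E' = (\<lambda>l. E l ** Tmat \<alpha> m y l)"
  have "RH_solution (FN_jump \<alpha> m y) (\<lambda>l. sigma3_pow l m)
     (\<lambda>w. if norm w < 1 then E' w else E' w ** adj2 (FN_jump \<alpha> m y w))"
  proof (rule RH_entire_imp_RH_solution[OF mat_holomorphic_on_FN_jump[OF \<alpha> m]])
    show "RH_entire (FN_jump \<alpha> m y) (\<lambda>l. sigma3_pow l m) E'"
      unfolding E'_def by (rule RH_entire_P_to_FN[OF \<alpha> m E])
    show "det (FN_jump \<alpha> m y w) = 1" if "w \<noteq> 0" for w
      using \<alpha> that by (rule det_FN_jump)
  qed simp_all
  thus ?thesis unfolding problem_FN_def by blast
qed

section \<open>The constants c and k\<close>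

lemma c_const_facts: "c_const \<noteq> 0" "norm c_const < 1" "norm c_const > 0" "c_const ^ 3 = \<i> / 12"
proof -
  define t where "t = inverse (root 3 12)"
  have "root 3 12 ^ 3 = (12 :: real)" by simp
  hence t3: "t ^ 3 = 1 / 12" by (simp add: t_def power_inverse inverse_eq_divide power_one_over)
  have t0: "t > 0" by (simp add: t_def)
  have c: "c_const = - \<i> * of_real t" by (simp add: c_const_def t_def)
  have "root 3 12 > 1" by simp
  hence t1: "t < 1" by (simp add: t_def inverse_less_1_iff)
  show "c_const \<noteq> 0" "norm c_const < 1" "norm c_const > 0"
    using t0 t1 by (simp_all add: c norm_mult)
  have "c_const ^ 3 = (- \<i>) ^ 3 * of_real (t ^ 3)" by (simp add: c power_mult_distrib)
  also have "\<dots> = \<i> / 12" unfolding t3 by (simp add: power3_eq_cube)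
  finally show "c_const ^ 3 = \<i> / 12" .
qed

text \<open>The substitution \<lambda> = c/x matches the two phases when 4 i c^3 = -1/3 and 2 i c =
  (2/3)^(1/3). The given c satisfies both, since 2/3 * 12 = 2^3.\<close>

lemma exponent_identity:
  assumes z: "z = of_real (root 3 (2/3)) * y" and x: "x \<noteq> 0"
  shows "2 * \<i> * theta (c_const / x) y = - (1/3) * x powi (-3) + z * x powi (-1)"
proof -
  have c3: "c_const ^ 3 = \<i> / 12" by (rule c_const_facts)
  have "root 3 (2/3) * root 3 12 = root 3 (2/3 * 12)" by (simp only: real_root_mult)
  also have "2/3 * 12 = (2 :: real) ^ 3" by simp
  also have "root 3 (2 ^ 3) = 2" by (rule real_root_power_cancel) simp_all
  finally have r: "root 3 (2/3) * root 3 12 = 2" .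
  have r0: "root 3 12 \<noteq> 0" by simp
  have "a = 2 * inverse b" if "a * b = 2" "b \<noteq> 0" for a b :: real
    using that by (simp add: field_simps)
  from this[OF r r0] have "z = of_real (2 * inverse (root 3 12)) * y" by (simp only: z)
  moreover have "of_real (2 * t) * y = 2 * \<i> * (- \<i> * of_real t) * y" for t by simp
  ultimately have z': "z = 2 * \<i> * c_const * y" by (simp only: c_const_def)
  have "x powi (-3) = inverse (x powi 3)" "x powi (-1) = inverse (x powi 1)"
    by (rule power_int_minus)+
  hence x3: "x powi (-3) = inverse (x ^ 3)" "x powi (-1) = inverse x"
    by (simp_all only: power_int_numeral power_int_1_right)
  have "2 * \<i> * theta (c_const / x) y = 4 * \<i> * c_const ^ 3 * inverse (x ^ 3) + 2 * \<i> * c_const * y * inverse x"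
    using x by (simp add: theta_def field_simps power_divide)
  also have "\<dots> = - (1/3) * x powi (-3) + z * x powi (-1)"
    unfolding c3 z' x3 by simp
  finally show ?thesis .
qed

text \<open>The conjugation of the jumps sees the square of k; squaring turns the factor exp (i pi /
  4) sqrt (2 pi) into the 2 pi i of \<open>nu'\<close>.\<close>

lemma k_const_facts: "k_const m \<noteq> 0"
  "(k_const m)\<^sup>2 = - ((-1) powi m * (c_const powi m)\<^sup>2 / (2 * of_real pi * \<i>))"
proof -
  show "k_const m \<noteq> 0" using c_const_facts(1) by (simp add: k_const_def)
  have i: "(\<i> powi (m + 1))\<^sup>2 = - ((-1) powi m)"
  proof -
    have "(\<i> * \<i>) powi (m + 1) = \<i> powi (m + 1) * \<i> powi (m + 1)"
      by (rule power_int_mult_distrib)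
    hence "(\<i> powi (m + 1))\<^sup>2 = (- 1) powi (m + 1)"
      by (simp only: power2_eq_square i_squared)
    also have "\<dots> = - ((-1) powi m)" by (simp add: power_int_add)
    finally show ?thesis .
  qed
  have e: "(exp (\<i> * of_real pi / 4) :: complex)\<^sup>2 = \<i>"
  proof -
    have "(exp (\<i> * of_real pi / 4) :: complex)\<^sup>2 = exp (\<i> * of_real (pi / 2))"
      by (simp add: power2_eq_square exp_add[symmetric])
    also have "\<dots> = \<i>" by (simp only: cis_conv_exp[symmetric] cis_pi_half)
    finally show ?thesis .
  qed
  have s: "(of_real (sqrt (2 * pi)) :: complex)\<^sup>2 = 2 * of_real pi"
    by (simp flip: of_real_power)
  show "(k_const m)\<^sup>2 = - ((-1) powi m * (c_const powi m)\<^sup>2 / (2 * of_real pi * \<i>))"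
    unfolding k_const_def power_divide power_mult_distrib i e s by simp
qed

text \<open>The right factor in \<open>P_to_Q\<close>. It is antidiagonal, so it exchanges the
  columns and turns the lower triangular jump of P into an upper triangular one.\<close>

definition W :: "int \<Rightarrow> complex \<Rightarrow> cmat2" where
  "W m x = sigma3_pow x (- m) ** sigma1 ** sigma3_pow (k_const m) (-1)"

lemma W_eq:
  assumes "x \<noteq> 0"
  shows "W m x = mat2 0 (k_const m / x powi m) (x powi m / k_const m) 0"
  by (simp add: W_def sigma3_pow_def sigma1_def power_int_minus field_simps)

text \<open>Under \<open>\<lambda> = c / \<xi>\<close> the jump of \<open>P\<close> is conjugated into the jump of \<open>C\<^sup>m\<^sup>,\<^sup>1\<close>; the constants
  \<open>c\<close> and \<open>k\<close> are chosen to make this true.\<close>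

lemma jump_conjugation:
  assumes z: "z = of_real (root 3 (2/3)) * y" and x: "x \<noteq> 0"
  shows "adj2 (P_jump m y (c_const / x)) ** W m x = W m x ** C_jump 1 z x"
proof -
  define e where "e = exp (- (1/3) * x powi (-3) + z * x powi (-1))"
  define X where "X = x powi m"
  define d where "d = c_const powi m"
  define k where "k = k_const m"
  define s where "s = (-1 :: complex) powi m"
  have nz: "X \<noteq> 0" "d \<noteq> 0" "k \<noteq> 0"
    using x c_const_facts(1) k_const_facts(1) by (simp_all add: X_def d_def k_def)
  have k2: "k * k = - (s * (d * d) / (2 * of_real pi * \<i>))"
    using k_const_facts(2)[of m] by (simp add: k_def s_def d_def power2_eq_square)
  have "(c_const / x) powi (- 2 * m) = inverse ((c_const / x) powi (m + m))"
    by (simp flip: power_int_minus)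
  also have "(c_const / x) powi (m + m) = (c_const / x) powi m * (c_const / x) powi m"
    using x c_const_facts(1) by (intro power_int_add) simp
  also have "(c_const / x) powi m = d / X"
    by (simp add: power_int_divide_distrib X_def d_def)
  also have "inverse (d / X * (d / X)) = (X * X) / (d * d)" by (simp add: field_simps)
  finally have P: "adj2 (P_jump m y (c_const / x)) = mat2 1 0 (- (s * ((X * X) / (d * d)) * e)) 1"
    unfolding P_jump_def exponent_identity[OF z x] by (simp add: e_def s_def)
  have Cj: "C_jump 1 z x = mat2 1 (e / (2 * of_real pi * \<i>)) 0 1"
    using x by (simp add: C_jump_def nu'_def e_def)
  have "- (s * ((X * X) / (d * d)) * e) * (k * k) = X * X * (e / (2 * of_real pi * \<i>)) * (s * s)"
    unfolding k2 using nz by (simp add: field_simps)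
  hence key: "- (s * ((X * X) / (d * d)) * e) * (k * k) = X * X * (e / (2 * of_real pi * \<i>))"
    by (simp add: s_def)
  have "A * (k / X) = X / k * B" if "A * (k * k) = X * X * B" for A B :: complex
  proof -
    have "A * (k / X) = A * (k * k) / (k * X)" using nz by (simp add: field_simps)
    also have "\<dots> = X / k * B" unfolding that using nz by (simp add: field_simps)
    finally show ?thesis .
  qed
  from this[OF key]
  have "- (s * ((X * X) / (d * d)) * e) * (k / X) = X / k * (e / (2 * of_real pi * \<i>))" .
  thus ?thesis
    unfolding P Cj W_eq[OF x] by (simp add: X_def k_def)
qed

text \<open>The constant left factor in \<open>P_to_Q\<close>, an involution, and also what remains
  of \<open>W m x\<close> once it is multiplied by the normalizing factor at infinity.\<close>

definition K_mat :: "int \<Rightarrow> cmat2" where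
  "K_mat m = sigma3_pow (k_const m) 1 ** sigma1"

lemma K_mat_eq: "K_mat m = mat2 0 (k_const m) (inverse (k_const m)) 0"
  by (simp add: K_mat_def sigma3_pow_def sigma1_def power_int_minus)

lemma W_sigma3:
  assumes "x \<noteq> 0"
  shows "W m x ** sigma3_pow x (- m) = K_mat m" "W m x ** (K_mat m ** sigma3_pow x m) = mat 1"
  using assms k_const_facts(1)[of m]
  by (simp_all add: W_eq K_mat_eq sigma3_pow_def power_int_minus mat_1_mat2 field_simps)

lemma K_mat_square: "K_mat m ** K_mat m = mat 1"
  using k_const_facts(1)[of m] by (simp add: K_mat_eq mat_1_mat2)

lemma sigma3_pow_quotient_W:
  assumes "x \<noteq> 0"
  shows "sigma3_pow (c_const / x) m ** W m c_const = W m x"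
  using assms c_const_facts(1) k_const_facts(1)[of m]
  by (simp add: W_eq sigma3_pow_def power_int_minus power_int_divide_distrib field_simps)

lemma c_div_norm:
  assumes "x \<noteq> 0"
  shows "norm (c_const / x) > 1 \<longleftrightarrow> norm x < norm c_const" "norm (c_const / x) < 1 \<longleftrightarrow> norm x > norm c_const"
  using assms by (simp_all add: norm_divide field_simps)

lemma RH_entire_P_det:
  assumes "RH_entire (P_jump m y) (\<lambda>l. sigma3_pow l m) E"
  shows "det (E w) = 1"
  by (rule RH_entire_det[OF _ _ assms]) auto

lemma P_to_Q_0:
  assumes P: "RH_pieces (P_jump m y) (\<lambda>l. sigma3_pow l m) P E" and x: "x \<noteq> 0"
  shows "P_to_Q m P x = K_mat m ** adj2 (E 0) ** P (c_const / x) ** W m x"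
proof -
  have P0: "P 0 = E 0" and E: "RH_entire (P_jump m y) (\<lambda>l. sigma3_pow l m) E"
    using P by (simp_all add: RH_pieces_def)
  have "matrix_inv (P 0) = adj2 (E 0)"
    unfolding P0 by (intro adj2_mult(3) RH_entire_P_det[OF E])
  thus ?thesis
    using x unfolding P_to_Q_def fill_in_def K_mat_def W_def by (simp add: matrix_mul_assoc)
qed

text \<open>The inversion \<lambda> = c/x exchanges interior and exterior: the normalization of P at
  infinity makes Q regular at 0, and the inverse of P(0) normalizes Q at infinity. The jump lies on
  |x| = |c|, yet the entire matrix \<open>E'\<close> is already the one belonging to
  \<open>problem_C m 1 z\<close>.\<close>

lemma P_to_Q_pieces:
  assumes z: "z = of_real (root 3 (2/3)) * y"
    and P: "RH_pieces (P_jump m y) (\<lambda>l. sigma3_pow l m) P E"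
  obtains E' where "RH_entire (C_jump 1 z) (\<lambda>x. sigma3_pow x (- m)) E'"
    "\<And>x. norm x < norm c_const \<Longrightarrow> P_to_Q m P x = E' x"
    "\<And>x. norm x > norm c_const \<Longrightarrow> P_to_Q m P x = E' x ** adj2 (C_jump 1 z x)"
    "E' 0 = K_mat m ** adj2 (E 0) ** W m c_const"
proof -
  define A where "A = K_mat m ** adj2 (E 0)"
  have Eent: "RH_entire (P_jump m y) (\<lambda>l. sigma3_pow l m) E"
    and Pin: "\<And>w. norm w < 1 \<Longrightarrow> P w = E w"
    and Pout: "\<And>w. norm w > 1 \<Longrightarrow> P w = E w ** adj2 (P_jump m y w)"
    using P by (auto simp: RH_pieces_def)
  have Ehol: "E mat_holomorphic_on UNIV"
    and Elim: "((\<lambda>l. E l ** adj2 (P_jump m y l) ** sigma3_pow l m) \<longlongrightarrow> mat 1) at_infinity"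
    using Eent by (auto simp: RH_entire_def)
  have detE: "det (E w) = 1" for w
    by (rule RH_entire_P_det[OF Eent])
  \<comment> \<open>The interior piece of Q comes from the exterior piece of P; the value at 0 is
    the limit given by the normalization of P.\<close>
  define E' where "E' = (\<lambda>x. if x = 0 then A ** W m c_const
      else A ** (E (c_const / x) ** adj2 (P_jump m y (c_const / x))) ** W m x)"
  have E'1: "E' x ** adj2 (C_jump 1 z x) = A ** E (c_const / x) ** W m x" if x: "x \<noteq> 0" for x
  proof -
    have "E' x = A ** E (c_const / x) ** (adj2 (P_jump m y (c_const / x)) ** W m x)"
      using x by (simp add: E'_def matrix_mul_assoc)
    also have "\<dots> = A ** E (c_const / x) ** (W m x ** C_jump 1 z x)"
      by (simp only: jump_conjugation[OF z x])
    finally have "E' x ** adj2 (C_jump 1 z x) =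
        A ** E (c_const / x) ** W m x ** (C_jump 1 z x ** adj2 (C_jump 1 z x))"
      by (simp only: matrix_mul_assoc)
    thus ?thesis by (simp add: adj2_mult(1))
  qed
  have "E' mat_holomorphic_on UNIV"
  proof (rule mat_holomorphic_on_removable)
    have "(\<lambda>x. A ** (E (c_const / x) ** adj2 (P_jump m y (c_const / x))) ** W m x) mat_holomorphic_on - {0}"
      unfolding W_def
    proof (intro mat_holomorphic_on_mult mat_holomorphic_on_const mat_holomorphic_on_adj2
        mat_holomorphic_on_sigma3_pow)
      show "(\<lambda>x. E (c_const / x)) mat_holomorphic_on - {0}"
        by (rule mat_holomorphic_on_compose[OF Ehol]) (auto intro!: holomorphic_intros)
      show "(\<lambda>x. P_jump m y (c_const / x)) mat_holomorphic_on - {0}"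
        by (rule mat_holomorphic_on_compose[OF mat_holomorphic_on_P_jump])
           (auto intro!: holomorphic_intros simp: c_const_facts)
    qed
    thus "E' mat_holomorphic_on - {0}"
      by (subst mat_holomorphic_on_cong[where Y =
            "\<lambda>x. A ** (E (c_const / x) ** adj2 (P_jump m y (c_const / x))) ** W m x"])
         (auto simp: E'_def)
    have "filterlim (\<lambda>x. c_const / x) at_infinity (at 0)"
      by (rule filterlim_divide_at_infinity[OF tendsto_const filterlim_ident]) (rule c_const_facts)
    from filterlim_compose[OF Elim this]
    have "((\<lambda>x. A ** (E (c_const / x) ** adj2 (P_jump m y (c_const / x)) ** sigma3_pow (c_const / x) m)
        ** W m c_const) \<longlongrightarrow> A ** mat 1 ** W m c_const) (at 0)"
      by (intro tendsto_mat_mult tendsto_const)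
    moreover have "eventually (\<lambda>x. A ** (E (c_const / x) ** adj2 (P_jump m y (c_const / x)) **
        sigma3_pow (c_const / x) m) ** W m c_const = E' x) (at 0)"
      unfolding eventually_at_filter
    proof (rule always_eventually, intro allI impI)
      fix x :: complex assume x: "x \<noteq> 0"
      show "A ** (E (c_const / x) ** adj2 (P_jump m y (c_const / x)) **
        sigma3_pow (c_const / x) m) ** W m c_const = E' x"
        using x by (simp add: E'_def sigma3_pow_quotient_W[OF x, symmetric] matrix_mul_assoc)
    qed
    ultimately have "(E' \<longlongrightarrow> A ** mat 1 ** W m c_const) (at 0)"
      by (rule Lim_transform_eventually)
    thus "(E' \<longlongrightarrow> E' 0) (at 0)" by (simp add: E'_def)
  qed
  moreover have "((\<lambda>x. E' x ** adj2 (C_jump 1 z x) ** sigma3_pow x (- m)) \<longlongrightarrow> mat 1) at_infinity"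
  proof -
    have c0: "((\<lambda>x. c_const / x) \<longlongrightarrow> 0) at_infinity"
      using tendsto_mult_right_zero[OF tendsto_inverse_0, of c_const] by (simp add: divide_inverse)
    have "(E \<longlongrightarrow> E 0) (nhds 0)"
      using mat_holomorphic_on_tendsto[OF Ehol, of 0 UNIV] tendsto_at_iff_tendsto_nhds by auto
    hence "((\<lambda>x. E (c_const / x)) \<longlongrightarrow> E 0) at_infinity"
      using c0 by (rule filterlim_compose)
    hence "((\<lambda>x. A ** E (c_const / x) ** K_mat m) \<longlongrightarrow> A ** E 0 ** K_mat m) at_infinity"
      by (intro tendsto_mat_mult tendsto_const)
    also have "A ** E 0 ** K_mat m = mat 1"
      unfolding A_def by (simp add: matrix_mul_assoc[symmetric] adj2_mult(2)[OF detE] K_mat_square)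
    finally show ?thesis
    proof (rule Lim_transform_eventually)
      show "eventually (\<lambda>x. A ** E (c_const / x) ** K_mat m =
          E' x ** adj2 (C_jump 1 z x) ** sigma3_pow x (- m)) at_infinity"
      proof (rule eventually_nonzero_at_infinity)
        fix x :: complex assume x: "x \<noteq> 0"
        have "E' x ** adj2 (C_jump 1 z x) ** sigma3_pow x (- m) =
            A ** E (c_const / x) ** (W m x ** sigma3_pow x (- m))"
          unfolding E'1[OF x] by (simp only: matrix_mul_assoc)
        thus "A ** E (c_const / x) ** K_mat m = E' x ** adj2 (C_jump 1 z x) ** sigma3_pow x (- m)"
          unfolding W_sigma3(1)[OF x] ..
      qed
    qed
  qed
  ultimately have E'ent: "RH_entire (C_jump 1 z) (\<lambda>x. sigma3_pow x (- m)) E'"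
    by (simp add: RH_entire_def)
  have inner: "P_to_Q m P x = E' x" if "norm x < norm c_const" "x \<noteq> 0" for x
    using that by (simp add: P_to_Q_0[OF P] E'_def A_def Pout c_div_norm)
  have outer: "P_to_Q m P x = E' x ** adj2 (C_jump 1 z x)" if "norm x > norm c_const" for x
  proof -
    have "x \<noteq> 0" using that by auto
    thus ?thesis using that by (simp add: P_to_Q_0[OF P] E'1 A_def Pin c_div_norm)
  qed
  have zero: "P_to_Q m P 0 = E' 0"
  proof -
    let ?f = "\<lambda>x. sigma3_pow (k_const m) 1 ** sigma1 ** matrix_inv (P 0) ** P (c_const / x) **
      sigma3_pow x (- m) ** sigma1 ** sigma3_pow (k_const m) (-1)"
    have "fill_in {0} ?f 0 = E' 0"
    proof (rule fill_in_0)
      show "E' mat_holomorphic_on UNIV" using E'ent by (simp add: RH_entire_def)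
      show "norm c_const > 0" by (rule c_const_facts)
      fix x :: complex assume "x \<noteq> 0" "norm x < norm c_const"
      hence "P_to_Q m P x = E' x" by (intro inner)
      thus "?f x = E' x" using \<open>x \<noteq> 0\<close> by (simp add: P_to_Q_def fill_in_def)
    qed
    thus ?thesis by (simp add: P_to_Q_def)
  qed
  show ?thesis
  proof (rule that[OF E'ent])
    show "P_to_Q m P x = E' x" if "norm x < norm c_const" for x
      using inner[OF that] zero by (cases "x = 0") auto
    show "E' 0 = K_mat m ** adj2 (E 0) ** W m c_const" by (simp add: E'_def A_def)
  qed (rule outer)
qed

lemma open_norm_gt: "open {w :: complex. r < norm w}"
  by (intro open_Collect_less continuous_intros)

text \<open>Moving the circle does not change the entire matrix. In the annulus between the circles
  Q is the exterior piece, and multiplying by the jump turns it into the interior one.\<close>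

lemma Q_to_C_pieces:
  assumes E: "RH_entire (C_jump 1 z) (\<lambda>x. sigma3_pow x (- m)) E"
    and Qin: "\<And>x. norm x < norm c_const \<Longrightarrow> Q x = E x"
    and Qout: "\<And>x. norm x > norm c_const \<Longrightarrow> Q x = E x ** adj2 (C_jump 1 z x)"
  shows "RH_pieces (C_jump 1 z) (\<lambda>x. sigma3_pow x (- m)) (Q_to_C z Q) E"
proof -
  let ?f = "\<lambda>x. if norm c_const < norm x \<and> norm x < 1 then Q x ** C_jump 1 z x else Q x"
  have f: "?f x = E x" if "norm x \<noteq> norm c_const" "norm x < 1" for x
  proof (cases "norm x < norm c_const")
    case False
    have "?f x = E x ** (adj2 (C_jump 1 z x) ** C_jump 1 z x)"
      using that False by (simp add: Qout matrix_mul_assoc)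
    thus ?thesis by (simp add: adj2_mult(2))
  qed (simp add: Qin)
  have "Q_to_C z Q x = E x" if x: "norm x < 1" for x
  proof (cases "norm x = norm c_const")
    case True
    have "fill_in (sphere 0 (norm c_const)) ?f x = E x"
    proof (rule fill_in_sphere[of E "ball 0 1"])
      show "E mat_holomorphic_on ball 0 1"
        using E by (auto simp: RH_entire_def intro: mat_holomorphic_on_subset)
      show "norm c_const > 0" by (rule c_const_facts)
      show "?f w = E w" if "norm w \<noteq> norm c_const" "w \<in> ball 0 1" for w
        using that by (intro f) auto
    qed (use x True in auto)
    thus ?thesis by (simp add: Q_to_C_def)
  next
    case False
    thus ?thesis using f[of x] x by (simp add: Q_to_C_def fill_in_def)
  qed
  moreover have "Q_to_C z Q x = E x ** adj2 (C_jump 1 z x)" if x: "norm x > 1" for x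
    using x c_const_facts(2) by (simp add: Q_to_C_def fill_in_def Qout)
  ultimately show ?thesis using E by (simp add: RH_pieces_def)
qed

lemma C_to_Q_eq:
  assumes C: "RH_pieces (C_jump 1 z) (\<lambda>x. sigma3_pow x (- m)) C E"
    and Qin: "\<And>x. norm x < norm c_const \<Longrightarrow> Q x = E x"
    and Qout: "\<And>x. norm x > norm c_const \<Longrightarrow> Q x = E x ** adj2 (C_jump 1 z x)"
  shows "agree_off_circle (norm c_const) (C_to_Q z C) Q"
  unfolding agree_off_circle_def
proof (intro allI impI)
  have E: "RH_entire (C_jump 1 z) (\<lambda>x. sigma3_pow x (- m)) E"
    and Cin: "\<And>x. norm x < 1 \<Longrightarrow> C x = E x"
    and Cout: "\<And>x. norm x > 1 \<Longrightarrow> C x = E x ** adj2 (C_jump 1 z x)"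
    using C by (auto simp: RH_pieces_def)
  let ?f = "\<lambda>x. if norm c_const < norm x \<and> norm x < 1 then C x ** matrix_inv (C_jump 1 z x) else C x"
  have f: "?f w = E w ** adj2 (C_jump 1 z w)" if "norm w \<noteq> 1" "norm w > norm c_const" for w
    using that by (cases "norm w < 1") (auto simp: Cin Cout adj2_mult(3))
  fix x :: complex assume x: "norm x \<noteq> norm c_const"
  consider "norm x < norm c_const" | "norm x > norm c_const" "norm x \<noteq> 1" | "norm x = 1"
    using x by linarith
  thus "C_to_Q z C x = Q x"
  proof cases
    case 1
    hence "norm x < 1" using c_const_facts(2) by linarith
    thus ?thesis using 1 by (simp add: C_to_Q_def fill_in_def Cin Qin)
  next
    case 2
    have "C_to_Q z C x = ?f x" using 2 by (simp add: C_to_Q_def fill_in_def)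
    thus ?thesis using f[OF 2(2,1)] Qout[OF 2(1)] by simp
  next
    case 3
    \<comment> \<open>On the unit circle \<open>C\<close> carries no information, but
      \<open>Q\<close> is analytic there, and \<open>fill_in\<close> recovers its value by
      continuity.\<close>
    have "fill_in (sphere 0 1) ?f x = E x ** adj2 (C_jump 1 z x)"
    proof (rule fill_in_sphere[of "\<lambda>x. E x ** adj2 (C_jump 1 z x)" "{w. norm c_const < norm w}"])
      show "(\<lambda>x. E x ** adj2 (C_jump 1 z x)) mat_holomorphic_on {w. norm c_const < norm w}"
        using E c_const_facts(3)
        by (intro mat_holomorphic_on_mult mat_holomorphic_on_adj2
            mat_holomorphic_on_subset[OF mat_holomorphic_on_C_jump])
           (auto simp: RH_entire_def intro: mat_holomorphic_on_subset)
      show "?f w = E w ** adj2 (C_jump 1 z w)" if "norm w \<noteq> 1" "w \<in> {w. norm c_const < norm w}" for w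
        using that by (intro f) auto
    qed (use 3 c_const_facts(2) in \<open>auto simp: open_norm_gt\<close>)
    moreover have "Q x = E x ** adj2 (C_jump 1 z x)"
      using 3 c_const_facts(2) by (intro Qout) simp
    ultimately show ?thesis by (simp add: C_to_Q_def)
  qed
qed

text \<open>The left factor A of Q contains the unknown P(0). As Q(0) = A B with the explicit matrix
  B = \<open>W m c_const\<close>, multiplying by B and the inverse of Q(0) undoes A.\<close>

lemma Q_to_P_eq:
  assumes P: "RH_pieces (P_jump m y) (\<lambda>l. sigma3_pow l m) P E"
    and Q': "agree_off_circle (norm c_const) Q' (P_to_Q m P)"
    and Q'0: "Q' 0 = K_mat m ** adj2 (E 0) ** W m c_const" "invertible (Q' 0)"
  shows "agree_off_circle 1 (Q_to_P m Q') P"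
  unfolding agree_off_circle_def
proof (intro allI impI)
  define A where "A = K_mat m ** adj2 (E 0)"
  define B where "B = W m c_const"
  let ?f = "\<lambda>l. sigma3_pow c_const (- m) ** sigma1 ** sigma3_pow (k_const m) (-1) ** matrix_inv (Q' 0) **
     Q' (c_const / l) ** sigma3_pow (k_const m) 1 ** sigma1 ** sigma3_pow (c_const / l) m"
  obtain Z where Z: "A ** B ** Z = mat 1"
    using Q'0(2) unfolding Q'0(1) A_def B_def invertible_def by blast
  hence inv: "matrix_inv (Q' 0) = Z"
    unfolding Q'0(1) A_def[symmetric] B_def[symmetric] by (rule matrix_inv_unique')
  have "A ** (B ** Z) = mat 1" using Z by (simp only: matrix_mul_assoc)
  hence BZA: "B ** Z ** A = mat 1" by (rule matrix_inv_unique'(3))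
  have f: "?f l = P l" if l: "l \<noteq> 0" "norm l \<noteq> 1" for l
  proof -
    have cl: "c_const / l \<noteq> 0" using l c_const_facts(1) by simp
    have "norm (c_const / l) \<noteq> norm c_const"
      using l c_const_facts(3) by (simp add: norm_divide field_simps)
    hence "Q' (c_const / l) = P_to_Q m P (c_const / l)"
      using Q' by (simp add: agree_off_circle_def)
    also have "\<dots> = A ** P l ** W m (c_const / l)"
      using P_to_Q_0[OF P cl] c_const_facts(1) by (simp add: A_def)
    finally have Q'l: "Q' (c_const / l) = A ** P l ** W m (c_const / l)" .
    have "?f l = B ** Z ** Q' (c_const / l) ** (K_mat m ** sigma3_pow (c_const / l) m)"
      unfolding inv B_def W_def K_mat_def by (simp only: matrix_mul_assoc)
    also have "\<dots> = (B ** Z ** A) ** P l ** (W m (c_const / l) ** (K_mat m ** sigma3_pow (c_const / l) m))"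
      unfolding Q'l by (simp only: matrix_mul_assoc)
    also have "\<dots> = P l"
      unfolding BZA W_sigma3(2)[OF cl] by simp
    finally show ?thesis .
  qed
  fix l :: complex assume l: "norm l \<noteq> 1"
  show "Q_to_P m Q' l = P l"
  proof (cases "l = 0")
    case False
    thus ?thesis using f[OF False l] by (simp add: Q_to_P_def fill_in_def)
  next
    case True
    have "fill_in {0} ?f 0 = E 0"
    proof (rule fill_in_0[of E 1])
      show "E mat_holomorphic_on UNIV" using P by (simp add: RH_pieces_def RH_entire_def)
      fix x :: complex assume "x \<noteq> 0" "norm x < 1"
      thus "?f x = E x" using f[of x] P by (simp add: RH_pieces_def)
    qed simp
    moreover have "P 0 = E 0" using P by (simp add: RH_pieces_def)
    ultimately show ?thesis unfolding True Q_to_P_def by simp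
  qed
qed

lemma P_to_M_eq:
  assumes \<alpha>: "\<alpha> \<noteq> 0" and P': "agree_off_circle 1 P' (M_to_P \<alpha> m y M)"
  shows "agree_off_circle 1 (P_to_M \<alpha> m y P') M"
  unfolding agree_off_circle_def
proof (intro allI impI)
  fix l :: complex assume l: "norm l \<noteq> 1"
  have "matrix_inv (Tmat \<alpha> m y l) ** Tmat \<alpha> m y l = mat 1"
    using \<alpha> by (simp add: adj2_mult)
  hence "M l ** matrix_inv (Tmat \<alpha> m y l) ** Tmat \<alpha> m y l = M l"
    by (simp add: matrix_mul_assoc[symmetric])
  thus "P_to_M \<alpha> m y P' l = M l"
    using l P' by (simp add: P_to_M_def M_to_P_def agree_off_circle_def)
qed

text \<open>The Pade pair supplies one entire matrix with lower right entry b, and uniqueness passes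
  b(0) \<noteq> 0 on to every solution.\<close>

lemma FN_pieces_regular:
  assumes \<alpha>: "\<alpha> \<noteq> 0" and m: "m \<ge> 0" and p: "rational_PII_solution m p" "\<not> is_pole p y"
  shows "\<exists>M. problem_FN \<alpha> m y M"
    "\<And>M E. RH_pieces (P_jump m y) (\<lambda>l. sigma3_pow l m) (M_to_P \<alpha> m y M) E \<Longrightarrow> E 0 $ 2 $ 2 \<noteq> 0"
proof -
  have mn: "int (nat m) = m" using m by simp
  obtain b a where ba: "Pade (nat m) (F_fps y) b a"
    by (rule Pade_exists[of "nat m" p y]) (simp_all add: m p)
  obtain E :: "complex \<Rightarrow> cmat2" where E: "RH_entire (P_jump m y) (\<lambda>l. sigma3_pow l m) E"
    "\<And>l. E l $ 1 $ 2 = poly a (- l)" "\<And>l. E l $ 2 $ 2 = poly b l"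
    by (rule Pade_imp_RH_entire_P[OF ba, unfolded mn], rule that)
  show "\<exists>M. problem_FN \<alpha> m y M" by (rule FN_solution_exists[OF \<alpha> m E(1)])
  fix M and E' :: "complex \<Rightarrow> cmat2"
  assume "RH_pieces (P_jump m y) (\<lambda>l. sigma3_pow l m) (M_to_P \<alpha> m y M) E'"
  hence E': "RH_entire (P_jump m y) (\<lambda>l. sigma3_pow l m) E'" by (simp add: RH_pieces_def)
  have "E' = E" by (rule RH_entire_unique[OF _ _ E(1) E']) auto
  thus "E' 0 $ 2 $ 2 \<noteq> 0" using Pade_coeff_0(1)[OF ba] by (simp add: E(3) poly_0_coeff_0)
qed

section \<open>Uniqueness and the composition of the chain\<close>

lemma problem_FN_unique:
  assumes "\<alpha> \<noteq> 0" "m \<ge> 0" "problem_FN \<alpha> m y M" "problem_FN \<alpha> m y M'"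
  shows "agree_off_circle 1 M M'"
  using assms unfolding problem_FN_def
  by (intro RH_solution_unique[of "FN_jump \<alpha> m y" "\<lambda>l. sigma3_pow l m"] mat_holomorphic_on_FN_jump)
     (auto simp: det_FN_jump)

lemma problem_C_unique:
  assumes "problem_C m j z X" "problem_C m j z X'"
  shows "agree_off_circle 1 X X'"
  using assms unfolding problem_C_def
  by (intro RH_solution_unique[of "C_jump j z" "\<lambda>x. sigma3_pow x (- m)"] mat_holomorphic_on_C_jump) auto

text \<open>Solutions are compared off the jump circle, where their values are determined. The
  backward chain starts from an arbitrary solution \<open>Y\<close> instead of \<open>C0\<close>.
  Existence of the coefficients and nonvanishing of the denominators belong to the conclusion, so
  that no formula rests on default values.\<close>

theorem theorem2p5:
  fixes \<alpha> y z :: complex and m :: int and p :: "complex \<Rightarrow> complex"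
  assumes "\<alpha> \<noteq> 0" and "m \<ge> 0"
    and "rational_PII_solution m p" and "\<not> is_pole p y"
    and "z = of_real (root 3 (2/3)) * y"
  shows
    "(\<exists>M. problem_FN \<alpha> m y M) \<and>
     (\<forall>M M'. problem_FN \<alpha> m y M \<and> problem_FN \<alpha> m y M' \<longrightarrow> agree_off_circle 1 M M') \<and>
     (\<exists>Y. problem_BB m z Y) \<and>
     (\<forall>Y Y'. problem_BB m z Y \<and> problem_BB m z Y' \<longrightarrow> agree_off_circle 1 Y Y') \<and>
     (\<forall>M Y. problem_FN \<alpha> m y M \<and> problem_BB m z Y \<longrightarrow>
        (\<exists>P Q C1 C0 C1' Q' P' M'.
           P = M_to_P \<alpha> m y M \<and> invertible (P 0) \<and>
           Q = P_to_Q m P \<and>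
           C1 = Q_to_C z Q \<and> problem_C m 1 z C1 \<and>
           (\<exists>R. is_residue_coeff m C1 R) \<and> C1 0 $ 2 $ 2 \<noteq> 0 \<and>
           C0 = decrease_j m C1 \<and> problem_C m 0 z C0 \<and>
           agree_off_circle 1 C0 Y \<and>
           problem_C m 0 z Y \<and> (\<exists>R. is_residue_coeff m Y R) \<and> Y 0 $ 1 $ 1 \<noteq> 0 \<and>
           C1' = increase_j m Y \<and> agree_off_circle 1 C1' C1 \<and>
           Q' = C_to_Q z C1' \<and> agree_off_circle (norm c_const) Q' Q \<and> invertible (Q' 0) \<and>
           P' = Q_to_P m Q' \<and> agree_off_circle 1 P' P \<and>
           M' = P_to_M \<alpha> m y P' \<and> agree_off_circle 1 M' M))"
proof -
  note z = assms(5)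
  have chain: "\<exists>E EC. let P = M_to_P \<alpha> m y M; Q = P_to_Q m P; C1 = Q_to_C z Q in
      RH_pieces (P_jump m y) (\<lambda>l. sigma3_pow l m) P E \<and> invertible (P 0) \<and>
      RH_pieces (C_jump 1 z) (\<lambda>x. sigma3_pow x (- m)) C1 EC \<and>
      (\<forall>x. norm x < norm c_const \<longrightarrow> Q x = EC x) \<and>
      (\<forall>x. norm x > norm c_const \<longrightarrow> Q x = EC x ** adj2 (C_jump 1 z x)) \<and>
      EC 0 = K_mat m ** adj2 (E 0) ** W m c_const \<and> invertible (EC 0) \<and>
      EC 0 $ 2 $ 2 \<noteq> 0"
    if M: "problem_FN \<alpha> m y M" for M
  proof -
    obtain E where E: "RH_pieces (P_jump m y) (\<lambda>l. sigma3_pow l m) (M_to_P \<alpha> m y M) E"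
      by (rule FN_pieces_P[OF assms(1,2) M], rule that)
    obtain EC where EC: "RH_entire (C_jump 1 z) (\<lambda>x. sigma3_pow x (- m)) EC"
      "\<And>x. norm x < norm c_const \<Longrightarrow> P_to_Q m (M_to_P \<alpha> m y M) x = EC x"
      "\<And>x. norm x > norm c_const \<Longrightarrow> P_to_Q m (M_to_P \<alpha> m y M) x = EC x ** adj2 (C_jump 1 z x)"
      "EC 0 = K_mat m ** adj2 (E 0) ** W m c_const"
      by (rule P_to_Q_pieces[OF z E], rule that)
    have "det (E 0) = 1"
      using E by (intro RH_entire_P_det[of m y]) (simp add: RH_pieces_def)
    hence "invertible (M_to_P \<alpha> m y M 0)"
      using E by (simp add: RH_pieces_def adj2_mult(4))
    moreover have "invertible (EC 0)" by (intro adj2_mult(4) RH_entire_C_det[OF EC(1)])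
    \<comment> \<open>The adjugate moves the lower right entry of \<open>E 0\<close> to the upper
      left, and the two antidiagonal factors move it back.\<close>
    moreover have "EC 0 $ 2 $ 2 = E 0 $ 2 $ 2 / c_const powi m"
    proof -
      have "EC 0 = K_mat m ** adj2 (mat2 (E 0 $ 1 $ 1) (E 0 $ 1 $ 2) (E 0 $ 2 $ 1) (E 0 $ 2 $ 2)) ** W m c_const"
        unfolding EC(4) mat2_eta[symmetric] ..
      thus ?thesis
        using k_const_facts(1)[of m] by (simp add: K_mat_eq W_eq[OF c_const_facts(1)] field_simps)
    qed
    hence "EC 0 $ 2 $ 2 \<noteq> 0"
      using FN_pieces_regular(2)[OF assms(1-4) E] c_const_facts(1) by simp
    moreover note Q_to_C_pieces[OF EC(1-3)]
    ultimately show ?thesis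
      unfolding Let_def using E EC(2-4) by (intro exI[of _ E] exI[of _ EC]) simp
  qed
  have BB_exists: "\<exists>Y. problem_BB m z Y"
  proof -
    obtain M where "problem_FN \<alpha> m y M" using FN_pieces_regular(1)[OF assms(1-4)] by blast
    from chain[OF this] obtain EC where
      EC: "RH_pieces (C_jump (0 + 1) z) (\<lambda>x. sigma3_pow x (- m)) (Q_to_C z (P_to_Q m (M_to_P \<alpha> m y M))) EC"
        "EC 0 $ 2 $ 2 \<noteq> 0"
      unfolding Let_def by auto
    obtain E' where "RH_pieces (C_jump 0 z) (\<lambda>x. sigma3_pow x (- m))
        (decrease_j m (Q_to_C z (P_to_Q m (M_to_P \<alpha> m y M)))) E'"
      by (rule decrease_j_pieces[OF EC], rule that)
    thus ?thesis unfolding problem_C_0_eq_BB[symmetric] by (blast intro: pieces_problem_C)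
  qed
  have main: "\<exists>P Q C1 C0 C1' Q' P' M'.
           P = M_to_P \<alpha> m y M \<and> invertible (P 0) \<and>
           Q = P_to_Q m P \<and>
           C1 = Q_to_C z Q \<and> problem_C m 1 z C1 \<and>
           (\<exists>R. is_residue_coeff m C1 R) \<and> C1 0 $ 2 $ 2 \<noteq> 0 \<and>
           C0 = decrease_j m C1 \<and> problem_C m 0 z C0 \<and>
           agree_off_circle 1 C0 Y \<and>
           problem_C m 0 z Y \<and> (\<exists>R. is_residue_coeff m Y R) \<and> Y 0 $ 1 $ 1 \<noteq> 0 \<and>
           C1' = increase_j m Y \<and> agree_off_circle 1 C1' C1 \<and>
           Q' = C_to_Q z C1' \<and> agree_off_circle (norm c_const) Q' Q \<and> invertible (Q' 0) \<and>
           P' = Q_to_P m Q' \<and> agree_off_circle 1 P' P \<and>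
           M' = P_to_M \<alpha> m y P' \<and> agree_off_circle 1 M' M"
    if M: "problem_FN \<alpha> m y M" and Y: "problem_BB m z Y" for M Y
  proof -
    define P where "P = M_to_P \<alpha> m y M"
    define Q where "Q = P_to_Q m P"
    define C1 where "C1 = Q_to_C z Q"
    define C0 where "C0 = decrease_j m C1"
    define C1' where "C1' = increase_j m Y"
    define Q' where "Q' = C_to_Q z C1'"
    obtain E EC where P: "RH_pieces (P_jump m y) (\<lambda>l. sigma3_pow l m) P E" and P0: "invertible (P 0)"
      and C1: "RH_pieces (C_jump 1 z) (\<lambda>x. sigma3_pow x (- m)) C1 EC"
      and Qin: "\<And>x. norm x < norm c_const \<Longrightarrow> Q x = EC x"
      and Qout: "\<And>x. norm x > norm c_const \<Longrightarrow> Q x = EC x ** adj2 (C_jump 1 z x)"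
      and EC0: "EC 0 = K_mat m ** adj2 (E 0) ** W m c_const" "invertible (EC 0)" "EC 0 $ 2 $ 2 \<noteq> 0"
      using chain[OF M] unfolding Let_def P_def[symmetric] Q_def[symmetric] C1_def[symmetric] by blast
    have C1_0: "C1 0 = EC 0" using C1 by (simp add: RH_pieces_def)
    have C1z: "RH_pieces (C_jump (0 + 1) z) (\<lambda>x. sigma3_pow x (- m)) C1 EC"
      using C1 by simp
    obtain E0 where C0: "RH_pieces (C_jump 0 z) (\<lambda>x. sigma3_pow x (- m)) C0 E0"
      and E0: "E0 0 $ 1 $ 1 * EC 0 $ 2 $ 2 = 1"
      by (rule decrease_j_pieces[OF C1z EC0(3), folded C0_def], rule that)
    have Y': "problem_C m 0 z Y" using Y by (simp add: problem_C_0_eq_BB)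
    obtain EY where EY: "RH_pieces (C_jump 0 z) (\<lambda>x. sigma3_pow x (- m)) Y EY"
      by (rule problem_C_pieces[OF Y'], rule that)
    \<comment> \<open>Uniqueness passes the product relation of \<open>decrease_j_pieces\<close> on
      to the given \<open>Y\<close>: its upper left entry at 0 is the reciprocal of the denominator
      used in decreasing \<open>j\<close>.\<close>
    have "EY = E0" using C0 EY by (intro RH_entire_C_unique) (auto simp: RH_pieces_def)
    have EY0: "EY 0 $ 1 $ 1 \<noteq> 0" using E0 unfolding \<open>EY = E0\<close> by auto
    have Y0: "Y 0 = EY 0" using EY by (simp add: RH_pieces_def)
    obtain E1 where "RH_pieces (C_jump (0 + 1) z) (\<lambda>x. sigma3_pow x (- m)) C1' E1"
      by (rule increase_j_pieces[OF EY EY0, folded C1'_def], rule that)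
    hence E1: "RH_pieces (C_jump 1 z) (\<lambda>x. sigma3_pow x (- m)) C1' E1" by simp
    \<comment> \<open>Uniqueness, instead of a matrix computation, shows that increasing
      \<open>j\<close> undoes decreasing it.\<close>
    have "E1 = EC" using C1 E1 by (intro RH_entire_C_unique) (auto simp: RH_pieces_def)
    note C1' = E1[unfolded this]
    have Q': "agree_off_circle (norm c_const) Q' Q"
      unfolding Q'_def by (rule C_to_Q_eq[OF C1' Qin Qout])
    have "Q' 0 = Q 0" using Q' c_const_facts(3) by (simp add: agree_off_circle_def)
    hence Q'0: "Q' 0 = EC 0" using Qin[of 0] c_const_facts(3) by simp
    have P': "agree_off_circle 1 (Q_to_P m Q') P"
      using Q' EC0 unfolding Q_def by (intro Q_to_P_eq[OF P]) (simp_all add: Q'0)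
    have res1: "\<exists>R. is_residue_coeff m C1 R"
      by (rule is_residue_coeff_exists[OF C1], rule exI)
    have res2: "\<exists>R. is_residue_coeff m Y R"
      by (rule is_residue_coeff_exists[OF EY], rule exI)
    have C1_22: "C1 0 $ 2 $ 2 \<noteq> 0" unfolding C1_0 by (rule EC0)
    have Y_11: "Y 0 $ 1 $ 1 \<noteq> 0" unfolding Y0 by (rule EY0)
    have Q'_inv: "invertible (Q' 0)" unfolding Q'0 by (rule EC0)
    have M': "agree_off_circle 1 (P_to_M \<alpha> m y (Q_to_P m Q')) M"
      by (rule P_to_M_eq[OF assms(1) P'[unfolded P_def]])
    show ?thesis
      by (rule exI[of _ P], rule exI[of _ Q], rule exI[of _ C1], rule exI[of _ C0], rule exI[of _ C1'],
          rule exI[of _ Q'], rule exI[of _ "Q_to_P m Q'"], rule exI[of _ "P_to_M \<alpha> m y (Q_to_P m Q')"],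
          intro conjI, rule P_def, rule P0, rule Q_def, rule C1_def, rule pieces_problem_C[OF C1],
          rule res1, rule C1_22, rule C0_def, rule pieces_problem_C[OF C0],
          rule problem_C_unique[OF pieces_problem_C[OF C0] Y'], rule Y', rule res2, rule Y_11,
          rule C1'_def, rule pieces_agree[OF C1' C1], rule Q'_def, rule Q', rule Q'_inv,
          rule refl, rule P', rule refl, rule M')
  qed
  have BB_unique: "agree_off_circle 1 Y Y'" if "problem_BB m z Y" "problem_BB m z Y'" for Y Y'
    using that unfolding problem_C_0_eq_BB[symmetric] by (rule problem_C_unique)
  show ?thesis
    by (intro conjI allI impI; (elim conjE)?)
       (rule FN_pieces_regular(1)[OF assms(1-4)], rule problem_FN_unique[OF assms(1,2)], assumption+,
        rule BB_exists, rule BB_unique, assumption+, rule main)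
qed

end
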